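(* Let $k$ be an algebraically closed field of characteristic $2$, and let $\nu,m\ge 1$. (i) The field $K_{2\nu\times m}^{O(2\nu)}$ is generated over $k$ by the algebraically independent invariants $Q^{(i)}$ ($1\le i\le\min(m,2\nu)$) and $B^{(ij)}$ ($1\le i<j\le m$, $i\le 2\nu$). (ii) For $m<2\nu$ we have $K_{2\nu\times m}^{SO(2\nu)}=K_{2\nu\times m}^{O(2\nu)}$. For $m\ge 2\nu$, the field $K_{2\nu\times m}^{SO(2\nu)}$ is a quadratic extension of $K_{2\nu\times m}^{O(2\nu)}$, generated for example by the invariant $\Delta$. (iii) The field $K_{(2\nu+1)\times m}^{SO(2\nu+1)}$ is generated over $k$ by the algebraically independent invariants $Q^{(i)}$ ($1\le i\le\min(m,2\nu)$), $B^{(ij)}$ ($1\le i<j\le m$, $i\le 2\nu$), and $D^{(1,\dots,2\nu,l)}$ ($2\nu+1\le l\le m$).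
   Context: $k$ is an algebraically closed field of characteristic $2$. Coordinates on $k^n$ are $x_1,\dots,x_\nu,y_1,\dots,y_\nu$ if $n=2\nu$, and $x_1,\dots,x_\nu,y_1,\dots,y_\nu,z$ if $n=2\nu+1$. The standard quadratic form is $q=\sum_{t=1}^\nu x_ty_t$ if $n=2\nu$ and $q=\sum_{t=1}^\nu x_ty_t+z^2$ if $n=2\nu+1$; its polar form is $\beta(v,w)=q(v+w)-q(v)-q(w)$. $O(n)$ is the group of linear automorphisms of $k^n$ preserving $q$; $SO(n)$ is the connected component of the identity in the algebraic group $O(n)$ (so $SO(n)=O(n)$ for odd $n$, and $SO(n)$ has index $2$ in $O(n)$ for even $n$). $K_{n\times m}$ is the field of rational functions over $k$ in the coordinates of $m$ indeterminate vectors $v^{(1)},\dots,v^{(m)}$ in $k^n$; $O(n)$ acts diagonally, and a superscript group denotes the subfield of invariants. $Q^{(i)}=q(v^{(i)})$, $B^{(ij)}=\beta(v^{(i)},v^{(j)})$, and $D^{(i_1,\dots,i_n)}=\det[v^{(i_1)},\dots,v^{(i_n)}]$ is the determinant of the matrix with the indicated columns. Definition of $\Delta$ (for $n=2\nu$, $m\ge 2\nu$): working over $\mathbb{Z}$ in the variables $x_t^{(i)},y_t^{(i)}$ ($1\le t\le\nu$, $1\le i\le2\nu$), put $B^{(ij)}=\sum_{t=1}^{\nu}\left(x_t^{(i)}y_t^{(j)}+y_t^{(i)}x_t^{(j)}\right)$ and $D=\det[v^{(1)},\dots,v^{(2\nu)}]$, and consider the sum $\sum B^{(i_1i_2)}B^{(i_3i_4)}\cdots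 B^{(i_{2\nu-1}i_{2\nu})}$ over those permutations $i_1,\dots,i_{2\nu}$ of $1,\dots,2\nu$ with $i_1<i_2$, ..., $i_{2\nu-1}<i_{2\nu}$ and $i_1<i_3<\dots<i_{2\nu-1}$. The difference of this sum and $D$ has all coefficients even, and $\Delta$ is the integer polynomial with $2\Delta=\sum B^{(i_1i_2)}\cdots B^{(i_{2\nu-1}i_{2\nu})}-D$, viewed over $k$ by reducing its coefficients modulo $2$. It is an $SO(2\nu)$-invariant. *)

theory Defs
  imports
    "HOL-Library.Poly_Mapping"
    "HOL-Library.Product_Lexorder"
    "HOL-Algebra.Embedded_Algebras"
    "HOL-Algebra.Generated_Fields"
    "HOL-Analysis.Abstract_Topology_2"
    "Jordan_Normal_Form.VS_Connect"
begin

section \<open>Polynomials in an arbitrary set of variables\<close>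

text \<open>
  Monomials are finitely supported exponent vectors.  The lexicographic order on pairs is imported
  only because the library's integral domain instance for polynomials asks for linearly ordered
  variables; it plays no role in the mathematics.
\<close>

type_synonym ('x, 'a) mpoly = "('x \<Rightarrow>\<^sub>0 nat) \<Rightarrow>\<^sub>0 'a"

definition Var :: "'x \<Rightarrow> ('x, 'a::zero_neq_one) mpoly" where
  "Var x = Poly_Mapping.single (Poly_Mapping.single x 1) 1"

definition Const :: "'a \<Rightarrow> ('x, 'a::zero) mpoly" where
  "Const c = Poly_Mapping.single 0 c"

definition vars :: "('x, 'a::zero) mpoly \<Rightarrow> 'x set" where
  "vars p = (\<Union>e\<in>Poly_Mapping.keys p. Poly_Mapping.keys e)"

definition mon_eval :: "('x \<Rightarrow> 'r) \<Rightarrow> ('x \<Rightarrow>\<^sub>0 nat) \<Rightarrow> 'r::comm_ring_1" where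
  "mon_eval s e = (\<Prod>x\<in>Poly_Mapping.keys e. s x ^ Poly_Mapping.lookup e x)"

text \<open>Evaluation at \<open>s\<close> of a polynomial whose coefficients are transported along \<open>h\<close>.\<close>

definition poly_eval ::
    "('a::zero \<Rightarrow> 'r) \<Rightarrow> ('x \<Rightarrow> 'r) \<Rightarrow> ('x, 'a) mpoly \<Rightarrow> 'r::comm_ring_1" where
  "poly_eval h s p = (\<Sum>e\<in>Poly_Mapping.keys p. h (Poly_Mapping.lookup p e) * mon_eval s e)"

lemma mon_eval_superset:
  assumes "finite S" "Poly_Mapping.keys e \<subseteq> S"
  shows "mon_eval s e = (\<Prod>x\<in>S. s x ^ Poly_Mapping.lookup e x)"
  unfolding mon_eval_def
  by (rule prod.mono_neutral_left) (use assms in \<open>auto simp: in_keys_iff\<close>)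

lemma mon_eval_0 [simp]: "mon_eval s 0 = 1"
  by (simp add: mon_eval_def)

lemma mon_eval_add: "mon_eval s (d + e) = mon_eval s d * mon_eval s e"
proof -
  let ?S = "Poly_Mapping.keys d \<union> Poly_Mapping.keys e"
  have "Poly_Mapping.keys (d + e) \<subseteq> ?S" by (rule Poly_Mapping.keys_add)
  then show ?thesis
    by (simp add: mon_eval_superset[of ?S] lookup_add power_add prod.distrib)
qed

lemma mpoly_eq_sum_single:
  "p = (\<Sum>e\<in>Poly_Mapping.keys p. Poly_Mapping.single e (Poly_Mapping.lookup p e))"
  by (rule poly_mapping_eqI)
     (auto simp: lookup_sum lookup_single when_def in_keys_iff sum.delta[OF finite_keys])

context comm_ring_hom
begin

lemma poly_eval_superset:
  assumes "finite S" "Poly_Mapping.keys p \<subseteq> S"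
  shows "poly_eval hom s p = (\<Sum>e\<in>S. hom (Poly_Mapping.lookup p e) * mon_eval s e)"
  unfolding poly_eval_def
  by (rule sum.mono_neutral_left) (use assms in \<open>auto simp: in_keys_iff\<close>)

lemma poly_eval_0 [simp]: "poly_eval hom s 0 = 0"
  by (simp add: poly_eval_def)

lemma poly_eval_single: "poly_eval hom s (Poly_Mapping.single e c) = hom c * mon_eval s e"
  by (simp add: poly_eval_def)

lemma poly_eval_Const [simp]: "poly_eval hom s (Const c) = hom c"
  by (simp add: Const_def poly_eval_single)

lemma poly_eval_1 [simp]: "poly_eval hom s 1 = 1"
  by (simp add: poly_eval_single flip: single_one)

lemma poly_eval_Var [simp]: "poly_eval hom s (Var x) = s x"
  by (simp add: Var_def poly_eval_single mon_eval_def)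

lemma poly_eval_add: "poly_eval hom s (p + r) = poly_eval hom s p + poly_eval hom s r"
proof -
  let ?S = "Poly_Mapping.keys p \<union> Poly_Mapping.keys r"
  have "Poly_Mapping.keys (p + r) \<subseteq> ?S" by (rule Poly_Mapping.keys_add)
  then show ?thesis
    by (simp add: poly_eval_superset[of ?S] lookup_add hom_add distrib_right sum.distrib)
qed

lemma poly_eval_sum: "poly_eval hom s (\<Sum>i\<in>I. p i) = (\<Sum>i\<in>I. poly_eval hom s (p i))"
  by (induction I rule: infinite_finite_induct) (simp_all add: poly_eval_add)

lemma poly_eval_mult: "poly_eval hom s (p * r) = poly_eval hom s p * poly_eval hom s r"
proof -
  let ?s = "\<lambda>p e. Poly_Mapping.single e (Poly_Mapping.lookup p e)"
  have "p * r = (\<Sum>d\<in>Poly_Mapping.keys p. ?s p d) * (\<Sum>e\<in>Poly_Mapping.keys r. ?s r e)"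
    by (simp flip: mpoly_eq_sum_single)
  then have "poly_eval hom s (p * r) =
      (\<Sum>d\<in>Poly_Mapping.keys p. \<Sum>e\<in>Poly_Mapping.keys r. poly_eval hom s (?s p d * ?s r e))"
    by (simp add: sum_product poly_eval_sum)
  also have "\<dots> = poly_eval hom s p * poly_eval hom s r"
    by (simp add: mult_single poly_eval_single hom_mult mon_eval_add sum_product
        poly_eval_def[of hom s p] poly_eval_def[of hom s r] mult_ac)
  finally show ?thesis .
qed

lemma comm_ring_hom_poly_eval: "comm_ring_hom (poly_eval hom s)"
  by unfold_locales (simp_all add: poly_eval_add poly_eval_mult)

end

lemma comm_ring_hom_Const: "comm_ring_hom (Const :: 'a::comm_ring_1 \<Rightarrow> ('x, 'a) mpoly)"
  by unfold_locales (simp_all add: Const_def single_add mult_single)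

lemma comm_ring_hom_id: "comm_ring_hom (\<lambda>c::'a::comm_ring_1. c)"
  by unfold_locales simp_all


section \<open>Fields of rational functions\<close>

text \<open>
  The variable \<open>(i, a)\<close> is the coordinate with index \<open>a\<close> of the indeterminate vector with
  index \<open>i\<close>.  Vectors are counted from 1 and coordinates from 0.
\<close>

type_synonym 'k ratfun = "(nat \<times> nat, 'k) mpoly fract"

definition ratfun_field :: "nat \<Rightarrow> nat \<Rightarrow> 'k::field ratfun set" where
  "ratfun_field n m = {to_fract p / to_fract r | p r.
     r \<noteq> 0 \<and> vars p \<subseteq> {1..m} \<times> {..<n} \<and> vars r \<subseteq> {1..m} \<times> {..<n}}"

definition const :: "'k \<Rightarrow> 'k::field ratfun" where
  "const c = to_fract (Const c)"

text \<open>
  Algebraic independence of a family, so that in particular its members are pairwise distinct.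
\<close>

definition alg_independent :: "'x set \<Rightarrow> ('x \<Rightarrow> 'k::field ratfun) \<Rightarrow> bool" where
  "alg_independent I f \<longleftrightarrow>
     (\<forall>p :: ('x, 'k) mpoly. vars p \<subseteq> I \<longrightarrow> poly_eval const f p = 0 \<longrightarrow> p = 0)"


section \<open>The orthogonal groups\<close>

text \<open>
  For \<open>n = 2 \<nu>\<close> or \<open>n = 2 \<nu> + 1\<close> the coordinates with indices \<open>0, \<dots>, \<nu> - 1\<close> are
  \<open>x\<^sub>1, \<dots>, x\<^sub>\<nu>\<close>, those with indices \<open>\<nu>, \<dots>, 2 \<nu> - 1\<close> are \<open>y\<^sub>1, \<dots>, y\<^sub>\<nu>\<close>, and for
  odd \<open>n\<close> the last one is \<open>z\<close>.
\<close>

definition quad_form :: "nat \<Rightarrow> 'a::comm_ring_1 vec \<Rightarrow> 'a" where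
  "quad_form n v =
     (\<Sum>t<n div 2. v $ t * v $ (n div 2 + t)) + (if odd n then (v $ (n - 1))\<^sup>2 else 0)"

definition polar_form :: "nat \<Rightarrow> 'a::comm_ring_1 vec \<Rightarrow> 'a vec \<Rightarrow> 'a" where
  "polar_form n v w = quad_form n (v + w) - quad_form n v - quad_form n w"

definition orthogonal_group :: "nat \<Rightarrow> 'k::field mat set" where
  "orthogonal_group n = {g \<in> carrier_mat n n.
     invertible_mat g \<and> (\<forall>v \<in> carrier_vec n. quad_form n (g *\<^sub>v v) = quad_form n v)}"

definition mat_zero_locus :: "nat \<Rightarrow> (nat \<times> nat, 'k::field) mpoly set \<Rightarrow> 'k mat set" where
  "mat_zero_locus n P = {g \<in> carrier_mat n n. \<forall>p\<in>P. poly_eval (\<lambda>c. c) (\<lambda>ij. g $$ ij) p = 0}"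

definition zariski_open :: "nat \<Rightarrow> 'k::field mat set \<Rightarrow> bool" where
  "zariski_open n U \<longleftrightarrow> (\<exists>P. U = carrier_mat n n - mat_zero_locus n P)"

definition zariski_topology :: "nat \<Rightarrow> 'k::field mat topology" where
  "zariski_topology n = topology (zariski_open n)"

lemma istopology_zariski: "istopology (zariski_open n :: 'k::field mat set \<Rightarrow> bool)"
proof -
  interpret comm_ring_hom "\<lambda>c::'k. c" by (rule comm_ring_hom_id)
  have "zariski_open n (S \<inter> T)" if S: "zariski_open n S" and T: "zariski_open n T"
    for S T :: "'k mat set"
  proof -
    obtain P R where PR: "S = carrier_mat n n - mat_zero_locus n P"
      "T = carrier_mat n n - mat_zero_locus n R"
      using S T unfolding zariski_open_def by blast
    have "S \<inter> T = carrier_mat n n - mat_zero_locus n {p * r | p r. p \<in> P \<and> r \<in> R}"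
    proof (rule Set.set_eqI)
      fix g :: "'k mat"
      have "(\<exists>p\<in>P. \<exists>r\<in>R. poly_eval (\<lambda>c. c) (\<lambda>ij. g $$ ij) (p * r) \<noteq> 0) \<longleftrightarrow>
          (\<exists>p\<in>P. poly_eval (\<lambda>c. c) (\<lambda>ij. g $$ ij) p \<noteq> 0) \<and>
          (\<exists>r\<in>R. poly_eval (\<lambda>c. c) (\<lambda>ij. g $$ ij) r \<noteq> 0)"
        unfolding poly_eval_mult mult_eq_0_iff by blast
      then show "g \<in> S \<inter> T \<longleftrightarrow>
          g \<in> carrier_mat n n - mat_zero_locus n {p * r | p r. p \<in> P \<and> r \<in> R}"
        unfolding PR mat_zero_locus_def by blast
    qed
    then show ?thesis unfolding zariski_open_def by blast
  qed
  moreover have "zariski_open n (\<Union>\<U>)" if U: "\<forall>U\<in>\<U>. zariski_open n U"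
    for \<U> :: "'k mat set set"
  proof -
    obtain F where F: "\<forall>U\<in>\<U>. U = carrier_mat n n - mat_zero_locus n (F U)"
      using U unfolding zariski_open_def by metis
    have "\<Union>\<U> = carrier_mat n n - mat_zero_locus n (\<Union>U\<in>\<U>. F U)"
      (is "_ = ?R")
    proof (rule Set.set_eqI)
      fix g
      have "g \<in> \<Union>\<U> \<longleftrightarrow> (\<exists>U\<in>\<U>. g \<in> carrier_mat n n - mat_zero_locus n (F U))"
        unfolding Union_iff by (intro bex_cong refl arg_cong[of _ _ "\<lambda>A. g \<in> A"]) (rule F[rule_format])
      also have "\<dots> \<longleftrightarrow> g \<in> ?R" unfolding mat_zero_locus_def by blast
      finally show "g \<in> \<Union>\<U> \<longleftrightarrow> g \<in> ?R" .
    qed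
    then show ?thesis unfolding zariski_open_def by blast
  qed
  ultimately show ?thesis unfolding istopology_def by blast
qed

lemma openin_zariski: "openin (zariski_topology n) U \<longleftrightarrow> zariski_open n U"
  unfolding zariski_topology_def by (simp add: istopology_zariski)

definition special_orthogonal_group :: "nat \<Rightarrow> 'k::field mat set" where
  "special_orthogonal_group n =
     connected_component_of_set (subtopology (zariski_topology n) (orthogonal_group n)) (1\<^sub>m n)"


section \<open>The diagonal action and its invariants\<close>

text \<open>
  \<open>lin_subst g p\<close> is the polynomial \<open>p(g v\<^sup>1, g v\<^sup>2, \<dots>)\<close>.  Since only
  invariance under groups is at stake, \<open>g\<close> may be used here in place of its inverse.
  Coordinates whose index exceeds the size of \<open>g\<close> do not occur in \<open>ratfun_field n m\<close>; they
  are left alone in order that \<open>lin_subst g\<close> be injective for every invertible \<open>g\<close>.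
\<close>

definition lin_subst :: "'k mat \<Rightarrow> (nat \<times> nat, 'k) mpoly \<Rightarrow> (nat \<times> nat, 'k::field) mpoly" where
  "lin_subst g = poly_eval Const (\<lambda>(i, a).
     if a < dim_row g then (\<Sum>b<dim_col g. Const (g $$ (a, b)) * Var (i, b)) else Var (i, a))"

text \<open>The extension to rational functions; \<open>ratfun_act_fraction\<close> below shows that the choice of
  numerator and denominator does not matter.\<close>

definition ratfun_act :: "'k mat \<Rightarrow> 'k ratfun \<Rightarrow> 'k::field ratfun" where
  "ratfun_act g f = (SOME u. \<exists>p r. r \<noteq> 0 \<and> f = to_fract p / to_fract r \<and>
     u = to_fract (lin_subst g p) / to_fract (lin_subst g r))"

definition invariant_field :: "'k mat set \<Rightarrow> nat \<Rightarrow> nat \<Rightarrow> 'k::field ratfun set" where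
  "invariant_field G n m = {f \<in> ratfun_field n m. \<forall>g\<in>G. ratfun_act g f = f}"

lemma comm_ring_hom_lin_subst: "comm_ring_hom (lin_subst g)"
  unfolding lin_subst_def
  by (rule comm_ring_hom.comm_ring_hom_poly_eval[OF comm_ring_hom_Const])

lemma poly_eval_Const_Var: "poly_eval Const Var (p :: ('x, 'a::comm_ring_1) mpoly) = p"
proof -
  have pow: "(Var x :: ('x, 'a) mpoly) ^ k = Poly_Mapping.single (Poly_Mapping.single x k) 1"
    for x :: 'x and k
    by (induction k) (simp_all add: Var_def mult_single flip: single_add)
  have prod: "(\<Prod>x\<in>S. Poly_Mapping.single (m x) (1::'a)) = Poly_Mapping.single (\<Sum>x\<in>S. m x) 1"
    if "finite S" for S and m :: "'x \<Rightarrow> 'x \<Rightarrow>\<^sub>0 nat"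
    using that by (induction S) (simp_all add: mult_single)
  have mon: "mon_eval (Var :: 'x \<Rightarrow> ('x, 'a) mpoly) e = Poly_Mapping.single e 1" for e :: "'x \<Rightarrow>\<^sub>0 nat"
    unfolding mon_eval_def by (simp add: pow prod flip: mpoly_eq_sum_single)
  show ?thesis
    unfolding poly_eval_def mon Const_def
    by (simp add: mult_single flip: mpoly_eq_sum_single)
qed

lemma poly_eval_comp:
  fixes f :: "('x, 'a::comm_ring_1) mpoly \<Rightarrow> ('x, 'a) mpoly"
  assumes "comm_ring_hom f" "\<And>c. f (Const c) = Const c"
  shows "f (poly_eval Const s p) = poly_eval Const (\<lambda>x. f (s x)) p"
proof -
  interpret comm_ring_hom f by fact
  show ?thesis
    unfolding poly_eval_def mon_eval_def
    by (simp add: hom_sum hom_mult hom_prod hom_power assms(2))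
qed

lemma lin_subst_inverse:
  fixes g h :: "'k::field mat"
  assumes g: "g \<in> carrier_mat n n" and h: "h \<in> carrier_mat n n" and gh: "g * h = 1\<^sub>m n"
  shows "lin_subst h (lin_subst g p) = p"
proof -
  interpret C: comm_ring_hom "Const :: 'k \<Rightarrow> (nat \<times> nat, 'k) mpoly" by (rule comm_ring_hom_Const)
  interpret H: comm_ring_hom "lin_subst h" by (rule comm_ring_hom_lin_subst)
  have HC: "lin_subst h (Const c) = Const c" for c
    by (simp add: lin_subst_def)
  have HV: "lin_subst h (Var (i, b)) = (\<Sum>c<n. Const (h $$ (b, c)) * Var (i, c))" if "b < n" for i b
    using h that by (simp add: lin_subst_def)
  have HV': "lin_subst h (Var (i, b)) = Var (i, b)" if "\<not> b < n" for i b
    using h that by (simp add: lin_subst_def)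
  have ent: "(\<Sum>b<n. g $$ (a, b) * h $$ (b, c)) = (if a = c then 1 else 0)"
    if "a < n" "c < n" for a c
  proof -
    have "(g * h) $$ (a, c) = (\<Sum>b<n. g $$ (a, b) * h $$ (b, c))"
      using g h that by (simp add: scalar_prod_def atLeast0LessThan)
    then show ?thesis using gh that by simp
  qed
  have lin: "(\<Sum>b<n. Const (g $$ (a, b)) * lin_subst h (Var (i, b))) = Var (i, a)" if a: "a < n" for i a
  proof -
    have "(\<Sum>b<n. Const (g $$ (a, b)) * lin_subst h (Var (i, b))) =
        (\<Sum>b<n. \<Sum>c<n. Const (g $$ (a, b) * h $$ (b, c)) * Var (i, c))"
      by (intro sum.cong refl) (simp add: HV sum_distrib_left C.hom_mult mult.assoc)
    also have "\<dots> = (\<Sum>c<n. \<Sum>b<n. Const (g $$ (a, b) * h $$ (b, c)) * Var (i, c))"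
      by (rule sum.swap)
    also have "\<dots> = (\<Sum>c<n. Const (\<Sum>b<n. g $$ (a, b) * h $$ (b, c)) * Var (i, c))"
      by (simp add: C.hom_sum sum_distrib_right)
    also have "\<dots> = (\<Sum>c<n. if a = c then Var (i, c) else 0)"
      by (intro sum.cong refl) (use a in \<open>simp add: ent\<close>)
    also have "\<dots> = Var (i, a)" using a by simp
    finally show ?thesis .
  qed
  have sub: "(\<lambda>x. lin_subst h (case x of (i, a) \<Rightarrow> if a < dim_row g
      then \<Sum>b<dim_col g. Const (g $$ (a, b)) * Var (i, b) else Var (i, a))) = Var"
    (is "?l = _")
  proof
    fix x :: "nat \<times> nat"
    obtain i a where x: "x = (i, a)" by (cases x)
    show "?l x = Var x"
      using g lin[of a i] HV'[of a i] by (simp add: x H.hom_sum H.hom_mult HC)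
  qed
  have "lin_subst h (lin_subst g p) = poly_eval Const Var p"
    unfolding lin_subst_def[of g]
    by (subst poly_eval_comp[OF comm_ring_hom_lin_subst HC]) (simp only: sub)
  then show ?thesis by (simp add: poly_eval_Const_Var)
qed

lemma lin_subst_eq_0_iff:
  assumes g: "g \<in> carrier_mat n n" "invertible_mat g"
  shows "lin_subst g p = 0 \<longleftrightarrow> p = 0"
proof -
  interpret G: comm_ring_hom "lin_subst g" by (rule comm_ring_hom_lin_subst)
  obtain h where h: "g * h = 1\<^sub>m (dim_row g)" "h * g = 1\<^sub>m (dim_row h)"
    using g unfolding invertible_mat_def inverts_mat_def by blast
  have "dim_col h = dim_col (g * h)" by simp
  also have "\<dots> = n" using g h by simp
  finally have "dim_col h = n" .
  moreover have "dim_row h = dim_col (h * g)" using h by simp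
  then have "dim_row h = n" using g by simp
  ultimately have "h \<in> carrier_mat n n" by auto
  then have inv: "lin_subst h (lin_subst g p) = p"
    using g h by (intro lin_subst_inverse) auto
  interpret H: comm_ring_hom "lin_subst h" by (rule comm_ring_hom_lin_subst)
  show ?thesis using inv by auto
qed

lemma ratfun_act_fraction:
  assumes g: "g \<in> carrier_mat n n" "invertible_mat g" and r: "r \<noteq> 0"
  shows "ratfun_act g (to_fract p / to_fract r) =
    to_fract (lin_subst g p) / to_fract (lin_subst g r)"
proof -
  interpret G: comm_ring_hom "lin_subst g" by (rule comm_ring_hom_lin_subst)
  have eq: "to_fract (lin_subst g p') / to_fract (lin_subst g r') =
      to_fract (lin_subst g p) / to_fract (lin_subst g r)"
    if r': "r' \<noteq> 0" and e: "to_fract p / to_fract r = to_fract p' / to_fract r'" for p' r'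
  proof -
    have "to_fract (p * r') = to_fract (p' * r)"
      using e r r' by (simp add: field_simps)
    then have "lin_subst g (p * r') = lin_subst g (p' * r)"
      by (simp only: to_fract_eq_iff)
    then have "to_fract (lin_subst g p * lin_subst g r') = to_fract (lin_subst g p' * lin_subst g r)"
      by (simp add: G.hom_mult)
    then show ?thesis
      using r r' lin_subst_eq_0_iff[OF g] by (simp add: field_simps)
  qed
  show ?thesis
    unfolding ratfun_act_def
    by (rule some_equality) (use r eq in blast)+
qed


section \<open>The basic invariants\<close>

definition gvec :: "nat \<Rightarrow> nat \<Rightarrow> (nat \<times> nat, 'a::comm_ring_1) mpoly vec" where
  "gvec n i = vec n (\<lambda>a. Var (i, a))"

definition det_poly :: "nat \<Rightarrow> nat list \<Rightarrow> (nat \<times> nat, 'a::comm_ring_1) mpoly" where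
  "det_poly n is = det (mat_of_cols n (map (gvec n) is))"

definition inv_Q :: "nat \<Rightarrow> nat \<Rightarrow> 'k::field ratfun" where
  "inv_Q n i = to_fract (quad_form n (gvec n i))"

definition inv_B :: "nat \<Rightarrow> nat \<Rightarrow> nat \<Rightarrow> 'k::field ratfun" where
  "inv_B n i j = to_fract (polar_form n (gvec n i) (gvec n j))"

definition inv_D :: "nat \<Rightarrow> nat list \<Rightarrow> 'k::field ratfun" where
  "inv_D n is = to_fract (det_poly n is)"

text \<open>Labels for the generators.  \<open>Dgen l\<close> is meant for \<open>n = 2 \<nu> + 1\<close> only, where it stands for
  \<open>D\<close> with the columns \<open>1, \<dots>, 2 \<nu>, l\<close>.\<close>

datatype gen = Qgen nat | Bgen nat nat | Dgen nat

fun gen_val :: "nat \<Rightarrow> gen \<Rightarrow> 'k::field ratfun" where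
  "gen_val n (Qgen i) = inv_Q n i"
| "gen_val n (Bgen i j) = inv_B n i j"
| "gen_val n (Dgen l) = inv_D n ([1..<n] @ [l])"

definition gens_QB :: "nat \<Rightarrow> nat \<Rightarrow> gen set" where
  "gens_QB \<nu> m = {Qgen i | i. 1 \<le> i \<and> i \<le> min m (2 * \<nu>)} \<union>
     {Bgen i j | i j. 1 \<le> i \<and> i < j \<and> j \<le> m \<and> i \<le> 2 * \<nu>}"

definition gens_D :: "nat \<Rightarrow> nat \<Rightarrow> gen set" where
  "gens_D \<nu> m = {Dgen l | l. 2 * \<nu> + 1 \<le> l \<and> l \<le> m}"


section \<open>The invariant \<open>\<Delta>\<close>\<close>

text \<open>A sequence \<open>i\<^sub>1, \<dots>, i\<^sub>2\<^sub>\<nu>\<close> is represented by the permutation \<open>s\<close> with \<open>s t = i\<^sub>t\<close>.\<close>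

definition pairings :: "nat \<Rightarrow> (nat \<Rightarrow> nat) set" where
  "pairings \<nu> = {s. s permutes {1..2 * \<nu>} \<and>
     (\<forall>t\<in>{1..\<nu>}. s (2 * t - 1) < s (2 * t)) \<and>
     (\<forall>t\<in>{1..\<nu>}. \<forall>u\<in>{1..\<nu>}. t < u \<longrightarrow> s (2 * t - 1) < s (2 * u - 1))}"

definition B_int :: "nat \<Rightarrow> nat \<Rightarrow> nat \<Rightarrow> (nat \<times> nat, int) mpoly" where
  "B_int \<nu> i j = (\<Sum>t<\<nu>. Var (i, t) * Var (j, \<nu> + t) + Var (i, \<nu> + t) * Var (j, t))"

text \<open>The integer polynomials have no 2-torsion, so at most one \<open>P\<close> has the property below.\<close>

definition Delta_int :: "nat \<Rightarrow> (nat \<times> nat, int) mpoly" where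
  "Delta_int \<nu> = (THE P. 2 * P =
     (\<Sum>s\<in>pairings \<nu>. \<Prod>t=1..\<nu>. B_int \<nu> (s (2 * t - 1)) (s (2 * t))) -
     det_poly (2 * \<nu>) [1..<2 * \<nu> + 1])"

definition Delta :: "nat \<Rightarrow> 'k::field ratfun" where
  "Delta \<nu> = to_fract (Poly_Mapping.map of_int (Delta_int \<nu>))"

end

theory Submission imports Defs begin

text \<open>
  Products of reflections move a tuple of vectors in general position to a normal form \<open>w\<close> adapted to the
  hyperbolic planes.  The coordinates of \<open>w\<close> are obtained from its Gram matrix by adjoining roots
  \<open>t\<^sub>s\<close> of quadratic equations, and reflections of \<open>w\<close> with the same Gram matrix exchange the roots of one
  equation at a time.  Hence the value at \<open>w\<close> of a reflection-invariant function is a rational function of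
  the Gram matrix (and of the \<open>D\<close> if \<open>n\<close> is odd), and by density so is the function itself.  The generators
  are independent because their linear parts at the standard basis are distinct variables.

  Since \<open>{c. q(c) \<noteq> 0}\<close> is irreducible, \<open>SO(n)\<close> contains the products of an even number of reflections,
  and for odd \<open>n\<close> all products, because the reflection in the last basis vector is the identity.  For even
  \<open>n\<close> every reflection adds the determinant \<open>D\<close> to \<open>\<Delta>\<close>, and \<open>\<Delta>\<^sup>2 + D \<Delta>\<close> is invariant, so that
  \<open>O(n)\<close> is the disjoint union of the closed sets where \<open>g \<Delta>\<close> is \<open>\<Delta>\<close> or \<open>\<Delta> + D\<close>, and \<open>SO(n)\<close> fixes
  \<open>\<Delta>\<close>.  An \<open>SO(n)\<close>-invariant \<open>f\<close> that a reflection maps to \<open>f'\<close> is \<open>a + b \<Delta>\<close> with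
  \<open>b = (f + f') / D\<close>.  If there are fewer than \<open>n\<close> vectors, some reflection fixes them all, so \<open>SO(n)\<close>
  and \<open>O(n)\<close> have the same invariants.
\<close>


section \<open>Polynomials\<close>

text \<open>The polar form is alternating in characteristic 2, so that there are no orthogonal bases
  to normalise against; hyperbolic planes take their place. Two consecutive vectors share a plane.
  The component of one becomes \<open>(1, a)\<close>, with \<open>a\<close> dictated by
  \<open>q\<close>; that of the other becomes \<open>(t, \<beta> + a t)\<close>, and prescribing its
  \<open>q\<close> is a quadratic equation for \<open>t\<close> whose roots differ by
  \<open>\<beta> / a\<close>. The Gram matrix cannot tell these roots apart, and the reflection in
  \<open>(1, a)\<close> is the isometry responsible for that.

  For \<open>n = 2 \<nu>\<close> the determinant \<open>D\<close> is itself a polynomial in the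
  \<open>B\<close>, namely their hafnian, so that it is fixed by all of \<open>O(n)\<close> and
  cannot single out \<open>SO(n)\<close>. This is why half of a difference that vanishes modulo 2 is
  needed.

  A rational function may be undefined at the normal form; its denominator has to be moved away by
  the group beforehand. All motions are products of reflections, and the full group enters through
  the invariance of the generators alone: its invariants are squeezed between the generated field
  and the invariants of the reflections.\<close>

lemma alg_closed_infinite: "infinite (UNIV :: 'k::alg_closed_field set)"
proof
  assume fin: "finite (UNIV :: 'k set)"
  define p :: "'k poly" where "p = (\<Prod>a\<in>UNIV. [:-a, 1:])"
  have deg: "degree p = card (UNIV :: 'k set)"
    unfolding p_def by (subst degree_prod_eq_sum_degree) (auto simp: fin)
  have "card (UNIV :: 'k set) > 0" using fin by (simp add: finite_UNIV_card_ge_0)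
  then have "degree (p + 1) > 0" using deg
    by (metis degree_1 degree_add_eq_left)
  then obtain x where "poly (p + 1) x = 0" using alg_closed_imp_poly_has_root by blast
  moreover have "poly p x = 0"
    unfolding p_def poly_prod by (rule prod_zero[OF fin]) auto
  ultimately show False by simp
qed

lemma Const_hom [simp]:
  "Const (0::'a::comm_ring_1) = 0" "Const (1::'a) = 1"
  "Const (a + b) = Const a + Const (b::'a)" "Const (a * b) = Const a * Const b"
  "Const (- a) = - Const a" "Const (a - b) = Const a - Const b"
  by (simp_all add: Const_def single_add mult_single single_uminus single_diff)

lemma Const_eq_0_iff [simp]: "Const (a::'a::comm_ring_1) = 0 \<longleftrightarrow> a = 0"
  unfolding Const_def by (metis lookup_single_eq lookup_zero single_zero)

lemma finite_vars [simp]: "finite (vars p)"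
  by (simp add: vars_def)

lemma vars_0 [simp]: "vars 0 = {}"
  by (simp add: vars_def)

lemma vars_Const [simp]: "vars (Const c) = {}"
  by (simp add: vars_def Const_def)

lemma vars_1 [simp]: "vars (1 :: ('x, 'a::comm_ring_1) mpoly) = {}"
  using vars_Const[of "1::'a"] by simp

lemma vars_Var [simp]: "vars (Var x :: ('x, 'a::comm_ring_1) mpoly) = {x}"
  by (simp add: vars_def Var_def)

lemma vars_add: "vars (p + q) \<subseteq> vars p \<union> vars q"
  using Poly_Mapping.keys_add[of p q] by (auto simp: vars_def)

lemma vars_uminus [simp]: "vars (- p :: ('x, 'a::comm_ring_1) mpoly) = vars p"
  by (simp add: vars_def)

lemma vars_diff: "vars (p - q :: ('x, 'a::comm_ring_1) mpoly) \<subseteq> vars p \<union> vars q"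
  using vars_add[of p "- q"] by simp

lemma vars_mult: "vars (p * q :: ('x, 'a::comm_ring_1) mpoly) \<subseteq> vars p \<union> vars q"
proof
  fix x assume "x \<in> vars (p * q)"
  then obtain e where e: "e \<in> Poly_Mapping.keys (p * q)" "x \<in> Poly_Mapping.keys e"
    by (auto simp: vars_def)
  then obtain a b where "e = a + b" "a \<in> Poly_Mapping.keys p" "b \<in> Poly_Mapping.keys q"
    using keys_mult[of p q] by auto
  then show "x \<in> vars p \<union> vars q"
    using e Poly_Mapping.keys_add[of a b] by (auto simp: vars_def)
qed

lemma vars_closed:
  fixes p q :: "('x, 'a::comm_ring_1) mpoly"
  assumes "vars p \<subseteq> S" "vars q \<subseteq> S"
  shows "vars (p + q) \<subseteq> S" "vars (p - q) \<subseteq> S" "vars (p * q) \<subseteq> S"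
  using assms vars_add[of p q] vars_diff[of p q] vars_mult[of p q] by blast+

lemma vars_sum:
  fixes f :: "'i \<Rightarrow> ('x, 'a::comm_ring_1) mpoly"
  assumes "\<And>i. i \<in> I \<Longrightarrow> vars (f i) \<subseteq> S"
  shows "vars (sum f I) \<subseteq> S"
  using assms by (induction I rule: infinite_finite_induct) (simp_all add: vars_closed)

lemma vars_prod:
  fixes f :: "'i \<Rightarrow> ('x, 'a::comm_ring_1) mpoly"
  assumes "\<And>i. i \<in> I \<Longrightarrow> vars (f i) \<subseteq> S"
  shows "vars (prod f I) \<subseteq> S"
  using assms by (induction I rule: infinite_finite_induct) (simp_all add: vars_closed)

lemma vars_power:
  fixes p :: "('x, 'a::comm_ring_1) mpoly"
  assumes "vars p \<subseteq> S"
  shows "vars (p ^ k) \<subseteq> S"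
  using assms by (induction k) (simp_all add: vars_closed)

lemma vars_poly_eval_Const:
  fixes p :: "('x, 'a::comm_ring_1) mpoly"
  assumes "\<And>x. x \<in> vars p \<Longrightarrow> vars (s x) \<subseteq> S"
  shows "vars (poly_eval Const s p :: ('y, 'a) mpoly) \<subseteq> S"
  unfolding poly_eval_def mon_eval_def
  by (intro vars_sum vars_closed vars_prod vars_power assms) (simp, auto simp: vars_def)

lemma poly_eval_cong:
  assumes "\<And>x. x \<in> vars p \<Longrightarrow> s x = t x"
  shows "poly_eval h s p = poly_eval h t p"
  unfolding poly_eval_def mon_eval_def
  by (intro sum.cong prod.cong arg_cong2[of _ _ _ _ "(*)"] arg_cong2[of _ _ _ _ "(^)"] refl assms)
     (auto simp: vars_def)

context comm_ring_hom
begin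

lemma poly_eval_uminus [simp]: "poly_eval hom s (- p) = - poly_eval hom s p"
proof -
  interpret E: comm_ring_hom "poly_eval hom s" by (rule comm_ring_hom_poly_eval)
  show ?thesis by (rule E.hom_uminus)
qed

lemma poly_eval_diff: "poly_eval hom s (p - q) = poly_eval hom s p - poly_eval hom s q"
proof -
  interpret E: comm_ring_hom "poly_eval hom s" by (rule comm_ring_hom_poly_eval)
  show ?thesis by (rule E.hom_minus)
qed

lemma poly_eval_prod: "poly_eval hom s (\<Prod>i\<in>I. p i) = (\<Prod>i\<in>I. poly_eval hom s (p i))"
proof -
  interpret E: comm_ring_hom "poly_eval hom s" by (rule comm_ring_hom_poly_eval)
  show ?thesis by (rule E.hom_prod)
qed

lemma poly_eval_power: "poly_eval hom s (p ^ k) = poly_eval hom s p ^ k"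
proof -
  interpret E: comm_ring_hom "poly_eval hom s" by (rule comm_ring_hom_poly_eval)
  show ?thesis by (rule E.hom_power)
qed

lemmas poly_eval_hom = poly_eval_add poly_eval_diff poly_eval_mult poly_eval_sum poly_eval_prod
  poly_eval_power poly_eval_uminus

lemma poly_eval_subst:
  "poly_eval hom s (poly_eval Const \<rho> p) = poly_eval hom (\<lambda>x. poly_eval hom s (\<rho> x)) p"
  unfolding poly_eval_def[of Const \<rho> p] poly_eval_def[of hom _ p] mon_eval_def
  by (simp add: poly_eval_hom)

end

lemmas eval_simps =
  comm_ring_hom.poly_eval_hom[OF comm_ring_hom_id] comm_ring_hom.poly_eval_Const[OF comm_ring_hom_id]
  comm_ring_hom.poly_eval_Var[OF comm_ring_hom_id] comm_ring_hom.poly_eval_0[OF comm_ring_hom_id]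
  comm_ring_hom.poly_eval_1[OF comm_ring_hom_id] comm_ring_hom.poly_eval_subst[OF comm_ring_hom_id]

section \<open>Nonvanishing of polynomials over infinite fields\<close>

lemma poly_eval_fun_upd:
  fixes p :: "('x, 'a::comm_ring_1) mpoly"
  shows "\<exists>F :: 'a poly. (\<forall>y. poly F y = poly_eval (\<lambda>c. c) (v(x := y)) p) \<and>
    (\<forall>j. coeff F j = (\<Sum>e | e \<in> Poly_Mapping.keys p \<and> Poly_Mapping.lookup e x = j.
      Poly_Mapping.lookup p e * (\<Prod>z\<in>Poly_Mapping.keys e - {x}. v z ^ Poly_Mapping.lookup e z)))"
proof -
  let ?c = "\<lambda>e. Poly_Mapping.lookup p e * (\<Prod>z\<in>Poly_Mapping.keys e - {x}. v z ^ Poly_Mapping.lookup e z)"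
  define F where "F = (\<Sum>e\<in>Poly_Mapping.keys p. monom (?c e) (Poly_Mapping.lookup e x))"
  have "poly F y = poly_eval (\<lambda>c. c) (v(x := y)) p" for y
  proof -
    have "mon_eval (v(x := y)) e = (\<Prod>z\<in>Poly_Mapping.keys e - {x}. v z ^ Poly_Mapping.lookup e z)
        * y ^ Poly_Mapping.lookup e x" for e
    proof -
      have "mon_eval (v(x := y)) e = (\<Prod>z\<in>insert x (Poly_Mapping.keys e - {x}).
          (v(x := y)) z ^ Poly_Mapping.lookup e z)"
        by (intro mon_eval_superset) auto
      also have "\<dots> = y ^ Poly_Mapping.lookup e x *
          (\<Prod>z\<in>Poly_Mapping.keys e - {x}. (v(x := y)) z ^ Poly_Mapping.lookup e z)"
        by (subst prod.insert) auto
      also have "(\<Prod>z\<in>Poly_Mapping.keys e - {x}. (v(x := y)) z ^ Poly_Mapping.lookup e z) =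
          (\<Prod>z\<in>Poly_Mapping.keys e - {x}. v z ^ Poly_Mapping.lookup e z)"
        by (intro prod.cong) auto
      finally show ?thesis by (simp only: mult.commute)
    qed
    then show ?thesis
      by (simp add: F_def poly_sum poly_monom poly_eval_def mult_ac)
  qed
  moreover have "coeff F j = (\<Sum>e | e \<in> Poly_Mapping.keys p \<and> Poly_Mapping.lookup e x = j. ?c e)" for j
    by (simp add: F_def coeff_sum sum.If_cases Int_def flip: Collect_conj_eq)
  ultimately show ?thesis by blast
qed

text \<open>Induction on the set of admissible variables. A nonzero coefficient \<open>q\<close> of
  \<open>p\<close> as a polynomial in \<open>x\<close> is nonzero at some \<open>v\<close> by the
  induction hypothesis, so \<open>p\<close> restricted to the line through \<open>v\<close> in
  direction \<open>x\<close> is a nonzero polynomial in one variable.\<close>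

lemma exists_nonroot_finite_vars:
  fixes p :: "('x, 'k::field) mpoly"
  assumes inf: "infinite (UNIV :: 'k set)" and "finite S"
  shows "vars p \<subseteq> S \<Longrightarrow> p \<noteq> 0 \<Longrightarrow> \<exists>v. poly_eval (\<lambda>c. c) v p \<noteq> 0"
  using \<open>finite S\<close>
proof (induction S arbitrary: p rule: finite_induct)
  case empty
  then have "Poly_Mapping.keys p \<subseteq> {0}"
    by (auto simp: vars_def)
  moreover from \<open>p \<noteq> 0\<close> have "Poly_Mapping.keys p \<noteq> {}" by simp
  ultimately have "Poly_Mapping.keys p = {0}" by blast
  then show ?case
    by (auto simp: poly_eval_def in_keys_iff)
next
  case (insert x S)
  obtain e0 where e0: "e0 \<in> Poly_Mapping.keys p" using \<open>p \<noteq> 0\<close> by fastforce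
  define j where "j = Poly_Mapping.lookup e0 x"
  define E where "E = {e \<in> Poly_Mapping.keys p. Poly_Mapping.lookup e x = j}"
  define del where "del e = e - Poly_Mapping.single x j" for e :: "'x \<Rightarrow>\<^sub>0 nat"
  have finE: "finite E" by (simp add: E_def)
  have lookdel: "Poly_Mapping.lookup (del e) z = (if z = x then 0 else Poly_Mapping.lookup e z)"
    if "e \<in> E" for e z
    using that by (simp add: del_def E_def lookup_minus lookup_single when_def)
  have inj: "inj_on del E"
  proof (rule inj_onI)
    fix a b assume ab: "a \<in> E" "b \<in> E" "del a = del b"
    show "a = b"
    proof (rule poly_mapping_eqI)
      fix z
      show "Poly_Mapping.lookup a z = Poly_Mapping.lookup b z"
        using lookdel[OF ab(1), of z] lookdel[OF ab(2), of z] ab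
        by (cases "z = x") (auto simp: E_def)
    qed
  qed
  have keysdel: "Poly_Mapping.keys (del e) = Poly_Mapping.keys e - {x}" if "e \<in> E" for e
    using lookdel[OF that] by (auto simp: in_keys_iff split: if_splits)
  \<comment> \<open>\<open>q\<close> is the coefficient of the power of \<open>x\<close> that occurs
    in \<open>e0\<close>. As \<open>del\<close> is injective on \<open>E\<close>, no two monomials
    of \<open>p\<close> are merged, and the coefficient of \<open>del e0\<close> survives.\<close>
  define q where "q = (\<Sum>e\<in>E. Poly_Mapping.single (del e) (Poly_Mapping.lookup p e))"
  have "Poly_Mapping.lookup q (del e0) =
      (\<Sum>e\<in>E. if e = e0 then Poly_Mapping.lookup p e else 0)"
    unfolding q_def lookup_sum
  proof (rule sum.cong[OF refl])
    fix e assume "e \<in> E"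
    moreover have "e0 \<in> E" using e0 by (simp add: E_def j_def)
    ultimately have "del e = del e0 \<longleftrightarrow> e = e0" using inj by (simp add: inj_on_eq_iff)
    then show "Poly_Mapping.lookup (Poly_Mapping.single (del e) (Poly_Mapping.lookup p e)) (del e0) =
        (if e = e0 then Poly_Mapping.lookup p e else 0)"
      by (simp only: lookup_single when_def)
  qed
  then have "Poly_Mapping.lookup q (del e0) = Poly_Mapping.lookup p e0"
    using finE e0 by (simp add: E_def j_def)
  moreover have "Poly_Mapping.lookup p e0 \<noteq> 0" using e0 by (simp only: in_keys_iff not_False_eq_True)
  ultimately have "q \<noteq> 0" by (metis lookup_zero)
  moreover have "vars q \<subseteq> S"
    unfolding q_def
  proof (rule vars_sum)
    fix e assume e: "e \<in> E"
    then have "Poly_Mapping.keys (del e) \<subseteq> S"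
      using keysdel[OF e] insert.prems(1) e unfolding E_def vars_def by blast
    then show "vars (Poly_Mapping.single (del e) (Poly_Mapping.lookup p e)) \<subseteq> S"
      by (cases "Poly_Mapping.lookup p e = 0") (simp_all add: vars_def)
  qed
  ultimately obtain v where v: "poly_eval (\<lambda>c. c) v q \<noteq> 0"
    using insert.IH by blast
  obtain F :: "'k poly" where F: "\<And>y. poly F y = poly_eval (\<lambda>c. c) (v(x := y)) p"
    "\<And>j. coeff F j = (\<Sum>e | e \<in> Poly_Mapping.keys p \<and> Poly_Mapping.lookup e x = j.
      Poly_Mapping.lookup p e * (\<Prod>z\<in>Poly_Mapping.keys e - {x}. v z ^ Poly_Mapping.lookup e z))"
    using poly_eval_fun_upd[of v x p] by blast
  have "coeff F j = poly_eval (\<lambda>c. c) v q"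
    unfolding F(2) q_def eval_simps comm_ring_hom.poly_eval_single[OF comm_ring_hom_id] E_def[symmetric] mon_eval_def
    by (intro sum.cong refl arg_cong2[of _ _ _ _ "(*)"] prod.cong)
       (auto simp: keysdel lookdel)
  then have "F \<noteq> 0" using v by auto
  then have "finite {y. poly F y = 0}" by (rule poly_roots_finite)
  then obtain y where "poly F y \<noteq> 0" using inf by (metis (mono_tags, lifting) UNIV_eq_I mem_Collect_eq)
  then show ?case using F(1) by metis
qed

lemma exists_nonroot:
  fixes p :: "('x, 'k::field) mpoly"
  assumes "infinite (UNIV :: 'k set)" "p \<noteq> 0"
  shows "\<exists>v. poly_eval (\<lambda>c. c) v p \<noteq> 0"
  using exists_nonroot_finite_vars[OF assms(1), of "vars p" p] assms(2) by simp

lemma mpoly_ext: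
  fixes p q :: "('x, 'k::field) mpoly"
  assumes "infinite (UNIV :: 'k set)"
    and "\<And>v. poly_eval (\<lambda>c. c) v p = poly_eval (\<lambda>c. c) v q"
  shows "p = q"
proof (rule ccontr)
  assume "p \<noteq> q"
  then have "p - q \<noteq> 0" by simp
  obtain v where "poly_eval (\<lambda>c. c) v (p - q) \<noteq> 0"
    using exists_nonroot[OF assms(1) \<open>p - q \<noteq> 0\<close>] by blast
  then show False using assms(2)[of v] by (simp add: eval_simps)
qed


section \<open>Specialisation of rational functions\<close>

text \<open>Evaluation of a rational function is a relation, because it is only partially defined.\<close>

definition spec :: "('k::field \<Rightarrow> 'r::field) \<Rightarrow> (nat \<times> nat \<Rightarrow> 'r) \<Rightarrow> 'k ratfun \<Rightarrow> 'r \<Rightarrow> bool" where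
  "spec h s y y' \<longleftrightarrow> (\<exists>p r. poly_eval h s r \<noteq> 0 \<and> y = to_fract p / to_fract r \<and>
     y' = poly_eval h s p / poly_eval h s r)"

lemma to_fract_sum' [simp]: "to_fract (sum f A) = sum (\<lambda>x. to_fract (f x)) A"
  by (rule to_fract_sum)

lemma to_fract_prod: "to_fract (prod f A) = prod (\<lambda>x. to_fract (f x)) A"
  by (induction A rule: infinite_finite_induct) auto

lemma to_fract_power: "to_fract (p ^ k) = to_fract p ^ k"
  by (induction k) auto

lemma comm_ring_hom_const: "comm_ring_hom (const :: 'k::field \<Rightarrow> 'k ratfun)"
  by unfold_locales (simp_all add: const_def)

lemma const_hom [simp]:
  "const (0::'k::field) = 0" "const (1::'k) = 1" "const (a + b) = const a + const (b::'k)"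
  "const (a * b) = const a * const b" "const (- a) = - const a" "const (a - b) = const a - const b"
  by (simp_all add: const_def)

lemma const_eq_0_iff [simp]: "const (a::'k::field) = 0 \<longleftrightarrow> a = 0"
  by (simp add: const_def)

lemma const_eq_iff: "const (a::'k::field) = const b \<longleftrightarrow> a = b"
  by (metis const_eq_0_iff const_hom(6) right_minus_eq)

lemma const_inverse: "const (inverse a) = inverse (const (a::'k::field))"
proof (cases "a = 0")
  case False
  then have "const (inverse a) * const a = 1" by (simp flip: const_hom(4))
  then show ?thesis by (metis inverse_unique mult.commute)
qed simp

lemma const_divide: "const (a / b) = const a / const (b::'k::field)"
  by (simp add: divide_inverse const_inverse)

lemmas const_eval_simps =
  comm_ring_hom.poly_eval_hom[OF comm_ring_hom_const] comm_ring_hom.poly_eval_Const[OF comm_ring_hom_const]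
  comm_ring_hom.poly_eval_Var[OF comm_ring_hom_const] comm_ring_hom.poly_eval_0[OF comm_ring_hom_const]
  comm_ring_hom.poly_eval_1[OF comm_ring_hom_const] comm_ring_hom.poly_eval_subst[OF comm_ring_hom_const]

lemmas Const_eval_simps =
  comm_ring_hom.poly_eval_hom[OF comm_ring_hom_Const] comm_ring_hom.poly_eval_Const[OF comm_ring_hom_Const]
  comm_ring_hom.poly_eval_Var[OF comm_ring_hom_Const] comm_ring_hom.poly_eval_0[OF comm_ring_hom_Const]
  comm_ring_hom.poly_eval_1[OF comm_ring_hom_Const] comm_ring_hom.poly_eval_subst[OF comm_ring_hom_Const]

lemma to_fract_poly_eval:
  "to_fract (poly_eval Const s p) = poly_eval const (\<lambda>x. to_fract (s x)) p"
  by (simp add: poly_eval_def mon_eval_def const_def to_fract_prod to_fract_power)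

lemma fraction_cases:
  fixes f :: "'a::idom fract"
  obtains p r where "r \<noteq> 0" "f = to_fract p / to_fract r"
  by (metis Fract_cases Fract_conv_to_fract)

context
  fixes h :: "'k::field \<Rightarrow> 'r::field" and s :: "nat \<times> nat \<Rightarrow> 'r"
  assumes hom: "comm_ring_hom h"
begin

interpretation h: comm_ring_hom h by (rule hom)

lemma spec_denominator: "poly_eval h s r \<noteq> 0 \<Longrightarrow> r \<noteq> 0"
  by auto

lemma spec_fraction:
  "poly_eval h s r \<noteq> 0 \<Longrightarrow> spec h s (to_fract p / to_fract r) (poly_eval h s p / poly_eval h s r)"
  unfolding spec_def by blast

lemma spec_to_fract: "spec h s (to_fract p) (poly_eval h s p)"
  using spec_fraction[of 1 p] by simp

lemma spec_unique:
  assumes "spec h s y a" "spec h s y b"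
  shows "a = b"
proof -
  obtain p r p' r' where *: "poly_eval h s r \<noteq> 0" "y = to_fract p / to_fract r"
    "a = poly_eval h s p / poly_eval h s r" "poly_eval h s r' \<noteq> 0" "y = to_fract p' / to_fract r'"
    "b = poly_eval h s p' / poly_eval h s r'"
    using assms unfolding spec_def by blast
  have "r \<noteq> 0" "r' \<noteq> 0" using * spec_denominator by blast+
  then have "to_fract p * to_fract r' = to_fract p' * to_fract r"
    using *(2,5) by (simp add: field_simps)
  then have "p * r' = p' * r" by (simp flip: to_fract_mult)
  then have "poly_eval h s p * poly_eval h s r' = poly_eval h s p' * poly_eval h s r"
    by (simp flip: h.poly_eval_mult)
  then show ?thesis unfolding *(3,6) using *(1,4) by (simp add: frac_eq_eq)
qed

lemma spec_const: "spec h s (const c) (h c)"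
  using spec_to_fract[of "Const c"] by (simp add: const_def)

lemma spec_0: "spec h s 0 0" and spec_1: "spec h s 1 1"
  using spec_to_fract[of 0] spec_to_fract[of 1] by simp_all

lemma spec_add: "spec h s x a \<Longrightarrow> spec h s y b \<Longrightarrow> spec h s (x + y) (a + b)"
proof -
  assume "spec h s x a" "spec h s y b"
  then obtain p r p' r' where *: "poly_eval h s r \<noteq> 0" "x = to_fract p / to_fract r"
    "a = poly_eval h s p / poly_eval h s r" "poly_eval h s r' \<noteq> 0" "y = to_fract p' / to_fract r'"
    "b = poly_eval h s p' / poly_eval h s r'"
    unfolding spec_def by blast
  have "r \<noteq> 0" "r' \<noteq> 0" using * spec_denominator by blast+
  then have "x + y = to_fract (p * r' + p' * r) / to_fract (r * r')"
    "a + b = poly_eval h s (p * r' + p' * r) / poly_eval h s (r * r')"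
    using * by (simp_all add: h.poly_eval_hom add_frac_eq)
  then show ?thesis using * spec_fraction[of "r * r'" "p * r' + p' * r"]
    by (simp add: h.poly_eval_mult)
qed

lemma spec_mult: "spec h s x a \<Longrightarrow> spec h s y b \<Longrightarrow> spec h s (x * y) (a * b)"
proof -
  assume "spec h s x a" "spec h s y b"
  then obtain p r p' r' where *: "poly_eval h s r \<noteq> 0" "x = to_fract p / to_fract r"
    "a = poly_eval h s p / poly_eval h s r" "poly_eval h s r' \<noteq> 0" "y = to_fract p' / to_fract r'"
    "b = poly_eval h s p' / poly_eval h s r'"
    unfolding spec_def by blast
  then show ?thesis using spec_fraction[of "r * r'" "p * p'"]
    by (simp add: h.poly_eval_mult)
qed

lemma spec_uminus: "spec h s x a \<Longrightarrow> spec h s (- x) (- a)"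
  using spec_mult[OF spec_const[of "-1"], of x a] by (simp add: h.hom_uminus)

lemma spec_diff: "spec h s x a \<Longrightarrow> spec h s y b \<Longrightarrow> spec h s (x - y) (a - b)"
  using spec_add[of x a "- y" "- b"] spec_uminus[of y b] by simp

lemma spec_inverse: "spec h s x a \<Longrightarrow> a \<noteq> 0 \<Longrightarrow> spec h s (inverse x) (inverse a)"
  unfolding spec_def by (metis divide_eq_0_iff inverse_divide)

lemma spec_divide: "spec h s x a \<Longrightarrow> spec h s y b \<Longrightarrow> b \<noteq> 0 \<Longrightarrow> spec h s (x / y) (a / b)"
  unfolding divide_inverse by (intro spec_mult spec_inverse)

lemma spec_power: "spec h s x a \<Longrightarrow> spec h s (x ^ k) (a ^ k)"
  by (induction k) (auto intro: spec_1 spec_mult)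

lemma spec_sum: "(\<And>i. i \<in> I \<Longrightarrow> spec h s (f i) (g i)) \<Longrightarrow> spec h s (sum f I) (sum g I)"
  by (induction I rule: infinite_finite_induct) (auto intro: spec_0 spec_add)

lemma spec_prod: "(\<And>i. i \<in> I \<Longrightarrow> spec h s (f i) (g i)) \<Longrightarrow> spec h s (prod f I) (prod g I)"
  by (induction I rule: infinite_finite_induct) (auto intro: spec_1 spec_mult)

lemma spec_poly_eval:
  assumes "\<And>x. x \<in> vars Z \<Longrightarrow> spec h s (u x) (u' x)"
  shows "spec h s (poly_eval const u Z) (poly_eval h u' Z)"
  unfolding poly_eval_def mon_eval_def
  by (intro spec_sum spec_mult spec_const spec_prod spec_power assms) (auto simp: vars_def)

end

text \<open>Reduces identities of rational functions to points over \<open>k\<close>: a nonzero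
  difference \<open>y\<close> would be defined and nonzero at some point, which can be chosen off
  the hypersurface \<open>D = 0\<close>.\<close>

lemma spec_point_exists:
  fixes y :: "'k::field ratfun"
  assumes inf: "infinite (UNIV :: 'k set)" and "y \<noteq> 0" and "D \<noteq> (0 :: (nat \<times> nat, 'k) mpoly)"
  shows "\<exists>\<xi> a. spec (\<lambda>c. c) \<xi> y a \<and> a \<noteq> 0 \<and> poly_eval (\<lambda>c. c) \<xi> D \<noteq> 0"
proof -
  obtain p r where pr: "r \<noteq> 0" "y = to_fract p / to_fract r" by (rule fraction_cases)
  then have "p * r * D \<noteq> 0" using assms by auto
  then obtain \<xi> where "poly_eval (\<lambda>c. c) \<xi> (p * r * D) \<noteq> 0"
    using exists_nonroot[OF inf] by blast
  then have nz: "poly_eval (\<lambda>c. c) \<xi> p \<noteq> 0" "poly_eval (\<lambda>c. c) \<xi> r \<noteq> 0" "poly_eval (\<lambda>c. c) \<xi> D \<noteq> 0"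
    by (auto simp: eval_simps)
  then have "spec (\<lambda>c. c) \<xi> y (poly_eval (\<lambda>c. c) \<xi> p / poly_eval (\<lambda>c. c) \<xi> r)"
    unfolding pr(2) by (intro spec_fraction comm_ring_hom_id)
  then show ?thesis using nz by (intro exI[of _ \<xi>] exI[of _ "poly_eval (\<lambda>c. c) \<xi> p / poly_eval (\<lambda>c. c) \<xi> r"] conjI) auto
qed


section \<open>Quadratic forms in characteristic 2\<close>

text \<open>Vectors are functions of the coordinate index here, so that the same form serves
  scalars, polynomials and rational functions without carrier conditions.\<close>

definition qf :: "nat \<Rightarrow> (nat \<Rightarrow> 'a::comm_ring_1) \<Rightarrow> 'a" where
  "qf n x = (\<Sum>t<n div 2. x t * x (n div 2 + t)) + (if odd n then (x (n - 1))\<^sup>2 else 0)"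

text \<open>The polar form of \<open>qf\<close> in characteristic 2, where the square of the last
  coordinate contributes \<open>2 z z' = 0\<close>. Hence for odd \<open>n\<close> the last basis
  vector lies in the radical.\<close>

definition bf :: "nat \<Rightarrow> (nat \<Rightarrow> 'a::comm_ring_1) \<Rightarrow> (nat \<Rightarrow> 'a) \<Rightarrow> 'a" where
  "bf n x y = (\<Sum>t<n div 2. x t * y (n div 2 + t) + x (n div 2 + t) * y t)"

text \<open>The form of a reflection that makes sense in every characteristic; in characteristic 2
  it is an orthogonal transvection with centre \<open>c\<close>.\<close>

definition reflect :: "nat \<Rightarrow> (nat \<Rightarrow> 'a::field) \<Rightarrow> (nat \<Rightarrow> 'a) \<Rightarrow> nat \<Rightarrow> 'a" where
  "reflect n c x = (\<lambda>a. x a - bf n x c / qf n c * c a)"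

lemma bf_sym: "bf n x y = bf n y x"
  unfolding bf_def by (intro sum.cong refl) (simp add: algebra_simps)

lemma bf_cong: "(\<And>a. a < n \<Longrightarrow> x a = x' a) \<Longrightarrow> (\<And>a. a < n \<Longrightarrow> y a = y' a) \<Longrightarrow> bf n x y = bf n x' y'"
  unfolding bf_def by (intro sum.cong) auto

lemma qf_cong: "(\<And>a. a < n \<Longrightarrow> x a = x' a) \<Longrightarrow> qf n x = qf n x'"
  unfolding qf_def by (intro arg_cong2[of _ _ _ _ "(+)"] sum.cong) (auto simp: odd_pos)

lemma bf_lin:
  "bf n (\<lambda>a. x a + c * y a) z = bf n x z + c * bf n y z"
  "bf n (\<lambda>a. x a - c * y a) z = bf n x z - c * bf n y z"
  "bf n (\<lambda>a. c * y a) z = c * bf n y z"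
  "bf n z (\<lambda>a. x a + c * y a) = bf n z x + c * bf n z y"
  "bf n z (\<lambda>a. x a - c * y a) = bf n z x - c * bf n z y"
  "bf n z (\<lambda>a. c * y a) = c * bf n z y"
  "bf n (\<lambda>a. x a + y a) z = bf n x z + bf n y z"
  "bf n (\<lambda>a. x a - y a) z = bf n x z - bf n y z"
  "bf n z (\<lambda>a. x a + y a) = bf n z x + bf n z y"
  "bf n z (\<lambda>a. x a - y a) = bf n z x - bf n z y"
  unfolding bf_def sum_distrib_left sum.distrib[symmetric] sum_subtractf[symmetric]
  by (auto intro!: sum.cong simp: algebra_simps)

lemma bf_zero [simp]: "bf n (\<lambda>a. 0) z = 0" "bf n z (\<lambda>a. 0) = 0"
  by (simp_all add: bf_def)

context
  fixes dummy :: "'a::comm_ring_1"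
  assumes two: "(2::'a) = 0"
begin

lemma add_self: "x + x = (0::'a)"
  using two by (metis mult_2 mult_zero_left)

lemma minus_eq: "- x = (x::'a)" and diff_eq: "x - y = x + (y::'a)"
proof -
  show minus: "- x = (x::'a)" for x by (rule minus_unique) (rule add_self)
  show "x - y = x + (y::'a)" by (simp add: diff_conv_add_uminus minus del: add_uminus_conv_diff)
qed

lemma square_add: "(x + y)\<^sup>2 = x\<^sup>2 + (y::'a)\<^sup>2"
  using two by (simp add: power2_sum)

lemma bf_self: "bf n x x = (0::'a)"
  unfolding bf_def by (rule sum.neutral) (simp add: mult.commute add_self)

lemma qf_lin: "qf n (\<lambda>a. x a + c * y a) = qf n x + c\<^sup>2 * qf n y + c * bf n x (y :: nat \<Rightarrow> 'a)"
proof -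
  let ?k = "n div 2"
  have "(\<Sum>t<?k. (x t + c * y t) * (x (?k + t) + c * y (?k + t))) =
      (\<Sum>t<?k. x t * x (?k + t)) + c\<^sup>2 * (\<Sum>t<?k. y t * y (?k + t)) +
      c * (\<Sum>t<?k. x t * y (?k + t) + x (?k + t) * y t)"
    unfolding sum_distrib_left sum.distrib[symmetric]
    by (intro sum.cong refl) (simp add: ring_distribs power2_eq_square mult_ac)
  moreover have "(x (n - 1) + c * y (n - 1))\<^sup>2 = (x (n - 1))\<^sup>2 + c\<^sup>2 * (y (n - 1))\<^sup>2"
    by (simp add: square_add power_mult_distrib)
  ultimately show ?thesis
    unfolding qf_def bf_def by (cases "odd n") (simp_all only: distrib_left if_True if_False, auto)
qed

end

lemma qf_add: "(2::'a::comm_ring_1) = 0 \<Longrightarrow> qf n (\<lambda>a. x a + y a) = qf n x + qf n y + bf n x (y :: nat \<Rightarrow> 'a)"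
  using qf_lin[of n x 1 y] by simp

lemma qf_diff: "(2::'a::comm_ring_1) = 0 \<Longrightarrow> qf n (\<lambda>a. x a - y a) = qf n x + qf n y + bf n x (y :: nat \<Rightarrow> 'a)"
  using qf_add[of n x y] by (simp add: diff_eq)

lemma qf_zero [simp]: "qf n (\<lambda>a. 0) = 0"
  by (simp add: qf_def)

context
  fixes dummy :: "'a::field"
  assumes two: "(2::'a) = 0"
begin

lemma reflect_fix: "bf n x c = (0::'a) \<Longrightarrow> reflect n c x = x"
  by (simp add: reflect_def)

lemma bf_reflect_left: "qf n c \<noteq> (0::'a) \<Longrightarrow> bf n (reflect n c x) c = bf n x c"
  unfolding reflect_def bf_lin bf_self[OF two] by simp

lemma reflect_reflect: "qf n c \<noteq> (0::'a) \<Longrightarrow> reflect n c (reflect n c x) = x"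
proof -
  assume "qf n c \<noteq> 0"
  then have "bf n (reflect n c x) c = bf n x c" by (rule bf_reflect_left)
  then have "reflect n c (reflect n c x) = (\<lambda>a. reflect n c x a - bf n x c / qf n c * c a)"
    by (simp add: reflect_def[of n c "reflect n c x"])
  also have "\<dots> = (\<lambda>a. x a - 2 * (bf n x c / qf n c * c a))"
    by (rule ext) (simp add: reflect_def)
  finally show ?thesis using two by simp
qed

lemma bf_reflect: "qf n c \<noteq> (0::'a) \<Longrightarrow> bf n (reflect n c x) (reflect n c y) = bf n x y"
proof -
  assume "qf n c \<noteq> 0"
  have "bf n (reflect n c x) (reflect n c y) =
      bf n x y - 2 * (bf n x c * bf n y c / qf n c)"
    unfolding reflect_def bf_lin bf_self[OF two] bf_sym[of n c] by (simp add: mult_ac)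
  then show ?thesis using two by simp
qed

lemma qf_reflect: "qf n c \<noteq> (0::'a) \<Longrightarrow> qf n (reflect n c x) = qf n x"
proof -
  assume c: "qf n c \<noteq> 0"
  let ?l = "bf n x c / qf n c"
  have "reflect n c x = (\<lambda>a. x a + ?l * c a)"
    unfolding reflect_def diff_eq[OF two] ..
  then have "qf n (reflect n c x) = qf n x + (?l\<^sup>2 * qf n c + ?l * bf n x c)"
    by (simp only: qf_lin[OF two] add.assoc)
  also have "?l\<^sup>2 * qf n c = ?l * bf n x c" using c by (simp add: power2_eq_square)
  finally show ?thesis by (simp add: add_self[OF two])
qed

lemma qf_diff_isometric: "qf n x = qf n y \<Longrightarrow> qf n (\<lambda>a. x a - y a) = bf n x (y :: nat \<Rightarrow> 'a)"
  by (simp add: qf_diff[OF two] add_self[OF two])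

text \<open>For vectors with the same \<open>q\<close>, characteristic 2 gives
  \<open>q(x - y) = b(x, y) = b(x, x - y)\<close>, so the coefficient of \<open>x - y\<close> in the
  reflection is 1.\<close>

lemma reflect_diff:
  assumes "qf n x = qf n y" "bf n x y \<noteq> (0::'a)"
  shows "reflect n (\<lambda>a. x a - y a) x = y"
proof -
  have "bf n x (\<lambda>a. x a - y a) = - bf n x y"
    unfolding bf_lin bf_self[OF two] by simp
  then have "bf n x (\<lambda>a. x a - y a) = bf n x y" unfolding minus_eq[OF two] .
  then show ?thesis
    unfolding reflect_def qf_diff_isometric[OF assms(1)] using assms(2) by simp
qed

end


section \<open>Isometries and products of reflections\<close>

lemma two_eq_0: "CHAR('a::comm_ring_1) = 2 \<Longrightarrow> (2::'a) = 0"
  using of_nat_CHAR[where ?'a = 'a] by simp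

lemma two_mpoly: "(2::'a::comm_ring_1) = 0 \<Longrightarrow> (2 :: ('x, 'a) mpoly) = 0"
  using Const_hom(3)[of 1 "1::'a"] by (metis Const_hom(1,2) one_add_one)

lemma two_ratfun: "(2::'k::field) = 0 \<Longrightarrow> (2 :: 'k ratfun) = 0"
  using const_hom(3)[of 1 "1::'k"] by (metis const_hom(1,2) one_add_one)

section \<open>Matrices acting on tuples of vectors\<close>

definition crow :: "(nat \<times> nat \<Rightarrow> 'a) \<Rightarrow> nat \<Rightarrow> nat \<Rightarrow> 'a" where
  "crow v i = (\<lambda>a. v (i, a))"

definition mv :: "nat \<Rightarrow> 'a::comm_ring_1 mat \<Rightarrow> (nat \<Rightarrow> 'a) \<Rightarrow> nat \<Rightarrow> 'a" where
  "mv n g x = (\<lambda>a. \<Sum>b<n. g $$ (a, b) * x b)"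

text \<open>Leaves the coordinates from \<open>n\<close> on alone, exactly as
  \<open>lin_subst\<close> does, so that evaluation turns \<open>lin_subst g\<close> into this
  action for all polynomials.\<close>

definition act_pt :: "nat \<Rightarrow> 'a::comm_ring_1 mat \<Rightarrow> (nat \<times> nat \<Rightarrow> 'a) \<Rightarrow> nat \<times> nat \<Rightarrow> 'a" where
  "act_pt n g v = (\<lambda>(i, a). if a < n then mv n g (crow v i) a else v (i, a))"

lemma eval_lin_subst:
  assumes "g \<in> carrier_mat n n"
  shows "poly_eval (\<lambda>c. c) v (lin_subst g p) = poly_eval (\<lambda>c. c) (act_pt n g v) p"
proof -
  have "(\<lambda>x. poly_eval (\<lambda>c. c) v (case x of (i, a) \<Rightarrow> if a < dim_row g
      then \<Sum>b<dim_col g. Const (g $$ (a, b)) * Var (i, b) else Var (i, a))) = act_pt n g v"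
    using assms by (auto simp: act_pt_def mv_def crow_def eval_simps fun_eq_iff)
  then show ?thesis
    unfolding lin_subst_def eval_simps by (rule arg_cong)
qed

lemma lin_subst_hom [simp]:
  "lin_subst g 0 = 0" "lin_subst g 1 = 1" "lin_subst g (p + q) = lin_subst g p + lin_subst g q"
  "lin_subst g (p * q) = lin_subst g p * lin_subst g q" "lin_subst g (- p) = - lin_subst g p"
  "lin_subst g (p - q) = lin_subst g p - lin_subst g q" "lin_subst g (Const c) = Const c"
  unfolding lin_subst_def by (simp_all add: Const_eval_simps)

lemma mv_cong: "(\<And>b. b < n \<Longrightarrow> x b = y b) \<Longrightarrow> mv n g x = mv n g y"
  unfolding mv_def by (intro ext sum.cong) auto

lemma mv_mult:
  assumes "g \<in> carrier_mat n n" "h \<in> carrier_mat n n" "a < n"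
  shows "mv n (g * h) x a = mv n g (mv n h x) a"
proof -
  have "mv n (g * h) x a = (\<Sum>b<n. (\<Sum>c<n. g $$ (a, c) * h $$ (c, b)) * x b)"
    unfolding mv_def using assms
    by (intro sum.cong refl) (simp add: scalar_prod_def atLeast0LessThan)
  also have "\<dots> = (\<Sum>c<n. \<Sum>b<n. g $$ (a, c) * h $$ (c, b) * x b)"
    unfolding sum_distrib_right by (rule sum.swap)
  finally show ?thesis by (simp add: mv_def sum_distrib_left mult.assoc)
qed

lemma crow_act_pt: "a < n \<Longrightarrow> crow (act_pt n g v) i a = mv n g (crow v i) a"
  by (subst crow_def) (simp add: act_pt_def)

lemma act_pt_mult:
  assumes "g \<in> carrier_mat n n" "h \<in> carrier_mat n n"
  shows "act_pt n (g * h) v = act_pt n g (act_pt n h v)"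
proof
  fix x :: "nat \<times> nat"
  obtain i a where x: "x = (i, a)" by force
  have "mv n g (crow (act_pt n h v) i) = mv n g (mv n h (crow v i))"
    by (rule mv_cong) (simp add: crow_act_pt)
  then show "act_pt n (g * h) v x = act_pt n g (act_pt n h v) x"
    using mv_mult[OF assms] by (simp add: x act_pt_def)
qed

lemma mv_one: "a < n \<Longrightarrow> mv n (1\<^sub>m n) x a = x a"
  by (simp add: mv_def if_distrib[of "\<lambda>z. z * _"] cong: if_cong)

lemma act_pt_one: "act_pt n (1\<^sub>m n) v = v"
  by (auto simp: act_pt_def mv_one crow_def fun_eq_iff)

lemma quad_form_qf: "quad_form n v = qf n (\<lambda>a. v $ a)"
  by (simp add: quad_form_def qf_def)

lemma orthogonal_groupD:
  assumes "g \<in> orthogonal_group n"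
  shows "g \<in> carrier_mat n n" "invertible_mat g"
  using assms by (auto simp: orthogonal_group_def)

lemma mv_vec: "g \<in> carrier_mat n n \<Longrightarrow> a < n \<Longrightarrow> (g *\<^sub>v vec n x) $ a = mv n g x a"
  by (auto simp: mv_def scalar_prod_def atLeast0LessThan intro!: sum.cong)

lemma qf_orthogonal:
  assumes "g \<in> orthogonal_group n"
  shows "qf n (mv n g x) = qf n x"
proof -
  have g: "g \<in> carrier_mat n n" by (rule orthogonal_groupD[OF assms])
  have "quad_form n (g *\<^sub>v vec n x) = quad_form n (vec n x)"
    using assms by (simp add: orthogonal_group_def)
  moreover have "quad_form n (g *\<^sub>v vec n x) = qf n (mv n g x)"
    unfolding quad_form_qf by (rule qf_cong) (rule mv_vec[OF g])
  moreover have "quad_form n (vec n x) = qf n x"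
    unfolding quad_form_qf by (rule qf_cong) simp
  ultimately show ?thesis by simp
qed

lemma mv_add: "mv n g (\<lambda>a. x a + y a) = (\<lambda>a. mv n g x a + mv n g y a)"
  by (simp add: mv_def sum.distrib distrib_left)

lemma bf_orthogonal:
  assumes "(2::'k::field) = 0" "g \<in> orthogonal_group n"
  shows "bf n (mv n g x) (mv n g y) = bf n x (y :: nat \<Rightarrow> 'k)"
proof -
  have "qf n (mv n g (\<lambda>a. x a + y a)) = qf n (\<lambda>a. x a + y a)"
    by (rule qf_orthogonal[OF assms(2)])
  then show ?thesis
    unfolding mv_add qf_add[OF assms(1)] qf_orthogonal[OF assms(2)] by simp
qed

text \<open>The inner conditional is the polar form of the basis vector with index \<open>b\<close>
  and \<open>c\<close>: the coordinate of \<open>c\<close> paired with \<open>b\<close>, or 0 for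
  the last coordinate when \<open>n\<close> is odd.\<close>

definition refl_mat :: "nat \<Rightarrow> (nat \<Rightarrow> 'k::field) \<Rightarrow> 'k mat" where
  "refl_mat n c = mat n n (\<lambda>(a, b). (if a = b then 1 else 0) - c a * (if b < n div 2 then c (n div 2 + b)
     else if b < 2 * (n div 2) then c (b - n div 2) else 0) / qf n c)"

lemma sum_split_halves: "(\<Sum>b<2 * k. f b) = (\<Sum>b<k. f b) + (\<Sum>b<k. f (k + b))" for f :: "nat \<Rightarrow> 'a::comm_monoid_add"
proof -
  have "(\<Sum>b<2 * k. f b) = sum f {0..<k} + sum f {k..<2 * k}"
    by (subst sum.atLeastLessThan_concat) (auto simp: atLeast0LessThan)
  also have "sum f {k..<2 * k} = (\<Sum>b\<in>{0..<k}. f (b + k))"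
    using sum.shift_bounds_nat_ivl[of f 0 k k] by (simp add: mult_2)
  finally show ?thesis by (simp add: atLeast0LessThan add.commute)
qed

lemma refl_mat_carrier [simp]: "refl_mat n c \<in> carrier_mat n n"
  by (simp add: refl_mat_def)

lemma mv_refl_mat: "a < n \<Longrightarrow> mv n (refl_mat n c) x a = reflect n c x a"
proof -
  assume a: "a < n"
  let ?k = "n div 2"
  let ?J = "\<lambda>b. if b < ?k then c (?k + b) else if b < 2 * ?k then c (b - ?k) else 0"
  have "(\<Sum>b<n. ?J b * x b) = (\<Sum>b<2 * ?k. ?J b * x b)"
    by (rule sum.mono_neutral_right) auto
  also have "\<dots> = bf n x c"
    unfolding sum_split_halves bf_def sum.distrib[symmetric]
    by (intro sum.cong refl) (simp add: mult.commute)
  finally have J: "(\<Sum>b<n. ?J b * x b) = bf n x c" .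
  have "mv n (refl_mat n c) x a = (\<Sum>b<n. (if a = b then x b else 0) - c a / qf n c * (?J b * x b))"
    unfolding mv_def refl_mat_def using a by (intro sum.cong refl) (simp add: algebra_simps)
  also have "\<dots> = x a - c a / qf n c * bf n x c"
    unfolding sum_subtractf sum_distrib_left[symmetric] J using a by simp
  finally show ?thesis by (simp add: reflect_def)
qed

lemma qf_crow_act_pt: "qf n (crow (act_pt n g v) i) = qf n (mv n g (crow v i))"
  by (rule qf_cong) (rule crow_act_pt)

lemma bf_crow_act_pt:
  "bf n (crow (act_pt n g v) i) (crow (act_pt n g v) j) = bf n (mv n g (crow v i)) (mv n g (crow v j))"
  by (rule bf_cong) (rule crow_act_pt, assumption)+

lemma mat_eqI_mv:
  assumes "g \<in> carrier_mat n n" "h \<in> carrier_mat n n"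
    and "\<And>x a. a < n \<Longrightarrow> mv n g x a = mv n h x a"
  shows "g = h"
proof (rule eq_matI)
  fix a b assume "a < dim_row h" "b < dim_col h"
  then have ab: "a < n" "b < n" using assms by auto
  have e: "mv n A (\<lambda>c. if c = b then 1 else 0) a = A $$ (a, b)" for A :: "'a mat"
    unfolding mv_def using ab by (simp add: if_distrib[of "\<lambda>z. _ * z"] cong: if_cong)
  show "g $$ (a, b) = h $$ (a, b)"
    using assms(3)[OF ab(1), of "\<lambda>c. if c = b then 1 else 0"] by (simp add: e)
qed (use assms in auto)

lemma invertible_matI:
  assumes "g \<in> carrier_mat n n" "h \<in> carrier_mat n n" "g * h = 1\<^sub>m n" "h * g = 1\<^sub>m n"
  shows "invertible_mat g"
  using assms unfolding invertible_mat_def inverts_mat_def by auto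

lemma invertible_matE:
  assumes "g \<in> carrier_mat n n" "invertible_mat g"
  obtains h where "h \<in> carrier_mat n n" "g * h = 1\<^sub>m n" "h * g = 1\<^sub>m n"
proof -
  obtain h where h: "g * h = 1\<^sub>m (dim_row g)" "h * g = 1\<^sub>m (dim_row h)"
    using assms unfolding invertible_mat_def inverts_mat_def by blast
  have "dim_col h = dim_col (g * h)" by simp
  also have "\<dots> = n" using assms h by simp
  finally have "dim_col h = n" .
  moreover have "dim_row h = dim_col (h * g)" using h by simp
  then have "dim_row h = n" using assms by simp
  ultimately show ?thesis using h assms by (intro that[of h]) auto
qed

lemma invertible_mat_mult:
  assumes "g \<in> carrier_mat n n" "invertible_mat g" "h \<in> carrier_mat n n" "invertible_mat h"
  shows "invertible_mat (g * h)"
proof -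
  obtain g' where g': "g' \<in> carrier_mat n n" "g * g' = 1\<^sub>m n" "g' * g = 1\<^sub>m n"
    using assms by (meson invertible_matE)
  obtain h' where h': "h' \<in> carrier_mat n n" "h * h' = 1\<^sub>m n" "h' * h = 1\<^sub>m n"
    using assms by (meson invertible_matE)
  have "g * h * (h' * g') = g * (h * (h' * g'))"
    using assms g' h' by (intro assoc_mult_mat[of _ n n _ n _ n]) auto
  also have "h * (h' * g') = h * h' * g'"
    using assms g' h' by (intro assoc_mult_mat[of _ n n _ n _ n, symmetric]) auto
  finally have 1: "g * h * (h' * g') = 1\<^sub>m n" using g' h' by simp
  have "h' * g' * (g * h) = h' * (g' * (g * h))"
    using assms g' h' by (intro assoc_mult_mat[of _ n n _ n _ n]) auto
  also have "g' * (g * h) = g' * g * h"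
    using assms g' h' by (intro assoc_mult_mat[of _ n n _ n _ n, symmetric]) auto
  finally have 2: "h' * g' * (g * h) = 1\<^sub>m n" using assms g' h' by simp
  show ?thesis using assms g' h' 1 2
    by (intro invertible_matI[of _ n "h' * g'"]) auto
qed

lemma reflect_cong: "(\<And>b. b < n \<Longrightarrow> x b = y b) \<Longrightarrow> a < n \<Longrightarrow> reflect n c x a = reflect n c y a"
  unfolding reflect_def using bf_cong[of n x y c c] by simp

lemma refl_mat_square:
  assumes "(2::'k::field) = 0" "qf n c \<noteq> (0::'k)"
  shows "refl_mat n c * refl_mat n c = 1\<^sub>m n"
proof (rule mat_eqI_mv)
  fix x a assume a: "a < n"
  have "mv n (refl_mat n c * refl_mat n c) x a = reflect n c (mv n (refl_mat n c) x) a"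
    using a by (simp add: mv_mult mv_refl_mat)
  also have "\<dots> = reflect n c (reflect n c x) a"
    by (rule reflect_cong) (simp_all add: mv_refl_mat a)
  also have "\<dots> = mv n (1\<^sub>m n) x a"
    using a by (simp add: reflect_reflect[OF assms] mv_one)
  finally show "mv n (refl_mat n c * refl_mat n c) x a = mv n (1\<^sub>m n) x a" .
qed (rule mult_carrier_mat[OF refl_mat_carrier refl_mat_carrier], simp)

lemma refl_mat_orthogonal:
  assumes "(2::'k::field) = 0" "qf n c \<noteq> (0::'k)"
  shows "refl_mat n c \<in> orthogonal_group n"
proof -
  have "quad_form n (refl_mat n c *\<^sub>v v) = quad_form n v" if v: "v \<in> carrier_vec n" for v
  proof -
    have "v = vec n (\<lambda>a. v $ a)" using v by auto
    then have "quad_form n (refl_mat n c *\<^sub>v v) = qf n (reflect n c (\<lambda>a. v $ a))"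
      unfolding quad_form_qf using mv_vec[OF refl_mat_carrier, of _ n c "\<lambda>a. v $ a"]
      by (intro qf_cong) (metis mv_refl_mat)
    then show ?thesis by (simp add: qf_reflect[OF assms] quad_form_qf)
  qed
  moreover have "invertible_mat (refl_mat n c)"
    using refl_mat_square[OF assms] by (intro invertible_matI[of _ n "refl_mat n c"]) auto
  ultimately show ?thesis by (simp add: orthogonal_group_def)
qed

lemma one_orthogonal: "1\<^sub>m n \<in> orthogonal_group n"
  by (auto simp: orthogonal_group_def intro: invertible_matI[of _ n "1\<^sub>m n"])

lemma orthogonal_mult:
  assumes "g \<in> orthogonal_group n" "h \<in> orthogonal_group n"
  shows "g * h \<in> orthogonal_group n"
proof -
  have gh: "g \<in> carrier_mat n n" "h \<in> carrier_mat n n" "invertible_mat g" "invertible_mat h"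
    using assms by (auto simp: orthogonal_group_def)
  have "quad_form n (g * h *\<^sub>v v) = quad_form n v" if "v \<in> carrier_vec n" for v
    using assms gh that by (simp add: orthogonal_group_def assoc_mult_mat_vec[of _ n n _ n])
  moreover have "invertible_mat (g * h)"
    using gh invertible_mat_mult by blast
  ultimately show ?thesis using gh by (simp add: orthogonal_group_def)
qed

text \<open>The Boolean is the parity of the number of factors. It is an argument of a relation
  because one matrix can have factorisations of both parities: for odd \<open>n\<close> the identity
  is a reflection.\<close>

inductive reflprod :: "nat \<Rightarrow> bool \<Rightarrow> 'k::field mat \<Rightarrow> bool" for n where
  one: "reflprod n False (1\<^sub>m n)"
| step: "reflprod n b g \<Longrightarrow> qf n c \<noteq> 0 \<Longrightarrow> reflprod n (\<not> b) (g * refl_mat n c)"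

lemma reflprod_orthogonal:
  "(2::'k::field) = 0 \<Longrightarrow> reflprod n b (g :: 'k mat) \<Longrightarrow> g \<in> orthogonal_group n"
  by (rotate_tac, induction rule: reflprod.induct)
     (auto intro: one_orthogonal orthogonal_mult refl_mat_orthogonal)

lemma reflprod_carrier: "reflprod n b g \<Longrightarrow> g \<in> carrier_mat n n"
  by (induction rule: reflprod.induct) auto

lemma reflprod_refl: "qf n c \<noteq> 0 \<Longrightarrow> reflprod n True (refl_mat n c)"
  using reflprod.step[OF reflprod.one, of n c] by (simp add: left_mult_one_mat[of _ n n])

lemma reflprod_mult:
  assumes "reflprod n b h" "reflprod n b' g"
  shows "reflprod n (b \<noteq> b') (h * g)"
  using assms(2)
proof (induction rule: reflprod.induct)
  case one
  then show ?case using assms(1) reflprod_carrier[OF assms(1)] by simp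
next
  case (step b' g c)
  have "h * (g * refl_mat n c) = h * g * refl_mat n c"
    using reflprod_carrier[OF assms(1)] reflprod_carrier[OF step.hyps(1)]
    by (simp add: assoc_mult_mat[of _ n n _ n _ n])
  then show ?case using reflprod.step[OF step.IH step.hyps(2)] by (simp add: not_iff)
qed

text \<open>The order is reversed because substitution acts on the argument: replacing
  \<open>v\<close> by \<open>h v\<close> in \<open>p(g v)\<close> gives
  \<open>p(g h v)\<close>.\<close>

lemma lin_subst_lin_subst:
  fixes g h :: "'k::alg_closed_field mat"
  assumes "g \<in> carrier_mat n n" "h \<in> carrier_mat n n"
  shows "lin_subst h (lin_subst g p) = lin_subst (g * h) p"
  by (rule mpoly_ext[OF alg_closed_infinite])
     (use assms in \<open>simp add: eval_lin_subst[of _ n] act_pt_mult mult_carrier_mat[of _ n n _ n]\<close>)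

lemma vars_lin_subst:
  assumes "vars p \<subseteq> I \<times> {..<n}" "g \<in> carrier_mat n n"
  shows "vars (lin_subst g p) \<subseteq> I \<times> {..<n}"
  unfolding lin_subst_def
proof (rule vars_poly_eval_Const)
  fix x assume x: "x \<in> vars p"
  obtain i a where ia: "x = (i, a)" by force
  have "vars (\<Sum>b<n. Const (g $$ (a, b)) * Var (i, b)) \<subseteq> I \<times> {..<n}"
    using x ia assms by (intro vars_sum vars_closed) auto
  then show "vars (case x of (i, a) \<Rightarrow> if a < dim_row g
      then \<Sum>b<dim_col g. Const (g $$ (a, b)) * Var (i, b) else Var (i, a)) \<subseteq> I \<times> {..<n}"
    using x ia assms by auto
qed

section \<open>The action on rational functions\<close>

context
  fixes g :: "'k::field mat" and n
  assumes g: "g \<in> carrier_mat n n" "invertible_mat g"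
begin

lemma ratfun_act_to_fract: "ratfun_act g (to_fract p) = to_fract (lin_subst g p)"
  using ratfun_act_fraction[OF g, of 1 p] by simp

lemma lin_subst_nonzero: "r \<noteq> 0 \<Longrightarrow> lin_subst g r \<noteq> 0"
  using lin_subst_eq_0_iff[OF g] by simp

lemma ratfun_act_mult: "ratfun_act g (x * y) = ratfun_act g x * ratfun_act g y"
proof -
  obtain p r where pr: "r \<noteq> 0" "x = to_fract p / to_fract r" by (rule fraction_cases)
  obtain p' r' where pr': "r' \<noteq> 0" "y = to_fract p' / to_fract r'" by (rule fraction_cases)
  have "x * y = to_fract (p * p') / to_fract (r * r')" by (simp add: pr pr')
  then show ?thesis using pr pr' ratfun_act_fraction[OF g, of "r * r'" "p * p'"]
    by (simp add: ratfun_act_fraction[OF g])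
qed

lemma ratfun_act_add: "ratfun_act g (x + y) = ratfun_act g x + ratfun_act g y"
proof -
  obtain p r where pr: "r \<noteq> 0" "x = to_fract p / to_fract r" by (rule fraction_cases)
  obtain p' r' where pr': "r' \<noteq> 0" "y = to_fract p' / to_fract r'" by (rule fraction_cases)
  have "x + y = to_fract (p * r' + p' * r) / to_fract (r * r')"
    using pr pr' by (simp add: add_frac_eq)
  then have "ratfun_act g (x + y) =
      to_fract (lin_subst g (p * r' + p' * r)) / to_fract (lin_subst g (r * r'))"
    using pr pr' ratfun_act_fraction[OF g, of "r * r'" "p * r' + p' * r"] by simp
  then show ?thesis
    using pr pr' lin_subst_nonzero by (simp add: ratfun_act_fraction[OF g] add_frac_eq)
qed

lemma ratfun_act_const: "ratfun_act g (const c) = const c"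
  by (simp add: const_def ratfun_act_to_fract)

lemma ratfun_act_diff: "ratfun_act g (x - y) = ratfun_act g x - ratfun_act g y"
proof -
  have "x - y = x + const (-1) * y" by simp
  then show ?thesis
    by (simp only: ratfun_act_add ratfun_act_mult ratfun_act_const) simp
qed

lemma ratfun_act_1: "ratfun_act g 1 = 1"
  using ratfun_act_const[of 1] by simp

lemma ratfun_act_inverse: "ratfun_act g (inverse x) = inverse (ratfun_act g x)"
proof (cases "x = 0")
  case True
  then show ?thesis using ratfun_act_const[of 0] by simp
next
  case False
  then have "ratfun_act g (inverse x) * ratfun_act g x = 1"
    by (simp add: ratfun_act_1 flip: ratfun_act_mult)
  then show ?thesis by (metis inverse_unique mult.commute)
qed

lemma ratfun_act_fixed_iff:
  assumes "r \<noteq> 0"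
  shows "ratfun_act g (to_fract p / to_fract r) = to_fract p / to_fract r \<longleftrightarrow>
    lin_subst g p * r = p * lin_subst g r"
  using assms lin_subst_nonzero[OF assms]
  by (simp add: ratfun_act_fraction[OF g] frac_eq_eq flip: to_fract_mult)

end

lemma ratfun_act_ratfun_act:
  fixes g h :: "'k::alg_closed_field mat"
  assumes "g \<in> carrier_mat n n" "invertible_mat g" "h \<in> carrier_mat n n" "invertible_mat h"
  shows "ratfun_act h (ratfun_act g f) = ratfun_act (g * h) f"
proof -
  obtain p r where pr: "r \<noteq> 0" "f = to_fract p / to_fract r" by (rule fraction_cases)
  have gh: "g * h \<in> carrier_mat n n" "invertible_mat (g * h)"
    using assms invertible_mat_mult by auto
  show ?thesis
    unfolding pr(2) ratfun_act_fraction[OF assms(1,2) pr(1)] ratfun_act_fraction[OF gh pr(1)]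
      ratfun_act_fraction[OF assms(3,4) lin_subst_nonzero[OF assms(1,2) pr(1)]]
    using assms by (simp add: lin_subst_lin_subst[of _ n])
qed


section \<open>Subfields and fields of invariants\<close>

text \<open>Subfields in terms of the type class operations, with \<open>inverse 0 = 0\<close>;
  \<open>fsub_subfield\<close> connects them with the notion behind
  \<open>generate_field\<close>.\<close>

definition fsub :: "'a::field set \<Rightarrow> bool" where
  "fsub S \<longleftrightarrow> 1 \<in> S \<and> (\<forall>x\<in>S. \<forall>y\<in>S. x - y \<in> S \<and> x * y \<in> S) \<and> (\<forall>x\<in>S. inverse x \<in> S)"

context
  fixes S :: "'a::field set"
  assumes S: "fsub S"
begin

lemma fsub_1: "1 \<in> S" and fsub_diff: "x \<in> S \<Longrightarrow> y \<in> S \<Longrightarrow> x - y \<in> S"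
  and fsub_mult: "x \<in> S \<Longrightarrow> y \<in> S \<Longrightarrow> x * y \<in> S" and fsub_inverse: "x \<in> S \<Longrightarrow> inverse x \<in> S"
  using S by (auto simp: fsub_def)

lemma fsub_0: "0 \<in> S"
  using fsub_diff[OF fsub_1 fsub_1] by simp

lemma fsub_uminus: "x \<in> S \<Longrightarrow> - x \<in> S"
  using fsub_diff[OF fsub_0, of x] by simp

lemma fsub_add: "x \<in> S \<Longrightarrow> y \<in> S \<Longrightarrow> x + y \<in> S"
  using fsub_diff[of x "- y"] fsub_uminus[of y] by simp

lemma fsub_divide: "x \<in> S \<Longrightarrow> y \<in> S \<Longrightarrow> x / y \<in> S"
  unfolding divide_inverse by (intro fsub_mult fsub_inverse)

lemma fsub_power: "x \<in> S \<Longrightarrow> x ^ k \<in> S"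
  by (induction k) (auto intro: fsub_1 fsub_mult)

lemma fsub_sum: "(\<And>i. i \<in> I \<Longrightarrow> f i \<in> S) \<Longrightarrow> sum f I \<in> S"
  by (induction I rule: infinite_finite_induct) (auto intro: fsub_0 fsub_add)

lemma fsub_prod: "(\<And>i. i \<in> I \<Longrightarrow> f i \<in> S) \<Longrightarrow> prod f I \<in> S"
  by (induction I rule: infinite_finite_induct) (auto intro: fsub_1 fsub_mult)

lemma fsub_poly_eval:
  assumes "\<And>c. h c \<in> S" "\<And>x. x \<in> vars p \<Longrightarrow> s x \<in> S"
  shows "poly_eval h s p \<in> S"
  unfolding poly_eval_def mon_eval_def
  by (intro fsub_sum fsub_mult assms(1) fsub_prod fsub_power assms(2)) (auto simp: vars_def)

lemma fsub_subfield: "subfield S class_ring"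
proof (rule field.subfieldI'[OF class_field])
  show "subring S class_ring"
    by (rule ring.subringI[OF class_ring.ring_axioms])
       (auto simp: fsub_1 fsub_uminus fsub_mult fsub_add class_ring_simps)
  show "inv\<^bsub>class_ring\<^esub> k \<in> S" if "k \<in> S - {\<zero>\<^bsub>class_ring\<^esub>}" for k
    using that by (auto simp: class_ring_simps fsub_inverse)
qed

end

lemma fsub_generate_field: "fsub (generate_field class_ring (H :: 'a::field set))"
proof -
  have "a \<in> generate_field class_ring H \<Longrightarrow> b \<in> generate_field class_ring H \<Longrightarrow>
      a + b \<in> generate_field class_ring H \<and> a * b \<in> generate_field class_ring H \<and>
      - a \<in> generate_field class_ring H" for a b
    using generate_field.eng_add[of a class_ring H b] generate_field.eng_mult[of a class_ring H b]
      generate_field.a_inv[of a class_ring H] by (simp add: class_ring_simps)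
  note ops = this
  have one: "1 \<in> generate_field class_ring H"
    using generate_field.one[of class_ring H] by simp
  have "inverse a \<in> generate_field class_ring H" if "a \<in> generate_field class_ring H" for a
  proof (cases "a = 0")
    case True
    then show ?thesis using that by simp
  next
    case False
    then show ?thesis using generate_field.m_inv[OF that] by (simp add: class_ring_simps)
  qed
  then show ?thesis unfolding fsub_def
    using one ops by (metis diff_conv_add_uminus)
qed

lemma generate_field_subset:
  assumes S: "fsub (S :: 'a::field set)" and "H \<subseteq> S"
  shows "generate_field class_ring H \<subseteq> S"
  by (rule field.generate_field_min_subfield1[OF class_field _ fsub_subfield[OF S] assms(2)]) auto

lemma fsub_Collect:
  assumes "P 1" "\<And>x y. P x \<Longrightarrow> P y \<Longrightarrow> P (x - y)" "\<And>x y. P x \<Longrightarrow> P y \<Longrightarrow> P (x * y)"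
    and "\<And>x. P x \<Longrightarrow> P (inverse x)"
  shows "fsub {x. P x}"
  using assms by (simp add: fsub_def)

lemma fsub_Int: "fsub S \<Longrightarrow> fsub T \<Longrightarrow> fsub (S \<inter> T)"
  by (simp add: fsub_def)

lemma fsub_ratfun_field: "fsub (ratfun_field n m :: 'k::field ratfun set)"
proof -
  let ?V = "{1..m} \<times> {..<n}"
  have I: "to_fract p / to_fract r \<in> ratfun_field n m"
    if "r \<noteq> 0" "vars p \<subseteq> ?V" "vars r \<subseteq> ?V" for p r :: "(nat \<times> nat, 'k) mpoly"
    using that unfolding ratfun_field_def by blast
  show ?thesis unfolding fsub_def
  proof (intro conjI ballI)
    show "1 \<in> (ratfun_field n m :: 'k ratfun set)" using I[of 1 1] by simp
    fix x :: "'k ratfun" assume "x \<in> ratfun_field n m"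
    then obtain p r where pr: "x = to_fract p / to_fract r" "r \<noteq> 0" "vars p \<subseteq> ?V" "vars r \<subseteq> ?V"
      unfolding ratfun_field_def by blast
    show "inverse x \<in> ratfun_field n m"
    proof (cases "p = 0")
      case True
      then show ?thesis using I[of 1 0] pr by simp
    next
      case False
      then show ?thesis using I[of p r] pr by simp
    qed
    fix y :: "'k ratfun" assume "y \<in> ratfun_field n m"
    then obtain p' r' where pr': "y = to_fract p' / to_fract r'" "r' \<noteq> 0" "vars p' \<subseteq> ?V" "vars r' \<subseteq> ?V"
      unfolding ratfun_field_def by blast
    have "x - y = to_fract (p * r' - p' * r) / to_fract (r * r')"
      using pr pr' by (simp add: diff_frac_eq)
    then show "x - y \<in> ratfun_field n m" using pr pr' I[of "r * r'" "p * r' - p' * r"]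
      by (simp add: vars_closed)
    show "x * y \<in> ratfun_field n m" using pr pr' I[of "r * r'" "p * p'"]
      by (simp add: vars_closed)
  qed
qed

lemma to_fract_ratfun_field: "vars p \<subseteq> {1..m} \<times> {..<n} \<Longrightarrow> to_fract p \<in> ratfun_field n m"
  unfolding ratfun_field_def by (rule CollectI, rule exI[of _ p], rule exI[of _ 1]) simp

lemma const_ratfun_field: "const c \<in> ratfun_field n m"
  unfolding const_def by (rule to_fract_ratfun_field) simp

lemma fsub_invariant_field:
  assumes "G \<subseteq> orthogonal_group n"
  shows "fsub (invariant_field G n m)"
proof -
  have "fsub {f. \<forall>g\<in>G. ratfun_act g f = f}"
  proof (rule fsub_Collect)
    note g = orthogonal_groupD[OF subsetD[OF assms]]
    show "\<forall>g\<in>G. ratfun_act g 1 = 1" using ratfun_act_1 g by blast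
    show "\<forall>g\<in>G. ratfun_act g (x - y) = x - y"
      if "\<forall>g\<in>G. ratfun_act g x = x" "\<forall>g\<in>G. ratfun_act g y = y" for x y
      using that ratfun_act_diff g by metis
    show "\<forall>g\<in>G. ratfun_act g (x * y) = x * y"
      if "\<forall>g\<in>G. ratfun_act g x = x" "\<forall>g\<in>G. ratfun_act g y = y" for x y
      using that ratfun_act_mult g by metis
    show "\<forall>g\<in>G. ratfun_act g (inverse x) = inverse x"
      if "\<forall>g\<in>G. ratfun_act g x = x" for x
      using that ratfun_act_inverse g by metis
  qed
  then have "fsub (ratfun_field n m \<inter> {f. \<forall>g\<in>G. ratfun_act g f = f})"
    by (intro fsub_Int fsub_ratfun_field)
  then show ?thesis by (simp add: invariant_field_def Int_def)
qed

lemma const_invariant_field: "G \<subseteq> orthogonal_group n \<Longrightarrow> const c \<in> invariant_field G n m"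
  unfolding invariant_field_def using const_ratfun_field ratfun_act_const orthogonal_groupD by blast


section \<open>Normal forms for tuples of vectors\<close>

lemma eval_qf: "comm_ring_hom h \<Longrightarrow> poly_eval h v (qf n X) = qf n (\<lambda>a. poly_eval h v (X a))"
  by (simp add: qf_def comm_ring_hom.poly_eval_hom comm_ring_hom.poly_eval_0)

lemma eval_bf: "comm_ring_hom h \<Longrightarrow> poly_eval h v (bf n X Y) = bf n (\<lambda>a. poly_eval h v (X a)) (\<lambda>a. poly_eval h v (Y a))"
  by (simp add: bf_def comm_ring_hom.poly_eval_hom)

text \<open>Freeze all rows except \<open>i\<close> at their values in \<open>v\<close>. Then
  \<open>P\<close> and \<open>G\<close> remain nonzero as polynomials in row \<open>i\<close>, the
  former because of \<open>v\<close> and the latter because of \<open>v2\<close>, and their product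
  has a common nonroot.\<close>

lemma perturb_row:
  fixes P G :: "(nat \<times> nat, 'k::field) mpoly"
  assumes inf: "infinite (UNIV :: 'k set)"
    and "poly_eval (\<lambda>c. c) v P \<noteq> 0" "poly_eval (\<lambda>c. c) v2 G \<noteq> 0" "\<And>x. fst x \<noteq> i \<Longrightarrow> v2 x = v x"
  obtains v' where "\<And>x. fst x \<noteq> i \<Longrightarrow> v' x = v x"
    "poly_eval (\<lambda>c. c) v' P \<noteq> 0" "poly_eval (\<lambda>c. c) v' G \<noteq> 0"
proof -
  define \<rho> :: "nat \<times> nat \<Rightarrow> (nat \<times> nat, 'k) mpoly" where
    "\<rho> x = (if fst x = i then Var x else Const (v x))" for x
  have ev: "poly_eval (\<lambda>c. c) u (poly_eval Const \<rho> Q) =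
      poly_eval (\<lambda>c. c) (\<lambda>x. if fst x = i then u x else v x) Q" for u Q
    unfolding comm_ring_hom.poly_eval_subst[OF comm_ring_hom_id] by (rule arg_cong[of _ _ "\<lambda>s. poly_eval (\<lambda>c. c) s Q"])
      (auto simp: \<rho>_def eval_simps)
  have "(\<lambda>x. if fst x = i then v x else v x) = v" "(\<lambda>x. if fst x = i then v2 x else v x) = v2"
    using assms(4) by auto
  then have "poly_eval (\<lambda>c. c) v (poly_eval Const \<rho> P) \<noteq> 0" "poly_eval (\<lambda>c. c) v2 (poly_eval Const \<rho> G) \<noteq> 0"
    using assms(2,3) by (simp_all add: ev)
  then have "poly_eval Const \<rho> P * poly_eval Const \<rho> G \<noteq> 0"
    by (metis eval_simps(10) no_zero_divisors)
  then obtain u where "poly_eval (\<lambda>c. c) u (poly_eval Const \<rho> P * poly_eval Const \<rho> G) \<noteq> 0"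
    using exists_nonroot[OF inf] by blast
  then have "poly_eval (\<lambda>c. c) (\<lambda>x. if fst x = i then u x else v x) P \<noteq> 0"
    "poly_eval (\<lambda>c. c) (\<lambda>x. if fst x = i then u x else v x) G \<noteq> 0"
    by (simp_all add: eval_simps(3) ev)
  then show ?thesis by (intro that[of "\<lambda>x. if fst x = i then u x else v x"]) auto
qed

text \<open>Even and odd \<open>n\<close> are treated together as far as possible.\<close>

locale orth_inv =
  fixes n \<nu> m :: nat and ktype :: "'k::alg_closed_field itself"
  assumes two: "(2::'k) = 0" and n_div: "n div 2 = \<nu>" and nu_pos: "\<nu> \<ge> 1"
begin

abbreviation ev :: "(nat \<times> nat \<Rightarrow> 'k) \<Rightarrow> (nat \<times> nat, 'k) mpoly \<Rightarrow> 'k" where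
  "ev \<equiv> poly_eval (\<lambda>c. c)"

lemma inf: "infinite (UNIV :: 'k set)"
  by (rule alg_closed_infinite)

lemma n_cases: "n = 2 * \<nu> \<or> n = 2 * \<nu> + 1"
  using n_div by linarith

text \<open>The normal form: the vectors with indices \<open>2 s + 1\<close> and \<open>2 s + 2\<close> lie in the span of the first
  \<open>s + 1\<close> hyperbolic planes, and the former has the component \<open>(1, a)\<close> with \<open>a \<noteq> 0\<close> in the last of
  these.  A plane consists of the coordinates \<open>s\<close> and \<open>\<nu> + s\<close>, so \<open>a mod \<nu>\<close> is the plane that the
  coordinate \<open>a < 2 \<nu>\<close> belongs to.\<close>

definition blk :: "nat \<Rightarrow> nat" where "blk i = (i - 1) div 2"

text \<open>Each of the \<open>\<nu>\<close> planes takes up two vectors, so that vectors with an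
  index above \<open>2 * \<nu>\<close> find no plane left and are not normalised.\<close>

definition nv :: nat where "nv = min m (2 * \<nu>)"

text \<open>The coordinates outside the first \<open>s\<close> planes. The last coordinate for odd
  \<open>n\<close> is listed separately, because \<open>2 * \<nu> mod \<nu>\<close> would put it
  into plane 0.\<close>

definition high :: "nat \<Rightarrow> nat \<Rightarrow> bool" where
  "high s a \<longleftrightarrow> a = 2 * \<nu> \<or> s \<le> a mod \<nu>"

definition normal_row :: "nat \<Rightarrow> (nat \<Rightarrow> 'k) \<Rightarrow> bool" where
  "normal_row i x \<longleftrightarrow> (\<forall>a<n. high (Suc (blk i)) a \<longrightarrow> x a = 0) \<and>
     (odd i \<longrightarrow> x (blk i) = 1 \<and> x (\<nu> + blk i) \<noteq> 0)"

definition normal_upto :: "nat \<Rightarrow> (nat \<times> nat \<Rightarrow> 'k) \<Rightarrow> bool" where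
  "normal_upto j v \<longleftrightarrow> (\<forall>i\<in>{1..j}. normal_row i (crow v i))"

definition hi :: "nat \<Rightarrow> (nat \<Rightarrow> 'a::zero) \<Rightarrow> nat \<Rightarrow> 'a" where
  "hi s x = (\<lambda>a. if a < n \<and> high s a then x a else 0)"

definition pair :: "nat \<Rightarrow> 'a::zero \<Rightarrow> 'a \<Rightarrow> nat \<Rightarrow> 'a" where
  "pair s p r = (\<lambda>a. if a = s then p else if a = \<nu> + s then r else 0)"

lemma bf_nu: "bf n x y = (\<Sum>t<\<nu>. x t * y (\<nu> + t) + x (\<nu> + t) * y t)"
  by (simp add: bf_def n_div)

lemma bf_pair: "s < \<nu> \<Longrightarrow> bf n (pair s p r) y = p * y (\<nu> + s) + r * y s"
  unfolding bf_nu by (subst sum.remove[of _ s]) (auto simp: pair_def intro!: sum.neutral)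

lemma qf_pair: "s < \<nu> \<Longrightarrow> qf n (pair s p r) = p * r"
proof -
  assume s: "s < \<nu>"
  have "(\<Sum>t<\<nu>. pair s p r t * pair s p r (\<nu> + t)) = p * r"
    using s by (subst sum.remove[of _ s]) (auto simp: pair_def intro!: sum.neutral)
  then show ?thesis using s n_cases by (auto simp: qf_def n_div pair_def)
qed

lemma high_simps: "t < \<nu> \<Longrightarrow> high s t \<longleftrightarrow> s \<le> t" "t < \<nu> \<Longrightarrow> high s (\<nu> + t) \<longleftrightarrow> s \<le> t"
  "high s (2 * \<nu>)"
  by (auto simp: high_def)

lemma idx_cases:
  assumes "a < n"
  obtains "a < \<nu>" | t where "t < \<nu>" "a = \<nu> + t" | "a = 2 * \<nu>" "n = 2 * \<nu> + 1"
proof (cases "a < \<nu>")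
  case False
  then have "a = \<nu> + (a - \<nu>)" by simp
  then show ?thesis using n_cases assms False that by (cases "a - \<nu> < \<nu>") auto
qed (use that in auto)

lemma nu_lt: "t < \<nu> \<Longrightarrow> t < n" "t < \<nu> \<Longrightarrow> \<nu> + t < n"
  using n_cases by auto

text \<open>Different planes are orthogonal, and the last coordinate for odd \<open>n\<close>
  belongs to the radical.\<close>

lemma bf_high_low:
  assumes "\<And>a. a < n \<Longrightarrow> high s a \<Longrightarrow> x a = 0" "\<And>a. a < n \<Longrightarrow> \<not> high s a \<Longrightarrow> c a = 0"
  shows "bf n x c = 0"
  unfolding bf_nu
proof (intro sum.neutral ballI)
  fix t assume "t \<in> {..<\<nu>}"
  then show "x t * c (\<nu> + t) + x (\<nu> + t) * c t = 0"
    using assms[of t] assms[of "\<nu> + t"] nu_lt[of t] by (cases "s \<le> t") (auto simp: high_simps)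
qed

lemma bf_hi:
  assumes "\<And>a. a < n \<Longrightarrow> \<not> high s a \<Longrightarrow> c a = 0"
  shows "bf n x c = bf n (hi s x) (c :: nat \<Rightarrow> 'a::comm_ring_1)"
proof -
  have "bf n x c = bf n (\<lambda>a. (x a - hi s x a) + hi s x a) c" by simp
  also have "\<dots> = bf n (\<lambda>a. x a - hi s x a) c + bf n (hi s x) c"
    by (rule bf_lin)
  also have "bf n (\<lambda>a. x a - hi s x a) c = 0"
    by (rule bf_high_low[of s]) (use assms in \<open>auto simp: hi_def\<close>)
  finally show ?thesis by simp
qed

lemma reflect_low:
  assumes "\<And>a. a < n \<Longrightarrow> \<not> high s a \<Longrightarrow> c a = (0::'k)" "a < n"
  shows "reflect n c x a = (if high s a then reflect n c (hi s x) a else x a)"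
  using assms bf_hi[OF assms(1), where x = x] by (auto simp: reflect_def hi_def)

lemma crow_refl: "a < n \<Longrightarrow> crow (act_pt n (refl_mat n c) v) i a = reflect n c (crow v i) a"
  by (simp add: crow_act_pt mv_refl_mat)

lemma act_refl_square: "qf n c \<noteq> (0::'k) \<Longrightarrow> act_pt n (refl_mat n c) (act_pt n (refl_mat n c) v) = v"
  by (metis act_pt_mult act_pt_one refl_mat_carrier refl_mat_square two)

lemma normal_row_cong: "i \<le> 2 * \<nu> \<Longrightarrow> 1 \<le> i \<Longrightarrow> (\<And>a. a < n \<Longrightarrow> x a = y a) \<Longrightarrow> normal_row i x \<longleftrightarrow> normal_row i y"
proof -
  assume "i \<le> 2 * \<nu>" "1 \<le> i" and e: "\<And>a. a < n \<Longrightarrow> x a = y a"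
  then have "blk i < \<nu>" by (auto simp: blk_def)
  then show ?thesis using e nu_lt[of "blk i"] by (auto simp: normal_row_def)
qed

text \<open>Rows inside the first \<open>s\<close> planes are orthogonal to a vector
  \<open>c\<close> supported outside of them. Later reflections therefore do not spoil rows that are
  already normalised.\<close>

lemma normal_row_refl_earlier:
  assumes "normal_row i (crow v i)" "1 \<le> i" "i \<le> 2 * s" "s \<le> \<nu>"
    and c: "\<And>a. a < n \<Longrightarrow> \<not> high s a \<Longrightarrow> c a = (0::'k)"
  shows "normal_row i (crow (act_pt n (refl_mat n c) v) i)"
proof -
  have "Suc (blk i) \<le> s" using assms(2,3) by (auto simp: blk_def)
  then have "crow v i a = 0" if "a < n" "high s a" for a
    using that assms(1) by (auto simp: normal_row_def high_def)
  then have "bf n (crow v i) c = 0"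
    using c by (rule bf_high_low)
  then have "reflect n c (crow v i) = crow v i" by (rule reflect_fix[OF two])
  then show ?thesis using assms(1-4)
    by (subst normal_row_cong[of i _ "crow v i"]) (auto simp: crow_refl)
qed

lemma normal_row_pair:
  assumes "1 \<le> i" "i \<le> 2 * \<nu>" and "\<And>a. a < n \<Longrightarrow> high (blk i) a \<Longrightarrow> x a = pair (blk i) p r a"
    and "odd i \<Longrightarrow> p = 1 \<and> r \<noteq> 0"
  shows "normal_row i x"
proof -
  have b: "blk i < \<nu>" using assms by (auto simp: blk_def)
  have "x a = 0" if "a < n" "high (Suc (blk i)) a" for a
  proof -
    have "high (blk i) a" "a \<noteq> blk i" "a \<noteq> \<nu> + blk i"
      using that b by (auto simp: high_def)
    then show ?thesis using assms(3)[OF that(1)] by (simp add: pair_def)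
  qed
  moreover have "x (blk i) = p" "x (\<nu> + blk i) = r"
    using assms(3)[of "blk i"] assms(3)[of "\<nu> + blk i"] b nu_lt[OF b]
    by (auto simp: high_simps pair_def)
  ultimately show ?thesis using assms(4) by (simp add: normal_row_def)
qed

text \<open>The part \<open>y\<close> of the new vector outside the first \<open>s\<close> planes
  and the target \<open>(1, q(y))\<close> in plane \<open>s\<close> have the same \<open>q\<close>,
  so the reflection in their difference takes one to the other. The assumption \<open>B\<close> says
  that this difference is nonsingular.\<close>

lemma odd_step:
  assumes s: "s < \<nu>" and v: "normal_upto (2 * s) v"
    and y: "y = hi s (crow v (2 * s + 1))" and q: "qf n y \<noteq> 0" and B: "bf n y (pair s 1 (qf n y)) \<noteq> (0::'k)"
  shows "\<exists>w b h. reflprod n b h \<and> act_pt n h w = v \<and> normal_upto (2 * s + 1) w"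
proof -
  let ?b = "pair s 1 (qf n y)"
  define c where "c = (\<lambda>a. y a - ?b a)"
  define w where "w = act_pt n (refl_mat n c) v"
  have c0: "c a = 0" if "a < n" "\<not> high s a" for a
    using that s by (auto simp: c_def y hi_def pair_def high_def)
  have iso: "qf n y = qf n ?b" by (simp add: qf_pair s)
  then have qc: "qf n c \<noteq> 0" unfolding c_def using B qf_diff_isometric[OF two] by metis
  have refl: "reflect n c y = ?b" unfolding c_def by (rule reflect_diff[OF two iso B])
  have "normal_row i (crow w i)" if "i \<in> {1..2 * s + 1}" for i
  proof (cases "i \<le> 2 * s")
    case True
    then show ?thesis unfolding w_def using v s that
      by (intro normal_row_refl_earlier[of i v s] c0) (auto simp: normal_upto_def)
  next
    case False
    then have i: "i = 2 * s + 1" using that by simp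
    have "crow w i a = ?b a" if "a < n" "high (blk i) a" for a
      using that reflect_low[where s = s and a = a and c = c and x = "crow v i"] c0 refl i
      by (simp add: w_def crow_refl y blk_def)
    then show ?thesis using s q i
      by (intro normal_row_pair[of _ _ 1 "qf n y"]) (auto simp: blk_def)
  qed
  then have "normal_upto (2 * s + 1) w" by (simp add: normal_upto_def)
  moreover have "act_pt n (refl_mat n c) w = v" unfolding w_def by (rule act_refl_square[OF qc])
  ultimately show ?thesis using reflprod_refl[OF qc] by blast
qed

lemma quadratic_root: "a \<noteq> 0 \<Longrightarrow> \<exists>t :: 'k. a * t\<^sup>2 + \<beta> * t + q = 0"
proof -
  assume a: "a \<noteq> 0"
  have "\<exists>t. poly [:q, \<beta>, a:] t = 0"
    by (rule alg_closed_imp_poly_has_root) (use a in simp)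
  then show ?thesis by (auto simp: algebra_simps power2_eq_square)
qed

text \<open>The target \<open>b\<close> must satisfy \<open>q(b) = q(y)\<close> and
  \<open>bf n d b = bf n d y\<close>, the latter in order that \<open>y - b\<close> be orthogonal to
  the preceding row, which is to stay fixed. With \<open>d = (1, a0)\<close> the second condition
  leaves \<open>b = (t, \<beta> + a0 t)\<close>, and the first becomes a quadratic equation for
  \<open>t\<close>.\<close>

lemma even_step:
  assumes s: "s < \<nu>" and v: "normal_upto (2 * s + 1) v"
    and y: "y = hi s (crow v (2 * s + 2))" and B: "bf n (crow v (2 * s + 1)) y \<noteq> (0::'k)"
  shows "\<exists>w b h. reflprod n b h \<and> act_pt n h w = v \<and> normal_upto (2 * s + 2) w"
proof -
  define a0 where "a0 = crow v (2 * s + 1) (\<nu> + s)"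
  define d where "d = pair s 1 a0"
  have nr: "normal_row (2 * s + 1) (crow v (2 * s + 1))" using v by (simp add: normal_upto_def)
  have bl: "blk (2 * s + 1) = s" "blk (2 * s + 2) = s" "blk (Suc (2 * s)) = s" "blk (Suc (Suc (2 * s))) = s" by (auto simp: blk_def)
  have a0: "a0 \<noteq> 0" using nr by (simp add: normal_row_def bl a0_def)
  have hid: "hi s (crow v (2 * s + 1)) a = d a" if "a < n" for a
  proof (cases "a = s \<or> a = \<nu> + s")
    case True
    then show ?thesis using nr s that
      by (auto simp: d_def hi_def pair_def a0_def normal_row_def bl high_simps)
  next
    case False
    have "high (Suc s) a" if "high s a"
      using \<open>a < n\<close> by (rule idx_cases) (use False that in \<open>auto simp: high_simps\<close>)
    then show ?thesis using False nr that
      by (auto simp: d_def hi_def pair_def normal_row_def bl)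
  qed
  have y0: "y a = 0" if "a < n" "\<not> high s a" for a using that by (simp add: y hi_def)
  have d0: "d a = 0" if "a < n" "\<not> high s a" for a using that s by (auto simp: d_def pair_def high_def)
  have bfd: "bf n (crow v (2 * s + 1)) c = bf n d c" if "\<And>a. a < n \<Longrightarrow> \<not> high s a \<Longrightarrow> c a = 0" for c
  proof -
    have "bf n (crow v (2 * s + 1)) c = bf n (hi s (crow v (2 * s + 1))) c"
      by (rule bf_hi) (rule that)
    also have "\<dots> = bf n d c" by (rule bf_cong) (use hid in auto)
    finally show ?thesis .
  qed
  define \<beta> where "\<beta> = bf n d y"
  have \<beta>: "\<beta> \<noteq> 0" using B bfd[OF y0] by (simp add: \<beta>_def)
  obtain t where t: "a0 * t\<^sup>2 + \<beta> * t + qf n y = 0" using quadratic_root[OF a0] by blast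
  define b where "b = pair s t (\<beta> + a0 * t)"
  have b0: "b a = 0" if "a < n" "\<not> high s a" for a using that s by (auto simp: b_def pair_def high_def)
  have qb: "qf n b = qf n y"
  proof -
    have "qf n b = a0 * t\<^sup>2 + \<beta> * t" using s by (simp add: b_def qf_pair algebra_simps power2_eq_square)
    also have "\<dots> = - qf n y" using t by (simp add: eq_neg_iff_add_eq_0)
    finally show ?thesis by (simp add: minus_eq[OF two])
  qed
  have bdb: "bf n d b = \<beta>"
    using s by (simp add: d_def b_def bf_pair) (simp add: pair_def add.assoc add_self[OF two])
  have qd: "qf n d = a0" using s by (simp add: d_def qf_pair)
  have earlier: "normal_upto (2 * s) u \<Longrightarrow> \<forall>i\<in>{1..2 * s}. normal_row i (crow (act_pt n (refl_mat n c) u) i)"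
    if "\<And>a. a < n \<Longrightarrow> \<not> high s a \<Longrightarrow> c a = 0" for c u
    using that s by (intro ballI normal_row_refl_earlier[of _ u s]) (auto simp: normal_upto_def)
  have odd_row: "normal_row (2 * s + 1) (crow (act_pt n (refl_mat n c) u) (2 * s + 1))"
    if "normal_row (2 * s + 1) (crow u (2 * s + 1))" "bf n (crow u (2 * s + 1)) c = 0" for c u
    using that s reflect_fix[OF two that(2)]
    by (subst normal_row_cong[of _ _ "crow u (2 * s + 1)"]) (auto simp: crow_refl)
  \<comment> \<open>Stated for any \<open>u\<close>, because it is applied to \<open>v\<close> and,
    in the singular case, to a reflected copy of \<open>v\<close>.\<close>
  have main: "\<exists>c. qf n c \<noteq> 0 \<and> normal_upto (2 * s + 2) (act_pt n (refl_mat n c) u)"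
    if u: "normal_upto (2 * s + 1) u" and d: "\<And>c. (\<And>a. a < n \<Longrightarrow> \<not> high s a \<Longrightarrow> c a = 0) \<Longrightarrow>
      bf n (crow u (2 * s + 1)) c = bf n d c"
      and z: "z = hi s (crow u (2 * s + 2))" "qf n z = qf n b" "bf n d z = \<beta>" "bf n z b \<noteq> 0" for u z
  proof -
    define c where "c = (\<lambda>a. z a - b a)"
    have c0: "c a = 0" if "a < n" "\<not> high s a" for a
      using that b0 by (simp add: c_def z(1) hi_def)
    have qc: "qf n c \<noteq> 0" unfolding c_def using z qf_diff_isometric[OF two] by metis
    have refl: "reflect n c z = b" unfolding c_def by (rule reflect_diff[OF two z(2,4)])
    have "bf n (crow u (2 * s + 1)) c = bf n d c" by (rule d) (rule c0)
    also have "\<dots> = 0" unfolding c_def bf_lin by (simp add: z(3) bdb)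
    finally have "bf n (crow u (2 * s + 1)) c = 0" .
    then have "normal_row (2 * s + 1) (crow (act_pt n (refl_mat n c) u) (2 * s + 1))"
      using odd_row u by (simp add: normal_upto_def)
    moreover have "\<forall>i\<in>{1..2 * s}. normal_row i (crow (act_pt n (refl_mat n c) u) i)"
      using u by (intro earlier c0) (auto simp: normal_upto_def)
    moreover have "normal_row (2 * s + 2) (crow (act_pt n (refl_mat n c) u) (2 * s + 2))"
    proof (rule normal_row_pair[of _ _ t "\<beta> + a0 * t"])
      fix a assume "a < n" "high (blk (2 * s + 2)) a"
      then show "crow (act_pt n (refl_mat n c) u) (2 * s + 2) a = pair (blk (2 * s + 2)) t (\<beta> + a0 * t) a"
        using reflect_low[where s = s and a = a and c = c and x = "crow u (2 * s + 2)"] c0 refl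
        by (simp add: crow_refl z(1) bl b_def)
    qed (use s in auto)
    moreover have "i \<in> {1..2 * s} \<or> i = 2 * s + 1 \<or> i = 2 * s + 2" if "i \<in> {1..2 * s + 2}" for i
      using that by auto
    ultimately have "normal_upto (2 * s + 2) (act_pt n (refl_mat n c) u)"
      unfolding normal_upto_def by blast
    then show ?thesis using qc by blast
  qed
  show ?thesis
  proof (cases "bf n y b = 0")
    case False
    then obtain c where c: "qf n c \<noteq> 0" "normal_upto (2 * s + 2) (act_pt n (refl_mat n c) v)"
      using main[OF v bfd y] qb \<beta>_def by auto
    then show ?thesis using reflprod_refl[OF c(1)] act_refl_square[OF c(1)] by blast
  next
    case True
    \<comment> \<open>Here \<open>y - b\<close> is singular. A preliminary reflection in
      \<open>d\<close>, which fixes the preceding row, replaces \<open>y\<close> by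
      \<open>z = y - (\<beta> / a0) d\<close>, and then
      \<open>bf n z b = - (\<beta> * \<beta> / a0)\<close> is nonzero.\<close>
    define u where "u = act_pt n (refl_mat n d) v"
    have dd: "bf n (crow v (2 * s + 1)) d = 0" using bfd[OF d0] by (simp add: bf_self[OF two])
    have crow_odd: "crow u (2 * s + 1) a = crow v (2 * s + 1) a" if "a < n" for a
      unfolding u_def crow_refl[OF that] reflect_fix[OF two dd] ..
    have "normal_row (2 * s + 1) (crow u (2 * s + 1))"
      unfolding u_def by (rule odd_row[OF nr dd])
    moreover have "\<forall>i\<in>{1..2 * s}. normal_row i (crow u i)"
      unfolding u_def using v by (intro earlier d0) (auto simp: normal_upto_def)
    moreover have "i \<in> {1..2 * s} \<or> i = 2 * s + 1" if "i \<in> {1..2 * s + 1}" for i using that by auto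
    ultimately have nu: "normal_upto (2 * s + 1) u" unfolding normal_upto_def by blast
    define z where "z = reflect n d y"
    have z: "z a = hi s (crow u (2 * s + 2)) a" if "a < n" for a
      using that reflect_low[where s = s and a = a and c = d and x = "crow v (2 * s + 2)"] d0 y0
      by (auto simp: u_def z_def hi_def crow_refl y reflect_def)
    define z' where "z' = hi s (crow u (2 * s + 2))"
    have zz: "qf n z' = qf n z" "\<And>x. bf n x z' = bf n x z" "\<And>x. bf n z' x = bf n z x"
      unfolding z'_def using z by (auto intro!: qf_cong bf_cong)
    have qd0: "qf n d \<noteq> 0" using a0 qd by simp
    have "qf n z = qf n b" by (simp add: z_def qf_reflect[OF two qd0] qb)
    moreover have "bf n d z = \<beta>"
      using bf_reflect_left[OF two qd0, of y] by (simp add: z_def \<beta>_def bf_sym[of n d])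
    moreover have "bf n z b = - (\<beta> * \<beta> / a0)"
      unfolding z_def reflect_def bf_lin qd True bdb by (simp add: \<beta>_def bf_sym[of n y])
    ultimately have z'b: "qf n z' = qf n b" "bf n d z' = \<beta>" "bf n z' b \<noteq> 0"
      using \<beta> a0 by (simp_all add: zz)
    have bfu: "bf n (crow u (2 * s + 1)) c = bf n d c" if "\<And>a. a < n \<Longrightarrow> \<not> high s a \<Longrightarrow> c a = 0" for c
    proof -
      have "bf n (crow u (2 * s + 1)) c = bf n (crow v (2 * s + 1)) c"
        by (rule bf_cong[OF crow_odd refl])
      then show ?thesis using bfd[OF that] by simp
    qed
    obtain c where c: "qf n c \<noteq> 0" "normal_upto (2 * s + 2) (act_pt n (refl_mat n c) u)"
      using main[OF nu bfu z'_def z'b] by blast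
    have "act_pt n (refl_mat n d * refl_mat n c) (act_pt n (refl_mat n c) u) = v"
      unfolding act_pt_mult[OF refl_mat_carrier refl_mat_carrier] act_refl_square[OF c(1)]
      unfolding u_def by (rule act_refl_square[OF qd0])
    then show ?thesis
      using reflprod_mult[OF reflprod_refl[OF qd0] reflprod_refl[OF c(1)]] c(2) by blast
  qed
qed

section \<open>Density of the translates of normal tuples\<close>

definition hi_var :: "nat \<Rightarrow> nat \<Rightarrow> nat \<Rightarrow> (nat \<times> nat, 'k) mpoly" where
  "hi_var s i = hi s (\<lambda>a. Var (i, a))"

lemma ev_hi_var: "ev v (hi_var s i a) = hi s (crow v i) a"
  by (simp add: hi_var_def hi_def eval_simps crow_def)

lemma ev_qf_hi: "ev v (qf n (hi_var s i)) = qf n (hi s (crow v i))"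
  by (simp add: eval_qf[OF comm_ring_hom_id] ev_hi_var)

lemma hi_pair: "s < \<nu> \<Longrightarrow> hi s (pair s p r) = pair s p r"
  using nu_lt[of s] by (auto simp: hi_def pair_def high_simps fun_eq_iff)

lemma ex_scalar: "\<exists>p :: 'k. p \<noteq> 0 \<and> p \<noteq> 1"
proof (rule ccontr)
  assume "\<not> ?thesis"
  then have "(UNIV :: 'k set) \<subseteq> {0, 1}" by auto
  then show False using inf finite_subset by blast
qed

text \<open>Each normalisation step needs a condition \<open>G\<close> on the next vector, which may
  fail at the given point. As \<open>G\<close> is not identically zero in that row, the row is
  perturbed so that \<open>G\<close> and the translated \<open>P\<close> are nonzero together; the
  rows before it keep their normal form.\<close>

lemma density_upto:
  assumes "P \<noteq> 0" "j \<le> 2 * \<nu>"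
  shows "\<exists>b g v. reflprod n b g \<and> normal_upto j v \<and> ev (act_pt n g v) P \<noteq> 0"
  using assms(2)
proof (induction j)
  case 0
  obtain v where "ev v P \<noteq> 0" using exists_nonroot[OF inf assms(1)] by blast
  then have "ev (act_pt n (1\<^sub>m n) v) P \<noteq> 0" by (simp add: act_pt_one)
  moreover have "normal_upto 0 v" by (simp add: normal_upto_def)
  ultimately show ?case using reflprod.one by blast
next
  case (Suc j)
  then obtain b g v where g: "reflprod n b g" and v: "normal_upto j v" and P: "ev (act_pt n g v) P \<noteq> 0"
    by auto
  have gc: "g \<in> carrier_mat n n" by (rule reflprod_carrier[OF g])
  have P': "ev v (lin_subst g P) \<noteq> 0" using P by (simp add: eval_lin_subst[OF gc])
  define s where "s = j div 2"
  have s: "s < \<nu>" using Suc.prems by (simp add: s_def)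
  have finish: ?case if "reflprod n b' h" "act_pt n h w = v'" "normal_upto (Suc j) w"
    "ev v' (lin_subst g P) \<noteq> 0" for b' h w v'
  proof -
    have "act_pt n g v' = act_pt n (g * h) w"
      using that(2) act_pt_mult[OF gc reflprod_carrier[OF that(1)]] by simp
    then have "ev (act_pt n (g * h) w) P \<noteq> 0" using that(4) by (simp add: eval_lin_subst[OF gc])
    then show ?thesis using reflprod_mult[OF g that(1)] that(3) by blast
  qed
  have upto: "normal_upto j v'" if "\<And>x. fst x \<noteq> Suc j \<Longrightarrow> v' x = v x" for v'
  proof -
    have "crow v' i = crow v i" if "i \<in> {1..j}" for i
      using that \<open>\<And>x. fst x \<noteq> Suc j \<Longrightarrow> v' x = v x\<close> by (auto simp: crow_def)
    then show ?thesis using v by (simp add: normal_upto_def)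
  qed
  show ?case
  proof (cases "even j")
    case True
    then have j: "j = 2 * s" by (simp add: s_def)
    define G where "G = qf n (hi_var s (Suc j)) *
      bf n (hi_var s (Suc j)) (pair s 1 (qf n (hi_var s (Suc j))))"
    have evG: "ev u G = qf n (hi s (crow u (Suc j))) *
      bf n (hi s (crow u (Suc j))) (pair s 1 (qf n (hi s (crow u (Suc j)))))" for u
    proof -
      have "(\<lambda>a. ev u (pair s 1 (qf n (hi_var s (Suc j))) a)) = pair s 1 (qf n (hi s (crow u (Suc j))))"
        by (auto simp: pair_def ev_qf_hi eval_simps fun_eq_iff)
      then show ?thesis
        by (simp add: G_def eval_simps(3) ev_qf_hi eval_bf[OF comm_ring_hom_id] ev_hi_var)
    qed
    obtain p :: 'k where p: "p \<noteq> 0" "p \<noteq> 1" using ex_scalar by blast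
    \<comment> \<open>For \<open>(p, 1)\<close> the value of \<open>q\<close> is \<open>p\<close>,
      and the polar form with the target \<open>(1, p)\<close> is
      \<open>p^2 + 1 = (p - 1)^2\<close>; hence the choice of \<open>p\<close> different from 0 and
      1.\<close>
    define v2 where "v2 x = (if fst x = Suc j then pair s p 1 (snd x) else v x)" for x
    have "crow v2 (Suc j) = pair s p 1" by (simp add: v2_def crow_def)
    then have "ev v2 G = p * bf n (pair s p 1) (pair s 1 p)"
      by (simp add: evG hi_pair[OF s] qf_pair[OF s])
    also have "bf n (pair s p 1) (pair s 1 p) = p\<^sup>2 + 1\<^sup>2"
      using s by (simp add: bf_pair power2_eq_square) (simp add: pair_def)
    also have "\<dots> = (p - 1)\<^sup>2" by (simp only: square_add[OF two] diff_eq[OF two])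
    finally have "ev v2 G \<noteq> 0" using p by simp
    then obtain v' where v': "\<And>x. fst x \<noteq> Suc j \<Longrightarrow> v' x = v x"
      "ev v' (lin_subst g P) \<noteq> 0" "ev v' G \<noteq> 0"
      using perturb_row[OF inf P', of v2 G "Suc j"] by (auto simp: v2_def)
    have "\<exists>w b h. reflprod n b h \<and> act_pt n h w = v' \<and> normal_upto (2 * s + 1) w"
      using upto[OF v'(1)] v'(3) by (intro odd_step[OF s]) (auto simp: evG j)
    then show ?thesis using finish v'(2) j by auto
  next
    case False
    then have j: "j = 2 * s + 1" by (simp add: s_def)
    define G where "G = bf n (\<lambda>a. Var (j, a)) (hi_var s (Suc j))"
    have evG: "ev u G = bf n (crow u j) (hi s (crow u (Suc j)))" for u
      by (simp add: G_def eval_bf[OF comm_ring_hom_id] ev_hi_var eval_simps crow_def[of u j])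
    \<comment> \<open>\<open>(0, 1)\<close> is paired with the first coordinate of the preceding row
      in plane \<open>s\<close>, which the normal form fixes as 1.\<close>
    define v2 where "v2 x = (if fst x = Suc j then pair s 0 1 (snd x) else v x)" for x
    have "crow v2 (Suc j) = pair s 0 1" "crow v2 j = crow v j" by (simp_all add: v2_def crow_def)
    then have "ev v2 G = crow v j s"
      unfolding evG by (simp add: hi_pair[OF s] bf_sym[of n "crow v j"] bf_pair[OF s])
    moreover have "normal_row j (crow v j)" "odd j" "blk j = s"
      using v j by (simp_all add: normal_upto_def blk_def)
    then have "crow v j s = 1" by (simp add: normal_row_def)
    ultimately have "ev v2 G \<noteq> 0" by simp
    then obtain v' where v': "\<And>x. fst x \<noteq> Suc j \<Longrightarrow> v' x = v x"
      "ev v' (lin_subst g P) \<noteq> 0" "ev v' G \<noteq> 0"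
      using perturb_row[OF inf P', of v2 G "Suc j"] by (auto simp: v2_def)
    have "\<exists>w b h. reflprod n b h \<and> act_pt n h w = v' \<and> normal_upto (2 * s + 2) w"
      using upto[OF v'(1)] v'(3) by (intro even_step[OF s _ refl]) (auto simp: evG j)
    then show ?thesis using finish v'(2) j by auto
  qed
qed

lemma density:
  assumes "P \<noteq> 0"
  obtains b g \<xi> where "reflprod n b g" "normal_upto nv \<xi>" "ev (act_pt n g \<xi>) P \<noteq> 0"
proof -
  have "nv \<le> 2 * \<nu>" by (simp add: nv_def)
  then show ?thesis using density_upto[OF assms] that by blast
qed

end


section \<open>The hafnian in characteristic 2\<close>

lemma prod_pairs: "(\<Prod>k=1..2 * n. g k) = (\<Prod>t=1..n. g (2 * t - 1) * g (2 * t))" for g :: "nat \<Rightarrow> 'a::comm_monoid_mult"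
  by (induction n) (simp_all add: mult.assoc)

lemma even_card_involution:
  assumes "finite S" "\<And>x. x \<in> S \<Longrightarrow> \<phi> x \<in> S" "\<And>x. x \<in> S \<Longrightarrow> \<phi> (\<phi> x) = x" "\<And>x. x \<in> S \<Longrightarrow> \<phi> x \<noteq> x"
  shows "even (card S)"
  using assms
proof (induction "card S" arbitrary: S rule: less_induct)
  case less
  show ?case
  proof (cases "S = {}")
    case False
    then obtain x where x: "x \<in> S" by blast
    let ?T = "S - {x, \<phi> x}"
    have sub: "{x, \<phi> x} \<subseteq> S" using x less.prems by auto
    have "card {x, \<phi> x} = 2" using less.prems(4)[OF x] by simp
    then have card: "card S = card ?T + 2"
      using card_Diff_subset[OF _ sub] card_mono[OF less.prems(1) sub] by simp
    have T: "\<phi> y \<in> ?T" if "y \<in> ?T" for y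
    proof -
      have "\<phi> y \<noteq> x" using that less.prems(3)[of y] by auto
      moreover have "\<phi> y \<noteq> \<phi> x" using that less.prems(3)[of y] less.prems(3)[OF x] by auto
      ultimately show ?thesis using that less.prems(2) by simp
    qed
    have "even (card ?T)"
      by (rule less.hyps) (use card less.prems T in auto)
    then show ?thesis using card by simp
  qed simp
qed

section \<open>Perfect matchings as fixed-point-free involutions\<close>

definition matchings :: "nat \<Rightarrow> (nat \<Rightarrow> nat) set" where
  "matchings \<nu> = {\<tau>. \<tau> permutes {1..2 * \<nu>} \<and> (\<forall>i\<in>{1..2 * \<nu>}. \<tau> (\<tau> i) = i \<and> \<tau> i \<noteq> i)}"

text \<open>Partners are the entries at the positions \<open>2 t - 1\<close> and \<open>2 t\<close>
  of the sequence \<open>s\<close>; \<open>k\<close> is the position of \<open>i\<close>.\<close>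

definition matching_of :: "nat \<Rightarrow> (nat \<Rightarrow> nat) \<Rightarrow> nat \<Rightarrow> nat" where
  "matching_of \<nu> s = (\<lambda>i. if i \<in> {1..2 * \<nu>} then
     let k = inv_into UNIV s i in s (if odd k then k + 1 else k - 1) else i)"

lemma matching_of_simps:
  assumes "s permutes {1..2 * \<nu>}" "t \<in> {1..\<nu>}"
  shows "matching_of \<nu> s (s (2 * t - 1)) = s (2 * t)" "matching_of \<nu> s (s (2 * t)) = s (2 * t - 1)"
proof -
  have "s (2 * t - 1) \<in> {1..2 * \<nu>}" "s (2 * t) \<in> {1..2 * \<nu>}"
    using assms(2) by (auto simp only: permutes_in_image[OF assms(1)], auto)
  moreover have "inv_into UNIV s (s k) = k" for k using permutes_inverses(2)[OF assms(1)] by simp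
  moreover have "odd (2 * t - 1)" using assms(2) by auto
  ultimately show "matching_of \<nu> s (s (2 * t - 1)) = s (2 * t)" "matching_of \<nu> s (s (2 * t)) = s (2 * t - 1)"
    using assms(2) unfolding matching_of_def Let_def by (auto simp del: even_diff_nat)
qed

lemma permutes_pair_cases:
  fixes s :: "nat \<Rightarrow> nat"
  assumes "s permutes {1..2 * \<nu>}" "i \<in> {1..2 * \<nu>}"
  obtains t where "t \<in> {1..\<nu>}" "i = s (2 * t - 1)" | t where "t \<in> {1..\<nu>}" "i = s (2 * t)"
proof -
  define k where "k = inv_into UNIV s i"
  have k: "k \<in> {1..2 * \<nu>}" "i = s k"
    using assms by (simp_all add: k_def permutes_inv permutes_in_image[OF permutes_inv] permutes_inverses del: atLeastAtMost_iff)
  show ?thesis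
  proof (cases "even k")
    case True
    then obtain t where "k = 2 * t" by (elim evenE)
    then show ?thesis using k that(2)[of t] by auto
  next
    case False
    then obtain t where "k = 2 * t + 1" by (elim oddE)
    then show ?thesis using k that(1)[of "t + 1"] by auto
  qed
qed

lemma matching_of_in:
  assumes s: "s permutes {1..2 * \<nu>}"
  shows "matching_of \<nu> s \<in> matchings \<nu>"
proof -
  let ?\<tau> = "matching_of \<nu> s" and ?D = "{1..2 * \<nu>}"
  have inD: "s (2 * t) \<in> ?D" "s (2 * t - 1) \<in> ?D" if "t \<in> {1..\<nu>}" for t
    using that by (auto simp only: permutes_in_image[OF s], auto)
  have neq: "s (2 * t) \<noteq> s (2 * t - 1)" if "t \<in> {1..\<nu>}" for t
    using that permutes_inj[OF s] by (auto simp: inj_eq)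
  have *: "?\<tau> i \<in> ?D \<and> ?\<tau> (?\<tau> i) = i \<and> ?\<tau> i \<noteq> i" if "i \<in> ?D" for i
    using s that by (rule permutes_pair_cases) (metis matching_of_simps[OF s] inD neq)+
  have "bij_betw ?\<tau> ?D ?D"
    by (rule bij_betw_byWitness[of _ ?\<tau>]) (use * in auto)
  then have "?\<tau> permutes ?D"
    by (rule bij_imp_permutes) (simp only: matching_of_def if_False)
  then show ?thesis using * by (simp add: matchings_def)
qed

lemma strict_mono_enum_unique:
  assumes "strict_mono_on {1..k::nat} g" "strict_mono_on {1..k} h" "g ` {1..k} = h ` {1..k}" "t \<in> {1..k}"
  shows "g t = (h t :: nat)"
proof -
  have *: "map f [1..<k + 1] = sorted_list_of_set (f ` {1..k})" if "strict_mono_on {1..k} f" for f :: "nat \<Rightarrow> nat"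
  proof -
    have "inj_on f {1..k}" using that by (rule strict_mono_on_imp_inj_on)
    then have "distinct (map f [1..<k + 1])" by (simp add: distinct_map atLeastLessThanSuc_atLeastAtMost del: upt_Suc)
    moreover have "sorted (map f [1..<k + 1])"
      unfolding sorted_iff_nth_mono_less
    proof (intro allI impI)
      fix i j assume ij: "i < j" "j < length (map f [1..<k + 1])"
      then have "f (1 + i) < f (1 + j)" by (intro strict_mono_onD[OF that]) (auto simp del: upt_Suc)
      then show "map f [1..<k + 1] ! i \<le> map f [1..<k + 1] ! j" using ij by (simp del: upt_Suc)
    qed
    moreover have "set (map f [1..<k + 1]) = f ` {1..k}" by (simp add: atLeastLessThanSuc_atLeastAtMost del: upt_Suc)
    ultimately show ?thesis by (metis sorted_list_of_set.idem_if_sorted_distinct)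
  qed
  have "map g [1..<k + 1] = map h [1..<k + 1]" using *[OF assms(1)] *[OF assms(2)] assms(3) by (simp del: upt_Suc)
  then have "map g [1..<k + 1] ! (t - 1) = map h [1..<k + 1] ! (t - 1)" by (simp only:)
  moreover have "t - 1 < length [1..<k + 1]" "[1..<k + 1] ! (t - 1) = t"
    using assms(4) by (auto simp del: upt_Suc)
  ultimately show ?thesis by (simp only: nth_map)
qed

text \<open>Recovers the sequence from its matching: the first members of the pairs are those
  smaller than their partners, and increasing order leaves only one way of listing them.\<close>

lemma pairings_first_elements:
  assumes "s \<in> pairings \<nu>"
  shows "strict_mono_on {1..\<nu>} (\<lambda>t. s (2 * t - 1))"
    "(\<lambda>t. s (2 * t - 1)) ` {1..\<nu>} = {i \<in> {1..2 * \<nu>}. i < matching_of \<nu> s i}"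
proof -
  have s: "s permutes {1..2 * \<nu>}" and lt: "\<And>t. t \<in> {1..\<nu>} \<Longrightarrow> s (2 * t - 1) < s (2 * t)"
    and mono: "\<And>t u. t \<in> {1..\<nu>} \<Longrightarrow> u \<in> {1..\<nu>} \<Longrightarrow> t < u \<Longrightarrow> s (2 * t - 1) < s (2 * u - 1)"
    using assms by (auto simp: pairings_def)
  show "strict_mono_on {1..\<nu>} (\<lambda>t. s (2 * t - 1))"
    by (rule strict_mono_onI) (use mono in simp)
  show "(\<lambda>t. s (2 * t - 1)) ` {1..\<nu>} = {i \<in> {1..2 * \<nu>}. i < matching_of \<nu> s i}"
  proof (intro equalityI subsetI)
    fix i assume "i \<in> (\<lambda>t. s (2 * t - 1)) ` {1..\<nu>}"
    then obtain t where t: "t \<in> {1..\<nu>}" "i = s (2 * t - 1)" by blast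
    have "s (2 * t - 1) \<in> {1..2 * \<nu>}" using t by (auto simp only: permutes_in_image[OF s], auto)
    then show "i \<in> {i \<in> {1..2 * \<nu>}. i < matching_of \<nu> s i}"
      using t lt[OF t(1)] matching_of_simps(1)[OF s t(1)] by simp
  next
    fix i assume "i \<in> {i \<in> {1..2 * \<nu>}. i < matching_of \<nu> s i}"
    then have i: "i \<in> {1..2 * \<nu>}" "i < matching_of \<nu> s i" by auto
    show "i \<in> (\<lambda>t. s (2 * t - 1)) ` {1..\<nu>}"
      using s i(1)
    proof (rule permutes_pair_cases)
      fix t assume t: "t \<in> {1..\<nu>}" "i = s (2 * t)"
      then show ?thesis using i(2) lt[OF t(1)] matching_of_simps(2)[OF s t(1)] by simp
    qed blast
  qed
qed

text \<open>For surjectivity, the smaller members of the pairs of \<open>\<tau>\<close> are listed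
  in increasing order, each followed by its partner.\<close>

lemma bij_betw_pairings: "bij_betw (matching_of \<nu>) (pairings \<nu>) (matchings \<nu>)"
proof (rule bij_betwI')
  fix s s' assume s: "s \<in> pairings \<nu>" and s': "s' \<in> pairings \<nu>"
  have p: "s permutes {1..2 * \<nu>}" "s' permutes {1..2 * \<nu>}" using s s' by (auto simp: pairings_def)
  show "matching_of \<nu> s = matching_of \<nu> s' \<longleftrightarrow> s = s'"
  proof
    assume eq: "matching_of \<nu> s = matching_of \<nu> s'"
    have 1: "s (2 * t - 1) = s' (2 * t - 1)" if "t \<in> {1..\<nu>}" for t
      using strict_mono_enum_unique[OF pairings_first_elements(1)[OF s] pairings_first_elements(1)[OF s'] _ that]
        pairings_first_elements(2)[OF s] pairings_first_elements(2)[OF s'] eq by simp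
    have 2: "s (2 * t) = s' (2 * t)" if "t \<in> {1..\<nu>}" for t
      using matching_of_simps(1)[OF p(1) that] matching_of_simps(1)[OF p(2) that] 1[OF that] eq by simp
    show "s = s'"
    proof
      fix k
      show "s k = s' k"
      proof (cases "k \<in> {1..2 * \<nu>}")
        case False
        then show ?thesis using p by (simp add: permutes_not_in)
      next
        case True
        show ?thesis
        proof (cases "even k")
          case True
          then obtain t where "k = 2 * t" by (elim evenE)
          then show ?thesis using 2[of t] \<open>k \<in> _\<close> by auto
        next
          case False
          then obtain t where "k = 2 * t + 1" by (elim oddE)
          then show ?thesis using 1[of "t + 1"] \<open>k \<in> _\<close> by auto
        qed
      qed
    qed
  qed simp
next
  fix s assume "s \<in> pairings \<nu>"
  then show "matching_of \<nu> s \<in> matchings \<nu>" by (simp add: matching_of_in pairings_def)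
next
  fix \<tau> assume \<tau>: "\<tau> \<in> matchings \<nu>"
  let ?D = "{1..2 * \<nu>}"
  have perm: "\<tau> permutes ?D" and inv: "\<And>i. i \<in> ?D \<Longrightarrow> \<tau> (\<tau> i) = i" and nofix: "\<And>i. i \<in> ?D \<Longrightarrow> \<tau> i \<noteq> i"
    using \<tau> by (auto simp: matchings_def)
  have inD: "\<tau> i \<in> ?D \<longleftrightarrow> i \<in> ?D" for i by (rule permutes_in_image[OF perm])
  define A where "A = {i \<in> ?D. i < \<tau> i}"
  have "?D = A \<union> \<tau> ` A"
  proof (intro equalityI subsetI)
    fix i assume i: "i \<in> ?D"
    show "i \<in> A \<union> \<tau> ` A"
    proof (cases "i < \<tau> i")
      case False
      then have "\<tau> i < \<tau> (\<tau> i)" using inv[OF i] nofix[OF i] by simp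
      then have "\<tau> i \<in> A" using i inD by (simp add: A_def)
      then show ?thesis using inv[OF i] by (metis UnI2 imageI)
    qed (use i in \<open>simp add: A_def\<close>)
  qed (use inD in \<open>auto simp: A_def\<close>)
  moreover have "A \<inter> \<tau> ` A = {}"
    using inv by (auto simp: A_def)
  moreover have "card (\<tau> ` A) = card A"
    by (rule card_image) (rule inj_on_subset[OF permutes_inj_on[OF perm] subset_UNIV])
  moreover have finA: "finite A" by (simp add: A_def)
  ultimately have "card ?D = card A + card A"
    by (metis card_Un_disjoint finite_imageI)
  then have cardA: "card A = \<nu>" by simp
  define xs where "xs = sorted_list_of_set A"
  have len: "length xs = \<nu>" by (simp add: xs_def cardA)
  have setxs: "set xs = A" using finA by (simp add: xs_def)
  have xs_mono: "xs ! i < xs ! j" if "i < j" "j < \<nu>" for i j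
    using that len unfolding xs_def by (metis sorted_wrt_nth_less strict_sorted_list_of_set)
  have xsA: "xs ! i \<in> A" if "i < \<nu>" for i using that len setxs nth_mem by metis
  \<comment> \<open>Positions are counted from 1 and list entries from 0, so that both positions
    \<open>2 t - 1\<close> and \<open>2 t\<close> have \<open>(k - 1) div 2 = t - 1\<close>.\<close>
  define s where "s k = (if k \<in> ?D then (if odd k then xs ! ((k - 1) div 2) else \<tau> (xs ! ((k - 1) div 2))) else k)" for k
  have s1: "s (2 * t - 1) = xs ! (t - 1)" and s2: "s (2 * t) = \<tau> (xs ! (t - 1))" if "t \<in> {1..\<nu>}" for t
  proof -
    have "(2 * t - 1 - 1) div 2 = t - 1" "(2 * t - 1) div 2 = t - 1" "odd (2 * t - 1)"
      "2 * t - 1 \<in> ?D" "2 * t \<in> ?D" using that by auto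
    then show "s (2 * t - 1) = xs ! (t - 1)" "s (2 * t) = \<tau> (xs ! (t - 1))"
      unfolding s_def by (simp_all only: if_True if_False even_mult_iff even_numeral simp_thms)
  qed
  have "?D \<subseteq> s ` ?D"
  proof
    fix i assume i: "i \<in> ?D"
    then obtain j where j: "j \<in> A" "i = j \<or> i = \<tau> j" using \<open>?D = A \<union> \<tau> ` A\<close> by blast
    then obtain u where u: "u < \<nu>" "xs ! u = j" using setxs len by (metis in_set_conv_nth)
    then have "s (2 * Suc u - 1) = j" "s (2 * Suc u) = \<tau> j" using s1[of "Suc u"] s2[of "Suc u"] by auto
    moreover have "2 * Suc u - 1 \<in> ?D" "2 * Suc u \<in> ?D" using u by auto
    ultimately show "i \<in> s ` ?D" using j(2) by (metis imageI)
  qed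
  moreover have "s ` ?D \<subseteq> ?D"
  proof
    fix i assume "i \<in> s ` ?D"
    then obtain k where k: "k \<in> ?D" "i = s k" by blast
    have "(k - 1) div 2 < \<nu>" using k by auto
    then have "xs ! ((k - 1) div 2) \<in> ?D" using xsA by (auto simp: A_def)
    then show "i \<in> ?D" using k inD by (simp add: s_def)
  qed
  ultimately have "s ` ?D = ?D" by blast
  then have "bij_betw s ?D ?D" by (simp add: bij_betw_def finite_surj_inj)
  then have sperm: "s permutes ?D"
    by (rule bij_imp_permutes) (simp only: s_def if_False)
  have "s \<in> pairings \<nu>"
    unfolding pairings_def
  proof (intro CollectI conjI ballI impI)
    show "s permutes ?D" by (rule sperm)
    show "s (2 * t - 1) < s (2 * t)" if "t \<in> {1..\<nu>}" for t
      using s1[OF that] s2[OF that] xsA[of "t - 1"] that by (auto simp: A_def)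
    show "s (2 * t - 1) < s (2 * u - 1)" if "t \<in> {1..\<nu>}" "u \<in> {1..\<nu>}" "t < u" for t u
      using s1[OF that(1)] s1[OF that(2)] xs_mono[of "t - 1" "u - 1"] that by auto
  qed
  moreover have "\<tau> = matching_of \<nu> s"
  proof
    fix i
    show "\<tau> i = matching_of \<nu> s i"
    proof (cases "i \<in> ?D")
      case False
      then show ?thesis using permutes_not_in[OF perm] by (simp only: matching_of_def if_False)
    next
      case True
      with sperm show ?thesis
      proof (rule permutes_pair_cases)
        fix t assume t: "t \<in> {1..\<nu>}" "i = s (2 * t - 1)"
        then show ?thesis using matching_of_simps(1)[OF sperm t(1)] s1[OF t(1)] s2[OF t(1)] by simp
      next
        fix t assume t: "t \<in> {1..\<nu>}" "i = s (2 * t)"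
        moreover have "xs ! (t - 1) \<in> ?D" using xsA[of "t - 1"] t by (auto simp: A_def)
        ultimately show ?thesis using matching_of_simps(2)[OF sperm t(1)] s1[OF t(1)] s2[OF t(1)] inv by simp
      qed
    qed
  qed
  ultimately show "\<exists>s\<in>pairings \<nu>. \<tau> = matching_of \<nu> s" by blast
qed

section \<open>Coordinates paired by the polar form, and the monomials of the hafnian\<close>

definition conj_idx :: "nat \<Rightarrow> nat \<Rightarrow> nat" where
  "conj_idx \<nu> a = (if a < \<nu> then \<nu> + a else a - \<nu>)"

lemma conj_idx: "a < 2 * \<nu> \<Longrightarrow> conj_idx \<nu> a < 2 * \<nu>" "a < 2 * \<nu> \<Longrightarrow> conj_idx \<nu> (conj_idx \<nu> a) = a"
  "a < 2 * \<nu> \<Longrightarrow> conj_idx \<nu> a \<noteq> a"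
  by (auto simp: conj_idx_def)

lemma bf_conj_idx: "bf (2 * \<nu>) x y = (\<Sum>a<2 * \<nu>. x a * y (conj_idx \<nu> a))"
  unfolding sum_split_halves bf_def sum.distrib by (simp add: conj_idx_def)

definition hafnian :: "nat \<Rightarrow> (nat \<Rightarrow> nat \<Rightarrow> 'a::comm_ring_1) \<Rightarrow> 'a" where
  "hafnian \<nu> B = (\<Sum>s\<in>pairings \<nu>. \<Prod>t=1..\<nu>. B (s (2 * t - 1)) (s (2 * t)))"

text \<open>\<open>f i\<close> is the coordinate taken from vector \<open>i\<close> when a product
  of the \<open>B\<close> is multiplied out; the two members of a pair must contribute coordinates
  that the polar form pairs.\<close>

definition compatible :: "nat \<Rightarrow> (nat \<Rightarrow> nat) \<Rightarrow> (nat \<Rightarrow> nat) \<Rightarrow> bool" where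
  "compatible \<nu> \<tau> f \<longleftrightarrow> (\<forall>i\<in>{1..2 * \<nu>}. f (\<tau> i) = conj_idx \<nu> (f i))"

lemma finite_matchings: "finite (matchings \<nu>)"
  by (rule finite_subset[OF _ finite_permutations[of "{1..2 * \<nu>}"]]) (auto simp: matchings_def)

lemma finite_pairings: "finite (pairings \<nu>)"
  by (rule finite_subset[OF _ finite_permutations[of "{1..2 * \<nu>}"]]) (auto simp: pairings_def)

text \<open>When every coordinate is used exactly once, the partner of \<open>i\<close> is forced:
  it is the vector contributing the coordinate conjugate to \<open>f i\<close>.\<close>

lemma card_compatible_inj:
  assumes f: "bij_betw f {1..2 * \<nu>} {..<2 * \<nu>}"
  shows "card {\<tau> \<in> matchings \<nu>. compatible \<nu> \<tau> f} = 1"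
proof -
  let ?D = "{1..2 * \<nu>}"
  define g where "g = inv_into ?D f"
  have fD: "f i < 2 * \<nu>" if "i \<in> ?D" for i using f that by (auto simp: bij_betw_def)
  have gD: "g a \<in> ?D" and fg: "f (g a) = a" if "a < 2 * \<nu>" for a
    using that f unfolding g_def by (auto simp: bij_betw_def intro: inv_into_into f_inv_into_f simp del: atLeastAtMost_iff)
  have gf: "g (f i) = i" if "i \<in> ?D" for i
    using that f unfolding g_def by (simp add: bij_betw_def inv_into_f_f)
  define \<sigma> where "\<sigma> i = (if i \<in> ?D then g (conj_idx \<nu> (f i)) else i)" for i
  have \<sigma>: "\<sigma> i \<in> ?D \<and> f (\<sigma> i) = conj_idx \<nu> (f i) \<and> \<sigma> (\<sigma> i) = i \<and> \<sigma> i \<noteq> i" if i: "i \<in> ?D" for i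
  proof -
    have c: "conj_idx \<nu> (f i) < 2 * \<nu>" by (rule conj_idx(1)[OF fD[OF i]])
    have s: "\<sigma> i = g (conj_idx \<nu> (f i))" using i by (simp only: \<sigma>_def if_True)
    have sD: "\<sigma> i \<in> ?D" unfolding s by (rule gD[OF c])
    have fs: "f (\<sigma> i) = conj_idx \<nu> (f i)" unfolding s by (rule fg[OF c])
    have "\<sigma> (\<sigma> i) = g (conj_idx \<nu> (f (\<sigma> i)))" using sD by (simp only: \<sigma>_def[of "\<sigma> i"] if_True)
    also have "\<dots> = i" unfolding fs conj_idx(2)[OF fD[OF i]] by (rule gf[OF i])
    finally show ?thesis using sD fs conj_idx(3)[OF fD[OF i]] by metis
  qed
  have "bij_betw \<sigma> ?D ?D" by (rule bij_betw_byWitness[of _ \<sigma>]) (use \<sigma> in auto)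
  then have "\<sigma> permutes ?D" by (rule bij_imp_permutes) (simp only: \<sigma>_def if_False)
  then have "\<sigma> \<in> matchings \<nu>" "compatible \<nu> \<sigma> f" using \<sigma> by (simp_all add: matchings_def compatible_def)
  moreover have "\<tau> = \<sigma>" if "\<tau> \<in> matchings \<nu>" "compatible \<nu> \<tau> f" for \<tau>
  proof
    fix i
    show "\<tau> i = \<sigma> i"
    proof (cases "i \<in> ?D")
      case False
      moreover have "\<tau> permutes ?D" using that(1) unfolding matchings_def by blast
      ultimately show ?thesis using \<open>\<sigma> permutes ?D\<close> permutes_not_in by metis
    next
      case True
      then have "\<tau> i \<in> ?D" using that(1) by (simp add: matchings_def permutes_in_image del: atLeastAtMost_iff)
      moreover have "f (\<tau> i) = f (\<sigma> i)" using that(2) \<sigma>[OF True] True by (simp add: compatible_def)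
      ultimately show ?thesis using \<sigma>[OF True] gf by metis
    qed
  qed
  ultimately have "{\<tau> \<in> matchings \<nu>. compatible \<nu> \<tau> f} = {\<sigma>}" by blast
  then show ?thesis by simp
qed

text \<open>Conjugation by the transposition of \<open>i\<close> and \<open>j\<close> is an
  involution on the compatible matchings. It has no fixed point: a matching of \<open>i\<close> with
  \<open>j\<close> would make \<open>f i\<close> conjugate to itself, and in any other fixed
  matching \<open>i\<close> and \<open>j\<close> would share a partner.\<close>

lemma even_card_compatible:
  assumes f: "f \<in> {1..2 * \<nu>} \<rightarrow> {..<2 * \<nu>}" and ij: "i \<in> {1..2 * \<nu>}" "j \<in> {1..2 * \<nu>}" "i \<noteq> j" "f i = f j"
  shows "even (card {\<tau> \<in> matchings \<nu>. compatible \<nu> \<tau> f})"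
proof (rule even_card_involution[where \<phi> = "\<lambda>\<tau>. transpose i j \<circ> \<tau> \<circ> transpose i j"])
  let ?D = "{1..2 * \<nu>}" and ?t = "transpose i j"
  have tD: "?t permutes ?D" by (rule permutes_swap_id[OF ij(1,2)])
  have ft: "f (?t k) = f k" for k using ij(4) by (simp add: transpose_def)
  show "finite {\<tau> \<in> matchings \<nu>. compatible \<nu> \<tau> f}" using finite_matchings by simp
  fix \<tau> assume "\<tau> \<in> {\<tau> \<in> matchings \<nu>. compatible \<nu> \<tau> f}"
  then have \<tau>: "\<tau> permutes ?D" "\<And>k. k \<in> ?D \<Longrightarrow> \<tau> (\<tau> k) = k \<and> \<tau> k \<noteq> k" "\<And>k. k \<in> ?D \<Longrightarrow> f (\<tau> k) = conj_idx \<nu> (f k)"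
    by (auto simp: matchings_def compatible_def)
  have tk: "?t k \<in> ?D" if "k \<in> ?D" for k using that permutes_in_image[OF tD] by blast
  have "?t \<circ> \<tau> \<circ> ?t permutes ?D" by (intro permutes_compose tD \<tau>)
  moreover have "(?t \<circ> \<tau> \<circ> ?t) ((?t \<circ> \<tau> \<circ> ?t) k) = k \<and> (?t \<circ> \<tau> \<circ> ?t) k \<noteq> k \<and>
      f ((?t \<circ> \<tau> \<circ> ?t) k) = conj_idx \<nu> (f k)" if "k \<in> ?D" for k
  proof -
    have "?t (\<tau> (?t k)) \<noteq> k" using \<tau>(2)[OF tk[OF that]] by (metis transpose_involutory)
    then show ?thesis using \<tau>(2,3)[OF tk[OF that]] ft by simp
  qed
  ultimately show "?t \<circ> \<tau> \<circ> ?t \<in> {\<tau> \<in> matchings \<nu>. compatible \<nu> \<tau> f}"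
    unfolding matchings_def compatible_def by blast
  show "?t \<circ> (?t \<circ> \<tau> \<circ> ?t) \<circ> ?t = \<tau>" by (simp add: fun_eq_iff)
  show "?t \<circ> \<tau> \<circ> ?t \<noteq> \<tau>"
  proof
    assume eq: "?t \<circ> \<tau> \<circ> ?t = \<tau>"
    have "f i < 2 * \<nu>" using f ij(1) by blast
    then have "\<tau> i \<noteq> j" using \<tau>(3)[OF ij(1)] ij(4) conj_idx(3) by metis
    moreover have "\<tau> i \<noteq> i" using \<tau>(2)[OF ij(1)] by simp
    ultimately have "(?t \<circ> \<tau> \<circ> ?t) j = \<tau> i" by (simp add: transpose_def)
    then have "\<tau> j = \<tau> i" using eq by simp
    then show False using permutes_inj[OF \<tau>(1)] ij(3) by (simp add: inj_eq)
  qed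
qed

lemma card_compatible_pairings:
  "card {s \<in> pairings \<nu>. compatible \<nu> (matching_of \<nu> s) f} = card {\<tau> \<in> matchings \<nu>. compatible \<nu> \<tau> f}"
proof (rule bij_betw_same_card[of "matching_of \<nu>"])
  show "bij_betw (matching_of \<nu>) {s \<in> pairings \<nu>. compatible \<nu> (matching_of \<nu> s) f}
      {\<tau> \<in> matchings \<nu>. compatible \<nu> \<tau> f}"
    using bij_betw_pairings[of \<nu>] unfolding bij_betw_def
    by (auto intro: inj_on_subset)
qed

lemma hafnian_summand:
  fixes x :: "nat \<Rightarrow> nat \<Rightarrow> 'a::comm_ring_1"
  assumes s: "s permutes {1..2 * \<nu>}"
  shows "(\<Prod>t=1..\<nu>. bf (2 * \<nu>) (x (s (2 * t - 1))) (x (s (2 * t)))) =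
    (\<Sum>f | f \<in> {1..2 * \<nu>} \<rightarrow>\<^sub>E {..<2 * \<nu>} \<and> compatible \<nu> (matching_of \<nu> s) f. \<Prod>i=1..2 * \<nu>. x i (f i))"
proof -
  let ?D = "{1..2 * \<nu>}" and ?T = "{1..\<nu>}" and ?N = "{..<2 * \<nu>}"
  let ?F = "{f. f \<in> ?D \<rightarrow>\<^sub>E ?N \<and> compatible \<nu> (matching_of \<nu> s) f}"
  let ?s' = "inv_into UNIV s"
  have inD: "s (2 * t) \<in> ?D" "s (2 * t - 1) \<in> ?D" if "t \<in> ?T" for t
    using that by (auto simp only: permutes_in_image[OF s], auto)
  have s's: "?s' (s k) = k" for k using permutes_inverses(2)[OF s] by simp
  \<comment> \<open>\<open>up\<close> extends a choice of coordinates for the first members of the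
    pairs by giving each second member the conjugate coordinate, and \<open>dn\<close> restricts
    back.\<close>
  define up where "up \<phi> = (\<lambda>i\<in>?D. if odd (?s' i) then \<phi> (Suc (?s' i) div 2) else conj_idx \<nu> (\<phi> (?s' i div 2)))" for \<phi>
  define dn where "dn f = (\<lambda>t\<in>?T. f (s (2 * t - 1)))" for f :: "nat \<Rightarrow> nat"
  have up1: "up \<phi> (s (2 * t - 1)) = \<phi> t" and up2: "up \<phi> (s (2 * t)) = conj_idx \<nu> (\<phi> t)" if "t \<in> ?T" for \<phi> t
  proof -
    have "odd (2 * t - 1)" "Suc (2 * t - 1) div 2 = t" using that by auto
    then show "up \<phi> (s (2 * t - 1)) = \<phi> t"
      unfolding up_def restrict_def s's using inD(2)[OF that] by (simp only: if_True not_False_eq_True)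
    show "up \<phi> (s (2 * t)) = conj_idx \<nu> (\<phi> t)"
      unfolding up_def restrict_def s's using inD(1)[OF that] by simp
  qed
  have compat: "f (s (2 * t)) = conj_idx \<nu> (f (s (2 * t - 1)))" if "f \<in> ?F" "t \<in> ?T" for f t
  proof -
    have "\<forall>i\<in>?D. f (matching_of \<nu> s i) = conj_idx \<nu> (f i)"
      using that(1) by (simp add: compatible_def)
    from bspec[OF this inD(2)[OF that(2)]] show ?thesis
      unfolding matching_of_simps(1)[OF s that(2)] .
  qed
  have "(\<Prod>t\<in>?T. bf (2 * \<nu>) (x (s (2 * t - 1))) (x (s (2 * t)))) =
      (\<Sum>\<phi>\<in>?T \<rightarrow>\<^sub>E ?N. \<Prod>t\<in>?T. x (s (2 * t - 1)) (\<phi> t) * x (s (2 * t)) (conj_idx \<nu> (\<phi> t)))"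
    unfolding bf_conj_idx by (rule prod_sum_PiE) auto
  also have "\<dots> = (\<Sum>f\<in>?F. \<Prod>i=1..2 * \<nu>. x i (f i))"
  proof (rule sum.reindex_bij_witness[of _ dn up])
    fix \<phi> assume \<phi>: "\<phi> \<in> ?T \<rightarrow>\<^sub>E ?N"
    then have \<phi>N: "\<phi> t \<in> ?N" if "t \<in> ?T" for t using that by blast
    show "dn (up \<phi>) = \<phi>"
    proof
      fix t show "dn (up \<phi>) t = \<phi> t"
        using up1[of t \<phi>] \<phi> by (cases "t \<in> ?T") (auto simp: dn_def PiE_def extensional_def simp del: atLeastAtMost_iff)
    qed
    have val: "up \<phi> i \<in> ?N" and co: "up \<phi> (matching_of \<nu> s i) = conj_idx \<nu> (up \<phi> i)" if "i \<in> ?D" for i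
    proof -
      have "up \<phi> i \<in> ?N \<and> up \<phi> (matching_of \<nu> s i) = conj_idx \<nu> (up \<phi> i)"
        using s that
      proof (rule permutes_pair_cases)
        fix t assume t: "t \<in> ?T" "i = s (2 * t - 1)"
        then show ?thesis
          using \<phi>N[OF t(1)] by (simp only: matching_of_simps[OF s t(1)] up1[OF t(1)] up2[OF t(1)] simp_thms)
      next
        fix t assume t: "t \<in> ?T" "i = s (2 * t)"
        have "\<phi> t < 2 * \<nu>" using \<phi>N[OF t(1)] by simp
        then show ?thesis
          unfolding t(2) matching_of_simps[OF s t(1)] up1[OF t(1)] up2[OF t(1)] by (simp add: conj_idx)
      qed
      then show "up \<phi> i \<in> ?N" "up \<phi> (matching_of \<nu> s i) = conj_idx \<nu> (up \<phi> i)" by blast+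
    qed
    have "up \<phi> \<in> ?D \<rightarrow>\<^sub>E ?N" using val unfolding up_def by (intro PiE_I) (auto simp del: atLeastAtMost_iff)
    then show "up \<phi> \<in> ?F" using co by (simp add: compatible_def)
    have "(\<Prod>i=1..2 * \<nu>. x i (up \<phi> i)) = (\<Prod>k=1..2 * \<nu>. x (s k) (up \<phi> (s k)))"
      by (rule prod.reindex_bij_betw[OF permutes_imp_bij[OF s], symmetric])
    also have "\<dots> = (\<Prod>t\<in>?T. x (s (2 * t - 1)) (up \<phi> (s (2 * t - 1))) * x (s (2 * t)) (up \<phi> (s (2 * t))))"
      by (rule prod_pairs)
    also have "\<dots> = (\<Prod>t\<in>?T. x (s (2 * t - 1)) (\<phi> t) * x (s (2 * t)) (conj_idx \<nu> (\<phi> t)))"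
      by (rule prod.cong) (simp_all only: up1 up2)
    finally show "(\<Prod>i=1..2 * \<nu>. x i (up \<phi> i)) =
      (\<Prod>t\<in>?T. x (s (2 * t - 1)) (\<phi> t) * x (s (2 * t)) (conj_idx \<nu> (\<phi> t)))" .
  next
    fix f assume f: "f \<in> ?F"
    show "dn f \<in> ?T \<rightarrow>\<^sub>E ?N" using f inD(2) unfolding dn_def by (intro PiE_I) (auto simp del: atLeastAtMost_iff)
    show "up (dn f) = f"
    proof
      fix i show "up (dn f) i = f i"
      proof (cases "i \<in> ?D")
        case False
        have "f \<in> ?D \<rightarrow>\<^sub>E ?N" using f by blast
        then have "f i = undefined" using False by (rule PiE_arb)
        then show ?thesis using False unfolding up_def restrict_def by (simp only: if_False)
      next
        case True
        with s show ?thesis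
        proof (rule permutes_pair_cases)
          fix t assume t: "t \<in> ?T" "i = s (2 * t - 1)"
          show ?thesis unfolding t(2) up1[OF t(1)] unfolding dn_def restrict_def using t(1) by (simp only: if_True)
        next
          fix t assume t: "t \<in> ?T" "i = s (2 * t)"
          show ?thesis unfolding t(2) up2[OF t(1)] compat[OF f t(1)]
            unfolding dn_def restrict_def using t(1) by (simp only: if_True)
        qed
      qed
    qed
  qed
  finally show ?thesis .
qed

lemma of_nat_even_eq_0: "(2::'a::comm_ring_1) = 0 \<Longrightarrow> even k \<Longrightarrow> of_nat k = (0::'a)"
  by (elim evenE) simp

text \<open>In characteristic 2 the Pfaffian of an alternating matrix is its hafnian, and
  \<open>Pf (V\<^sup>T J V) = det V\<close>.  After expanding the hafnian into monomials, a non-injective choice of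
  coordinates occurs for an even number of perfect matchings and an injective one for exactly one.\<close>

theorem hafnian_eq_det:
  fixes x :: "nat \<Rightarrow> nat \<Rightarrow> 'a::comm_ring_1"
  assumes two: "(2::'a) = 0"
  shows "hafnian \<nu> (\<lambda>i j. bf (2 * \<nu>) (x i) (x j)) = det (mat (2 * \<nu>) (2 * \<nu>) (\<lambda>(a, j). x (Suc j) a))"
proof -
  let ?D = "{1..2 * \<nu>}" and ?N = "{..<2 * \<nu>}"
  let ?F = "?D \<rightarrow>\<^sub>E ?N"
  let ?mon = "\<lambda>f. \<Prod>i=1..2 * \<nu>. x i (f i)"
  have finF: "finite ?F" by (intro finite_PiE) auto
  have "hafnian \<nu> (\<lambda>i j. bf (2 * \<nu>) (x i) (x j)) =
      (\<Sum>s\<in>pairings \<nu>. \<Sum>f | f \<in> ?F \<and> compatible \<nu> (matching_of \<nu> s) f. ?mon f)"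
    unfolding hafnian_def by (intro sum.cong refl hafnian_summand) (simp add: pairings_def)
  also have "\<dots> = (\<Sum>s\<in>pairings \<nu>. \<Sum>f\<in>?F. if compatible \<nu> (matching_of \<nu> s) f then ?mon f else 0)"
    by (rule sum.cong[OF refl], rule sum.inter_filter[OF finF])
  also have "\<dots> = (\<Sum>f\<in>?F. \<Sum>s\<in>pairings \<nu>. if compatible \<nu> (matching_of \<nu> s) f then ?mon f else 0)"
    by (rule sum.swap)
  also have "\<dots> = (\<Sum>f\<in>?F. of_nat (card {s \<in> pairings \<nu>. compatible \<nu> (matching_of \<nu> s) f}) * ?mon f)"
  proof (rule sum.cong[OF refl])
    fix f
    have "(\<Sum>s\<in>pairings \<nu>. if compatible \<nu> (matching_of \<nu> s) f then ?mon f else 0) =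
        (\<Sum>s\<in>{s \<in> pairings \<nu>. compatible \<nu> (matching_of \<nu> s) f}. ?mon f)"
      by (rule sum.inter_filter[OF finite_pairings, symmetric])
    also have "\<dots> = of_nat (card {s \<in> pairings \<nu>. compatible \<nu> (matching_of \<nu> s) f}) * ?mon f"
      by (rule sum_constant)
    finally show "(\<Sum>s\<in>pairings \<nu>. if compatible \<nu> (matching_of \<nu> s) f then ?mon f else 0) =
      of_nat (card {s \<in> pairings \<nu>. compatible \<nu> (matching_of \<nu> s) f}) * ?mon f" .
  qed
  also have "\<dots> = (\<Sum>f\<in>?F. if inj_on f ?D then ?mon f else 0)"
  proof (intro sum.cong refl)
    fix f assume f: "f \<in> ?F"
    show "of_nat (card {s \<in> pairings \<nu>. compatible \<nu> (matching_of \<nu> s) f}) * ?mon f = (if inj_on f ?D then ?mon f else 0)"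
    proof (cases "inj_on f ?D")
      case True
      have "f ` ?D \<subseteq> ?N" using f by blast
      moreover have "card (f ` ?D) = card ?N" using True by (simp add: card_image)
      ultimately have "f ` ?D = ?N" by (intro card_subset_eq) auto
      then have "bij_betw f ?D ?N" using True by (simp add: bij_betw_def)
      then show ?thesis using True unfolding card_compatible_pairings card_compatible_inj[OF \<open>bij_betw f ?D ?N\<close>] by simp
    next
      case False
      then obtain i j where "i \<in> ?D" "j \<in> ?D" "i \<noteq> j" "f i = f j" by (auto simp: inj_on_def simp del: atLeastAtMost_iff)
      then have "even (card {\<tau> \<in> matchings \<nu>. compatible \<nu> \<tau> f})"
        using f by (intro even_card_compatible[of f \<nu> i j]) (auto simp del: atLeastAtMost_iff)
      then show ?thesis using False unfolding card_compatible_pairings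
        by (simp only: of_nat_even_eq_0[OF two] mult_zero_left if_False)
    qed
  qed
  also have "\<dots> = (\<Sum>f | f \<in> ?F \<and> inj_on f ?D. ?mon f)"
    by (rule sum.inter_filter[OF finF, symmetric])
  also have "\<dots> = (\<Sum>p | p permutes {0..<2 * \<nu>}. \<Prod>j=0..<2 * \<nu>. x (Suc j) (p j))"
  proof (rule sum.reindex_bij_witness[of _ "\<lambda>p. \<lambda>i\<in>?D. p (i - 1)" "\<lambda>f j. if j < 2 * \<nu> then f (Suc j) else j"])
    fix f assume "f \<in> {f. f \<in> ?F \<and> inj_on f ?D}"
    then have f: "f \<in> ?F" "inj_on f ?D" by auto
    let ?p = "\<lambda>j. if j < 2 * \<nu> then f (Suc j) else j"
    show "(\<lambda>i\<in>?D. ?p (i - 1)) = f"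
      using f(1) by (auto simp: fun_eq_iff restrict_def PiE_def extensional_def)
    have "inj_on ?p {0..<2 * \<nu>}"
    proof (rule inj_onI)
      fix a b assume ab: "a \<in> {0..<2 * \<nu>}" "b \<in> {0..<2 * \<nu>}" "?p a = ?p b"
      then have "f (Suc a) = f (Suc b)" by simp
      then have "Suc a = Suc b" by (rule inj_onD[OF f(2)]) (use ab in auto)
      then show "a = b" by simp
    qed
    moreover have "?p ` {0..<2 * \<nu>} \<subseteq> {0..<2 * \<nu>}"
    proof
      fix b assume "b \<in> ?p ` {0..<2 * \<nu>}"
      then obtain a where "a < 2 * \<nu>" "b = f (Suc a)" by auto
      moreover have "f (Suc a) \<in> ?N" using \<open>a < 2 * \<nu>\<close> by (intro PiE_mem[OF f(1)]) simp
      ultimately show "b \<in> {0..<2 * \<nu>}" by simp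
    qed
    ultimately have bij: "bij_betw ?p {0..<2 * \<nu>} {0..<2 * \<nu>}"
      unfolding bij_betw_def using endo_inj_surj[of "{0..<2 * \<nu>}" ?p] by blast
    have "?p permutes {0..<2 * \<nu>}"
      by (rule bij_imp_permutes[OF bij]) simp
    then show "?p \<in> {p. p permutes {0..<2 * \<nu>}}" by blast
    have "?mon f = (\<Prod>j=0..<2 * \<nu>. x (Suc j) (f (Suc j)))"
      using prod.shift_bounds_Suc_ivl[of "\<lambda>i. x i (f i)" 0 "2 * \<nu>"] by (simp add: atLeastLessThanSuc_atLeastAtMost)
    then show "(\<Prod>j=0..<2 * \<nu>. x (Suc j) (?p j)) = ?mon f" by simp
  next
    fix p assume "p \<in> {p. p permutes {0..<2 * \<nu>}}"
    then have p: "p permutes {0..<2 * \<nu>}" by simp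
    let ?f = "\<lambda>i\<in>?D. p (i - 1)"
    show "(\<lambda>j. if j < 2 * \<nu> then ?f (Suc j) else j) = p"
      using permutes_not_in[OF p] by (auto simp: fun_eq_iff)
    have "?f \<in> ?F"
    proof (rule PiE_I)
      fix i assume i: "i \<in> ?D"
      then have "i - 1 \<in> {0..<2 * \<nu>}" by auto
      then have "p (i - 1) \<in> {0..<2 * \<nu>}" using permutes_in_image[OF p] by blast
      then show "?f i \<in> ?N" using i by simp
    qed (simp only: restrict_apply if_False)
    moreover have "inj_on ?f ?D"
    proof (rule inj_onI)
      fix i j assume ij: "i \<in> ?D" "j \<in> ?D" "?f i = ?f j"
      then have "p (i - 1) = p (j - 1)" by (simp only: restrict_apply if_True)
      then have "i - 1 = j - 1" by (rule injD[OF permutes_inj[OF p]])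
      then show "i = j" using ij by auto
    qed
    ultimately show "?f \<in> {f. f \<in> ?F \<and> inj_on f ?D}" by simp
  qed
  also have "\<dots> = det (mat (2 * \<nu>) (2 * \<nu>) (\<lambda>(j, a). x (Suc j) a))"
  proof -
    \<comment> \<open>In characteristic 2 the determinant is a permanent.\<close>
    have sgn: "of_int (sign p) = (1::'a)" for p :: "nat \<Rightarrow> nat"
      using minus_eq[OF two, of 1] by (simp add: sign_def)
    show ?thesis
      unfolding det_def dim_row_mat dim_col_mat if_True sgn mult_1
    proof (simp only: simp_thms if_True, intro sum.cong refl prod.cong)
      fix p j assume "p \<in> {p. p permutes {0..<2 * \<nu>}}" "j \<in> {0..<2 * \<nu>}"
      then have "j < 2 * \<nu>" "p j < 2 * \<nu>" using permutes_in_image[of p "{0..<2 * \<nu>}" j] by auto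
      then show "x (Suc j) (p j) = mat (2 * \<nu>) (2 * \<nu>) (\<lambda>(j, a). x (Suc j) a) $$ (j, p j)" by simp
    qed
  qed
  also have "\<dots> = det (transpose_mat (mat (2 * \<nu>) (2 * \<nu>) (\<lambda>(j, a). x (Suc j) a)))"
    by (rule det_transpose[symmetric, of _ "2 * \<nu>"]) simp
  also have "transpose_mat (mat (2 * \<nu>) (2 * \<nu>) (\<lambda>(j, a). x (Suc j) a)) = mat (2 * \<nu>) (2 * \<nu>) (\<lambda>(a, j). x (Suc j) a)"
    by (rule eq_matI) auto
  finally show ?thesis .
qed


section \<open>The generic tuple in normal form\<close>

lemma eval_quad_form:
  fixes h :: "'a::comm_ring_1 \<Rightarrow> 'b::comm_ring_1"
  assumes "comm_ring_hom h"
  shows "poly_eval h s (quad_form n (gvec n i)) = qf n (crow s i)"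
proof -
  have "quad_form n (gvec n i) = qf n (\<lambda>a. Var (i, a) :: (nat \<times> nat, 'a) mpoly)"
    unfolding quad_form_qf by (rule qf_cong) (simp add: gvec_def)
  then show ?thesis
    by (simp add: eval_qf[OF assms] comm_ring_hom.poly_eval_Var[OF assms] crow_def)
qed

lemma eval_polar_form:
  fixes h :: "'a::comm_ring_1 \<Rightarrow> 'b::comm_ring_1"
  assumes "comm_ring_hom h" "(2::'b) = 0"
  shows "poly_eval h s (polar_form n (gvec n i) (gvec n j)) = bf n (crow s i) (crow s j)"
proof -
  have "quad_form n (gvec n i + gvec n j) = qf n (\<lambda>a. Var (i, a) + (Var (j, a) :: (nat \<times> nat, 'a) mpoly))"
    unfolding quad_form_qf by (rule qf_cong) (simp add: gvec_def)
  then have "poly_eval h s (quad_form n (gvec n i + gvec n j)) = qf n (\<lambda>a. crow s i a + crow s j a)"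
    by (simp add: eval_qf[OF assms(1)] comm_ring_hom.poly_eval_hom[OF assms(1)]
        comm_ring_hom.poly_eval_Var[OF assms(1)] crow_def)
  then show ?thesis
    unfolding polar_form_def comm_ring_hom.poly_eval_diff[OF assms(1)] eval_quad_form[OF assms(1)]
    by (simp add: qf_add[OF assms(2)])
qed

lemma eval_det_poly:
  assumes "comm_ring_hom h" "length is = n"
  shows "poly_eval h s (det_poly n is) = det (mat n n (\<lambda>(a, j). s (is ! j, a)))"
proof -
  interpret E: comm_ring_hom "poly_eval h s" by (rule comm_ring_hom.comm_ring_hom_poly_eval[OF assms(1)])
  have "poly_eval h s (det_poly n is) = det (map_mat (poly_eval h s) (mat_of_cols n (map (gvec n) is)))"
    unfolding det_poly_def by (rule E.hom_det[symmetric])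
  also have "map_mat (poly_eval h s) (mat_of_cols n (map (gvec n) is)) = mat n n (\<lambda>(a, j). s (is ! j, a))"
    using assms(2) by (intro eq_matI)
      (auto simp: mat_of_cols_def gvec_def comm_ring_hom.poly_eval_Var[OF assms(1)])
  finally show ?thesis .
qed

lemma det_last_row:
  fixes f :: "nat \<times> nat \<Rightarrow> 'a::idom"
  assumes "\<And>j. j < k \<Longrightarrow> f (k, j) = 0"
  shows "det (mat (Suc k) (Suc k) f) = det (mat k k f) * f (k, k)"
proof -
  have "mat (Suc k) (Suc k) f = four_block_mat (mat k k f) (mat k 1 (\<lambda>(i, j). f (i, k))) (0\<^sub>m 1 k) (mat 1 1 (\<lambda>_. f (k, k)))"
    using assms by (intro eq_matI) (auto simp: less_Suc_eq)
  also have "det \<dots> = det (mat k k f) * det (mat 1 1 (\<lambda>_. f (k, k)))"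
    by (rule det_four_block_mat_lower_left_zero) auto
  finally show ?thesis by (simp add: det_single)
qed

lemma spec_bf:
  assumes "comm_ring_hom h" "\<And>a. spec h s (x a) (x' a)" "\<And>a. spec h s (y a) (y' a)"
  shows "spec h s (bf n x y) (bf n x' y')"
  unfolding bf_def by (intro spec_sum spec_add spec_mult assms)

lemma spec_qf:
  assumes "comm_ring_hom h" "\<And>a. spec h s (x a) (x' a)"
  shows "spec h s (qf n x) (qf n x')"
  unfolding qf_def by (auto intro!: spec_sum spec_add spec_mult spec_power spec_0 assms)

lemma spec_reflect:
  assumes h: "comm_ring_hom h" and x: "\<And>a. spec h s (x a) (x' a)" and c: "\<And>a. spec h s (c a) (c' a)"
    and "qf n c' \<noteq> 0"
  shows "spec h s (reflect n c x a) (reflect n c' x' a)"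
  unfolding reflect_def
  by (intro spec_diff spec_mult spec_divide spec_bf spec_qf assms)

lemma bf_sum: "bf n (\<lambda>a. \<Sum>i\<in>I. c i * f i a) z = (\<Sum>i\<in>I. c i * bf n (f i) z)"
  by (induction I rule: infinite_finite_induct)
     (simp_all add: bf_lin flip: bf_lin(3))

fun gpoly :: "nat \<Rightarrow> gen \<Rightarrow> (nat \<times> nat, 'k::field) mpoly" where
  "gpoly n (Qgen i) = quad_form n (gvec n i)"
| "gpoly n (Bgen i j) = polar_form n (gvec n i) (gvec n j)"
| "gpoly n (Dgen l) = det_poly n ([1..<n] @ [l])"

lemma gen_val_gpoly: "gen_val n g = to_fract (gpoly n g)"
  by (cases g) (simp_all add: inv_Q_def inv_B_def inv_D_def)

context orth_inv
begin

lemma two_r: "(2 :: 'k ratfun) = 0" by (rule two_ratfun[OF two])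

lemma bf_2nu: "bf (2 * \<nu>) = bf n"
  by (simp add: fun_eq_iff bf_def n_div)

definition gens :: "gen set" where
  "gens = gens_QB \<nu> m \<union> (if odd n then gens_D \<nu> m else {})"

lemma gens_nv: "Qgen i \<in> gens \<longleftrightarrow> i \<in> {1..nv}"
  "Bgen i j \<in> gens \<longleftrightarrow> 1 \<le> i \<and> i < j \<and> j \<le> m \<and> i \<le> 2 * \<nu>"
  "Dgen l \<in> gens \<longleftrightarrow> n = 2 * \<nu> + 1 \<and> 2 * \<nu> + 1 \<le> l \<and> l \<le> m"
  using n_cases by (auto simp: gens_def gens_QB_def gens_D_def nv_def)

text \<open>If the last coordinate vanishes in the first \<open>2 * \<nu>\<close> columns, the last
  row has at most one nonzero entry, and its cofactor is a determinant of even size, that is, the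
  hafnian of the polar form values. So \<open>D\<close> determines the last coordinate of vector
  \<open>l\<close> where this hafnian is nonzero.\<close>

lemma eval_Dgen:
  fixes h :: "'k \<Rightarrow> 'b::idom"
  assumes h: "comm_ring_hom h" and two: "(2::'b) = 0" and "n = 2 * \<nu> + 1"
    and "\<And>i. i \<in> {1..2 * \<nu>} \<Longrightarrow> s (i, 2 * \<nu>) = 0"
  shows "poly_eval h s (gpoly n (Dgen l)) = hafnian \<nu> (\<lambda>i j. bf n (crow s i) (crow s j)) * s (l, 2 * \<nu>)"
proof -
  let ?f = "\<lambda>(a, j). s (([1..<n] @ [l]) ! j, a)"
  have nth: "([1..<n] @ [l]) ! j = Suc j" if "j < 2 * \<nu>" for j
    using that assms(3) by (simp add: nth_append del: upt_Suc)
  have "poly_eval h s (gpoly n (Dgen l)) = det (mat (Suc (2 * \<nu>)) (Suc (2 * \<nu>)) ?f)"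
    unfolding gpoly.simps using assms(3) by (subst eval_det_poly[OF h]) simp_all
  also have "\<dots> = det (mat (2 * \<nu>) (2 * \<nu>) ?f) * ?f (2 * \<nu>, 2 * \<nu>)"
    by (rule det_last_row) (use assms(4) nth in auto)
  also have "?f (2 * \<nu>, 2 * \<nu>) = s (l, 2 * \<nu>)" using assms(3) by (simp add: nth_append del: upt_Suc)
  also have "mat (2 * \<nu>) (2 * \<nu>) ?f = mat (2 * \<nu>) (2 * \<nu>) (\<lambda>(a, j). crow s (Suc j) a)"
    by (intro eq_matI) (auto simp: nth[unfolded One_nat_def] crow_def simp del: upt_Suc)
  also have "det \<dots> = hafnian \<nu> (\<lambda>i j. bf n (crow s i) (crow s j))"
    using hafnian_eq_det[OF two, of \<nu> "crow s"] by (simp add: bf_2nu)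
  finally show ?thesis .
qed

text \<open>The generic normal tuple: coordinates prescribed by the normal form are 0 or 1, all
  others remain variables.\<close>

definition w :: "nat \<times> nat \<Rightarrow> 'k ratfun" where
  "w = (\<lambda>(i, a). if i \<in> {1..nv} \<and> a < n \<and> high (Suc (blk i)) a then 0
     else if i \<in> {1..nv} \<and> odd i \<and> a = blk i then 1 else to_fract (Var (i, a)))"

lemma blk_nv: "i \<in> {1..nv} \<Longrightarrow> blk i < \<nu>"
  by (auto simp: blk_def nv_def)

lemma not_high_blk: "i \<in> {1..nv} \<Longrightarrow> \<not> high (Suc (blk i)) (blk i)"
  using blk_nv[of i] by (simp add: high_simps)

definition wval :: "(nat \<times> nat \<Rightarrow> 'k) \<Rightarrow> nat \<times> nat \<Rightarrow> 'k" where
  "wval \<xi> = (\<lambda>(i, a). if i \<in> {1..nv} \<and> a < n \<and> high (Suc (blk i)) a then 0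
     else if i \<in> {1..nv} \<and> odd i \<and> a = blk i then 1 else \<xi> (i, a))"

lemma spec_wval: "spec (\<lambda>c. c) \<xi> (w x) (wval \<xi> x)"
  using spec_0[OF comm_ring_hom_id] spec_1[OF comm_ring_hom_id]
    spec_to_fract[OF comm_ring_hom_id, of \<xi> "Var x"]
  by (cases x) (auto simp: w_def wval_def eval_simps)

lemma wval_normal: "normal_upto nv \<xi> \<Longrightarrow> wval \<xi> = \<xi>"
proof
  fix x :: "nat \<times> nat" assume n: "normal_upto nv \<xi>"
  obtain i a where x: "x = (i, a)" by force
  show "wval \<xi> x = \<xi> x"
  proof (cases "i \<in> {1..nv}")
    case True
    then have "normal_row i (crow \<xi> i)" using n by (simp add: normal_upto_def)
    then show ?thesis using not_high_blk[OF True] nu_lt(1)[OF blk_nv[OF True]]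
      by (auto simp: x wval_def normal_row_def crow_def)
  qed (auto simp: x wval_def)
qed

lemma spec_eval_w: "spec (\<lambda>c. c) \<xi> (poly_eval const w P) (ev (wval \<xi>) P)"
  by (rule spec_poly_eval[OF comm_ring_hom_id]) (rule spec_wval)

text \<open>A polynomial that is zero at \<open>w\<close> is zero at every specialisation of
  \<open>w\<close>, and normal tuples are such specialisations.\<close>

lemma eval_w_nonzero:
  assumes "normal_upto nv \<xi>" "ev \<xi> P \<noteq> 0"
  shows "poly_eval const w P \<noteq> 0"
  using spec_eval_w[of \<xi> P] spec_unique[OF comm_ring_hom_id _ spec_0[OF comm_ring_hom_id]] assms
  by (metis wval_normal)

lemma reflprod_mat: "reflprod n b (g :: 'k mat) \<Longrightarrow> g \<in> carrier_mat n n" "reflprod n b (g :: 'k mat) \<Longrightarrow> invertible_mat g"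
  using reflprod_orthogonal[OF two] orthogonal_groupD by blast+

text \<open>Numerator and denominator can be moved by the group until the denominator survives the
  specialisation to the normal form.\<close>

lemma good_fraction:
  assumes "f \<in> ratfun_field n m" "\<forall>b g. reflprod n b g \<longrightarrow> ratfun_act g f = f"
  shows "\<exists>P R. f = to_fract P / to_fract R \<and> poly_eval const w R \<noteq> 0 \<and>
    vars P \<subseteq> {1..m} \<times> {..<n} \<and> vars R \<subseteq> {1..m} \<times> {..<n} \<and> R \<noteq> 0 \<and>
    (\<forall>b g. reflprod n b g \<longrightarrow> lin_subst g P * R = P * lin_subst g R)"
proof -
  obtain P R where PR: "f = to_fract P / to_fract R" "R \<noteq> 0"
    "vars P \<subseteq> {1..m} \<times> {..<n}" "vars R \<subseteq> {1..m} \<times> {..<n}"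
    using assms(1) unfolding ratfun_field_def by blast
  obtain b g \<xi> where g: "reflprod n b g" and \<xi>: "normal_upto nv \<xi>" "ev (act_pt n g \<xi>) R \<noteq> 0"
    using density[OF PR(2)] by blast
  note gm = reflprod_mat[OF g]
  have f: "f = to_fract (lin_subst g P) / to_fract (lin_subst g R)"
    using assms(2)[rule_format, OF g] unfolding PR(1) ratfun_act_fraction[OF gm PR(2)] by simp
  have "poly_eval const w (lin_subst g R) \<noteq> 0"
    using eval_w_nonzero[OF \<xi>(1)] \<xi>(2) by (simp add: eval_lin_subst[OF gm(1)])
  moreover have nz: "lin_subst g R \<noteq> 0" by (rule lin_subst_nonzero[OF gm PR(2)])
  moreover have "lin_subst g' (lin_subst g P) * lin_subst g R = lin_subst g P * lin_subst g' (lin_subst g R)"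
    if g': "reflprod n b' g'" for b' g'
    using assms(2)[rule_format, OF g'] ratfun_act_fixed_iff[OF reflprod_mat[OF g'] nz, of "lin_subst g P"] f by simp
  ultimately show ?thesis
    using f vars_lin_subst[OF PR(3) gm(1)] vars_lin_subst[OF PR(4) gm(1)] by blast
qed

text \<open>\<open>dv s\<close> and \<open>ve s\<close> are the components of the generic vectors \<open>2 s + 1\<close> and \<open>2 s + 2\<close> in the last
  plane that they meet.  Reflecting \<open>w\<close> in \<open>dv s\<close> does not change the Gram matrix and, among the first
  coordinates \<open>t\<^sub>r\<close> of the \<open>ve r\<close>, only changes \<open>t\<^sub>s\<close>.\<close>

definition dv :: "nat \<Rightarrow> nat \<Rightarrow> 'k ratfun" where
  "dv s = pair s 1 (w (2 * s + 1, \<nu> + s))"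

definition ve :: "nat \<Rightarrow> nat \<Rightarrow> 'k ratfun" where
  "ve s = pair s (w (2 * s + 2, s)) (w (2 * s + 2, \<nu> + s))"

definition w' :: "nat \<Rightarrow> nat \<times> nat \<Rightarrow> 'k ratfun" where
  "w' s = (\<lambda>(i, a). reflect n (dv s) (crow w i) a)"

lemma blk_simps [simp]: "blk (2 * s + 1) = s" "blk (2 * s + 2) = s" "blk (Suc (2 * s)) = s" "blk (Suc (Suc (2 * s))) = s"
  by (auto simp: blk_def)

lemma w_block:
  assumes "2 * s + 1 \<le> nv"
  shows "w (2 * s + 1, \<nu> + s) = to_fract (Var (2 * s + 1, \<nu> + s))" "w (2 * s + 1, s) = 1" "s < \<nu>"
proof -
  show s: "s < \<nu>" using assms by (simp add: nv_def)
  show "w (2 * s + 1, \<nu> + s) = to_fract (Var (2 * s + 1, \<nu> + s))" "w (2 * s + 1, s) = 1"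
    using assms s nu_lt[OF s] nu_pos by (auto simp: w_def high_simps)
qed

lemma w_block2:
  assumes "2 * s + 2 \<le> nv"
  shows "w (2 * s + 2, \<nu> + s) = to_fract (Var (2 * s + 2, \<nu> + s))" "w (2 * s + 2, s) = to_fract (Var (2 * s + 2, s))"
proof -
  have s: "s < \<nu>" using assms by (simp add: nv_def)
  show "w (2 * s + 2, \<nu> + s) = to_fract (Var (2 * s + 2, \<nu> + s))" "w (2 * s + 2, s) = to_fract (Var (2 * s + 2, s))"
    using s nu_lt[OF s] by (auto simp: w_def high_simps)
qed

lemma Var_nonzero: "Var x \<noteq> (0 :: (nat \<times> nat, 'k) mpoly)"
  using vars_Var[of x, where ?'a = 'k] by (metis insert_not_empty vars_0)

lemma qf_dv: "2 * s + 1 \<le> nv \<Longrightarrow> qf n (dv s) = w (2 * s + 1, \<nu> + s)" "2 * s + 1 \<le> nv \<Longrightarrow> qf n (dv s) \<noteq> 0"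
  using w_block[of s] Var_nonzero by (simp_all add: dv_def qf_pair)

text \<open>The invariance is given for reflections over \<open>k\<close>, whereas
  \<open>w' s\<close> arises from \<open>w\<close> by a reflection over the function field. A
  failure would persist at some point \<open>\<xi>\<close> over \<open>k\<close> at which the
  specialised vector \<open>d\<close> is nonsingular, and there the reflection is a matrix over
  \<open>k\<close>.\<close>

lemma invariance_at_w:
  assumes inv: "\<And>b g. reflprod n b g \<Longrightarrow> lin_subst g P * R = P * lin_subst g R" and s: "2 * s + 1 \<le> nv"
  shows "poly_eval const (w' s) P * poly_eval const w R = poly_eval const w P * poly_eval const (w' s) R"
proof (rule ccontr)
  assume neg: "\<not> ?thesis"
  let ?Y = "poly_eval const (w' s) P * poly_eval const w R - poly_eval const w P * poly_eval const (w' s) R"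
  have "?Y \<noteq> 0" using neg by simp
  then obtain \<xi> y where \<xi>: "spec (\<lambda>c. c) \<xi> ?Y y" "y \<noteq> 0" "ev \<xi> (Var (2 * s + 1, \<nu> + s)) \<noteq> 0"
    using spec_point_exists[OF inf _ Var_nonzero] by blast
  define d where "d = pair s 1 (\<xi> (2 * s + 1, \<nu> + s))"
  have sn: "s < \<nu>" by (rule w_block[OF s])
  have q: "qf n d \<noteq> 0" using \<xi>(3) sn by (simp add: d_def qf_pair eval_simps)
  have d: "spec (\<lambda>c. c) \<xi> (dv s a) (d a)" for a
    using spec_to_fract[OF comm_ring_hom_id, of \<xi> "Var (2 * s + 1, \<nu> + s)"]
    unfolding dv_def d_def w_block(1)[OF s] pair_def eval_simps
    by (auto intro: spec_0 spec_1 comm_ring_hom_id)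
  define v where "v = wval \<xi>"
  define v' where "v' = (\<lambda>(i, a). reflect n d (crow v i) a)"
  have w': "spec (\<lambda>c. c) \<xi> (w' s x) (v' x)" for x
    unfolding w'_def v'_def
    by (cases x, simp) (intro spec_reflect[OF comm_ring_hom_id _ d q], simp add: crow_def v_def spec_wval)
  have v': "v' = act_pt n (refl_mat n d) v"
  proof
    fix x :: "nat \<times> nat"
    obtain i a where x: "x = (i, a)" by force
    have "d a = 0" if "\<not> a < n" using that sn nu_lt[OF sn] by (auto simp: d_def pair_def)
    then show "v' x = act_pt n (refl_mat n d) v x"
      by (auto simp: x v'_def act_pt_def mv_refl_mat) (simp add: reflect_def crow_def)
  qed
  have "spec (\<lambda>c. c) \<xi> ?Y (ev v' P * ev v R - ev v P * ev v' R)"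
    by (intro spec_diff spec_mult spec_poly_eval comm_ring_hom_id w') (simp_all add: v_def spec_wval)
  moreover have "ev v (lin_subst (refl_mat n d) P * R) = ev v (P * lin_subst (refl_mat n d) R)"
    using inv[OF reflprod_refl[OF q]] by simp
  then have "ev v' P * ev v R - ev v P * ev v' R = 0"
    by (simp add: eval_simps(3) eval_lin_subst[OF refl_mat_carrier] v')
  ultimately have "y = 0" using \<xi>(1) spec_unique[OF comm_ring_hom_id] by metis
  then show False using \<xi>(2) by contradiction
qed

lemma w_zero: "i \<in> {1..nv} \<Longrightarrow> a < n \<Longrightarrow> high (Suc (blk i)) a \<Longrightarrow> w (i, a) = 0"
  by (simp add: w_def)

lemma w_one: "i \<in> {1..nv} \<Longrightarrow> odd i \<Longrightarrow> w (i, blk i) = 1"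
  using not_high_blk[of i] by (simp add: w_def)

lemma w_Var:
  assumes "\<not> (i \<in> {1..nv} \<and> a < n \<and> high (Suc (blk i)) a)" "\<not> (i \<in> {1..nv} \<and> odd i \<and> a = blk i)"
  shows "w (i, a) = to_fract (Var (i, a))"
  unfolding w_def prod.case using assms by (simp only: if_False)

lemma dv_apply: "dv s a = (if a = s then 1 else if a = \<nu> + s then w (2 * s + 1, \<nu> + s) else 0)"
  by (simp add: dv_def pair_def)

lemma bf_dv: "s < \<nu> \<Longrightarrow> bf n x (dv s) = x (\<nu> + s) + w (2 * s + 1, \<nu> + s) * x s"
  by (simp add: bf_sym[of n x] dv_def bf_pair)

lemma dv_low: "s < \<nu> \<Longrightarrow> \<not> high s a \<Longrightarrow> dv s a = 0"
  by (auto simp: dv_apply high_simps)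

lemma w'_eq: "w' s (i, a) = w (i, a) - bf n (crow w i) (dv s) / qf n (dv s) * dv s a"
  by (simp add: w'_def reflect_def crow_def)

lemma bf_earlier:
  assumes "s < \<nu>" "i \<in> {1..nv}" "blk i < s"
  shows "bf n (crow w i) (dv s) = 0"
  by (rule bf_high_low[of s]) (use assms in \<open>auto simp: crow_def dv_low intro!: w_zero simp: high_def\<close>)

lemma bf_own_odd:
  assumes "2 * s + 1 \<le> nv"
  shows "bf n (crow w (2 * s + 1)) (dv s) = 0"
  unfolding bf_dv[OF w_block(3)[OF assms]] crow_def w_block(2)[OF assms] by (simp add: add_self[OF two_r])

lemma crow_w'_fixed: "bf n (crow w i) (dv s) = 0 \<Longrightarrow> w' s (i, a) = w (i, a)"
  by (simp add: w'_eq)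

text \<open>Keeps the prescribed coordinates, so that \<open>w' s\<close> is again a specialisation
  of \<open>w\<close>. The earlier rows and row \<open>2 s + 1\<close> are orthogonal to
  \<open>dv s\<close>; in the other rows the prescribed coordinates lie outside plane
  \<open>s\<close>.\<close>

lemma w'_special:
  assumes s: "2 * s + 1 \<le> nv" and i: "i \<in> {1..nv}"
    and "(a < n \<and> high (Suc (blk i)) a) \<or> (odd i \<and> a = blk i)"
  shows "w' s (i, a) = w (i, a)"
proof (cases "blk i < s \<or> i = 2 * s + 1")
  case True
  then have "bf n (crow w i) (dv s) = 0"
    using bf_earlier[OF w_block(3)[OF s] i] bf_own_odd[OF s] by blast
  then show ?thesis by (rule crow_w'_fixed)
next
  case False
  have sn: "s < \<nu>" by (rule w_block[OF s])
  have "i = 2 * blk i + 1" if "odd i" using i that by (auto simp: blk_def elim!: oddE)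
  then have "blk i \<noteq> s \<or> even i" using False by metis
  then have "a \<noteq> s" "a \<noteq> \<nu> + s" using assms(3) False sn blk_nv[OF i] by (auto simp: high_simps)
  then show ?thesis by (simp add: w'_eq dv_apply)
qed

text \<open>Substituting \<open>w' s\<close> for the variables is a partial endomorphism of the
  function field; it acts on \<open>w\<close> as the reflection in \<open>dv s\<close>.\<close>

lemma spec_w_w':
  assumes "2 * s + 1 \<le> nv"
  shows "spec const (w' s) (w x) (w' s x)"
proof -
  obtain i a where x: "x = (i, a)" by force
  show ?thesis
  proof (cases "i \<in> {1..nv} \<and> ((a < n \<and> high (Suc (blk i)) a) \<or> (odd i \<and> a = blk i))")
    case True
    then have e: "w' s x = w x" unfolding x by (intro w'_special[OF assms]) auto
    have "w x = 0 \<or> w x = 1" using True w_zero w_one unfolding x by blast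
    then show ?thesis unfolding e
      by (auto intro: spec_0[OF comm_ring_hom_const] spec_1[OF comm_ring_hom_const])
  next
    case False
    then have "w x = to_fract (Var x)" unfolding x by (intro w_Var) auto
    then show ?thesis using spec_to_fract[OF comm_ring_hom_const, of "w' s" "Var x"]
      by (simp add: const_eval_simps)
  qed
qed

lemma spec_dv:
  assumes "2 * s + 1 \<le> nv"
  shows "spec const (w' s) (dv s a) (dv s a)"
proof -
  have "w' s (2 * s + 1, \<nu> + s) = w (2 * s + 1, \<nu> + s)"
    by (rule crow_w'_fixed[OF bf_own_odd[OF assms]])
  then have "spec const (w' s) (w (2 * s + 1, \<nu> + s)) (w (2 * s + 1, \<nu> + s))"
    using spec_w_w'[OF assms, of "(2 * s + 1, \<nu> + s)"] by simp
  then show ?thesis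
    by (auto simp: dv_apply intro: spec_0[OF comm_ring_hom_const] spec_1[OF comm_ring_hom_const])
qed

text \<open>The substitution fixes \<open>dv s\<close>, so it takes the reflection of
  \<open>w\<close> to the same reflection of \<open>w' s\<close>, which is \<open>w\<close>
  again.\<close>

lemma spec_w'_w:
  assumes "2 * s + 1 \<le> nv"
  shows "spec const (w' s) (w' s x) (w x)"
proof -
  obtain i a where x: "x = (i, a)" by force
  have "spec const (w' s) (reflect n (dv s) (crow w i) a) (reflect n (dv s) (crow (w' s) i) a)"
    by (rule spec_reflect[OF comm_ring_hom_const _ spec_dv[OF assms] qf_dv(2)[OF assms]])
      (simp add: crow_def spec_w_w'[OF assms])
  moreover have "crow (w' s) i = reflect n (dv s) (crow w i)"
    by (simp add: crow_def w'_def fun_eq_iff)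
  ultimately show ?thesis
    using reflect_reflect[OF two_r qf_dv(2)[OF assms], of "crow w i"]
    by (simp add: x w'_def crow_def)
qed

lemma qf_w': "2 * s + 1 \<le> nv \<Longrightarrow> qf n (crow (w' s) i) = qf n (crow w i)"
  and bf_w': "2 * s + 1 \<le> nv \<Longrightarrow> bf n (crow (w' s) i) (crow (w' s) j) = bf n (crow w i) (crow w j)"
proof -
  assume s: "2 * s + 1 \<le> nv"
  have "crow (w' s) i = reflect n (dv s) (crow w i)" for i
    by (simp add: crow_def w'_def fun_eq_iff)
  then show "qf n (crow (w' s) i) = qf n (crow w i)"
    "bf n (crow (w' s) i) (crow (w' s) j) = bf n (crow w i) (crow w j)"
    using qf_reflect[OF two_r qf_dv(2)[OF s]] bf_reflect[OF two_r qf_dv(2)[OF s]] by simp_all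
qed

lemma nv_full: "2 * \<nu> + 1 \<le> l \<Longrightarrow> l \<le> m \<Longrightarrow> nv = 2 * \<nu>"
  by (simp add: nv_def)

lemma w_last: "i \<in> {1..nv} \<Longrightarrow> n = 2 * \<nu> + 1 \<Longrightarrow> w (i, 2 * \<nu>) = 0"
  by (rule w_zero) (auto simp: high_def)

lemma w'_last: "s < \<nu> \<Longrightarrow> w' s (i, 2 * \<nu>) = w (i, 2 * \<nu>)"
  by (simp add: w'_eq dv_apply)

text \<open>For \<open>D\<close> the hafnian formula applies to both tuples, as the reflection does
  not touch the last coordinate.\<close>

lemma eval_gens_w':
  assumes s: "2 * s + 1 \<le> nv" and "g \<in> gens"
  shows "poly_eval const (w' s) (gpoly n g) = poly_eval const w (gpoly n g)"
proof (cases g)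
  case (Qgen i)
  then show ?thesis by (simp add: eval_quad_form[OF comm_ring_hom_const] qf_w'[OF s])
next
  case (Bgen i j)
  then show ?thesis by (simp add: eval_polar_form[OF comm_ring_hom_const two_r] bf_w'[OF s])
next
  case (Dgen l)
  then have l: "n = 2 * \<nu> + 1" "nv = 2 * \<nu>" using assms(2) by (auto simp: gens_nv nv_full)
  have "w (i, 2 * \<nu>) = 0" "w' s (i, 2 * \<nu>) = 0" if "i \<in> {1..2 * \<nu>}" for i
    using w_last[of i] w'_last[OF w_block(3)[OF s], of i] l that by auto
  then show ?thesis unfolding Dgen
    by (subst (1 2) eval_Dgen[OF comm_ring_hom_const two_r l(1)])
      (auto simp: bf_w'[OF s] w'_last[OF w_block(3)[OF s]])
qed

section \<open>The field of values of the generators at the normal form\<close>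

definition E :: "'k ratfun set" where
  "E = generate_field class_ring (range const \<union> (\<lambda>g. poly_eval const w (gpoly n g)) ` gens)"

lemma fsub_E: "fsub E"
  unfolding E_def by (rule fsub_generate_field)

lemma const_E: "const c \<in> E" and gens_E: "g \<in> gens \<Longrightarrow> poly_eval const w (gpoly n g) \<in> E"
  unfolding E_def by (auto intro!: generate_field.incl)

lemma qf_w_E: "i \<in> {1..nv} \<Longrightarrow> qf n (crow w i) \<in> E"
  using gens_E[of "Qgen i"] by (simp add: gens_nv eval_quad_form[OF comm_ring_hom_const])

lemma bf_w_E: "i \<in> {1..nv} \<Longrightarrow> j \<in> {1..m} \<Longrightarrow> bf n (crow w i) (crow w j) \<in> E"
proof -
  assume ij: "i \<in> {1..nv}" "j \<in> {1..m}"
  consider "i = j" | "i < j" | "j < i" by linarith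
  then show ?thesis
  proof cases
    case 1
    then show ?thesis using fsub_0[OF fsub_E] by (simp add: bf_self[OF two_r])
  next
    case 2
    then show ?thesis using gens_E[of "Bgen i j"] ij
      by (simp add: gens_nv eval_polar_form[OF comm_ring_hom_const two_r] nv_def)
  next
    case 3
    then show ?thesis using gens_E[of "Bgen j i"] ij
      by (simp add: gens_nv eval_polar_form[OF comm_ring_hom_const two_r] nv_def bf_sym[of n "crow w i"])
  qed
qed

text \<open>A vector found in this \<open>E\<close>-span of the rows of \<open>w\<close> has its
  values of both forms in \<open>E\<close>, even if its coordinates are not.\<close>

definition span_w :: "(nat \<Rightarrow> 'k ratfun) set" where
  "span_w = {x. \<exists>c. (\<forall>i. c i \<in> E) \<and> (\<forall>a<n. x a = (\<Sum>i\<in>{1..nv}. c i * crow w i a))}"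

lemma span_w_cong: "x \<in> span_w \<Longrightarrow> (\<And>a. a < n \<Longrightarrow> y a = x a) \<Longrightarrow> y \<in> span_w"
  unfolding span_w_def by auto

lemma span_w_row: "i \<in> {1..nv} \<Longrightarrow> crow w i \<in> span_w"
  unfolding span_w_def
  by (intro CollectI exI[of _ "\<lambda>j. if j = i then 1 else 0"])
     (auto simp: fsub_1[OF fsub_E] fsub_0[OF fsub_E] if_distrib[of "\<lambda>z. z * _"] cong: if_cong)

lemma span_w_add:
  assumes "x \<in> span_w" "y \<in> span_w" "e \<in> E"
  shows "(\<lambda>a. x a + e * y a) \<in> span_w"
proof -
  obtain c where c: "\<forall>i. c i \<in> E" "\<forall>a<n. x a = (\<Sum>i\<in>{1..nv}. c i * crow w i a)"
    using assms(1) unfolding span_w_def by blast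
  obtain d where d: "\<forall>i. d i \<in> E" "\<forall>a<n. y a = (\<Sum>i\<in>{1..nv}. d i * crow w i a)"
    using assms(2) unfolding span_w_def by blast
  have "\<forall>i. c i + e * d i \<in> E"
    using c(1) d(1) assms(3) by (auto intro!: fsub_add[OF fsub_E] fsub_mult[OF fsub_E])
  moreover have "x a + e * y a = (\<Sum>i\<in>{1..nv}. (c i + e * d i) * crow w i a)" if "a < n" for a
    using that c(2) d(2) by (simp add: sum.distrib sum_distrib_left distrib_right mult.assoc)
  ultimately show ?thesis unfolding span_w_def
    by (intro CollectI exI[of _ "\<lambda>i. c i + e * d i"]) simp
qed

lemma span_w_sum:
  assumes "\<And>r. r \<in> I \<Longrightarrow> f r \<in> span_w" "\<And>r. r \<in> I \<Longrightarrow> c r \<in> E" "x \<in> span_w"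
  shows "(\<lambda>a. x a + (\<Sum>r\<in>I. c r * f r a)) \<in> span_w"
  using assms
proof (induction I rule: infinite_finite_induct)
  case (insert r I)
  then have "(\<lambda>a. (x a + (\<Sum>r\<in>I. c r * f r a)) + c r * f r a) \<in> span_w"
    by (intro span_w_add) auto
  then show ?case using insert.hyps by (simp add: add_ac)
qed auto

lemma span_wE:
  assumes "x \<in> span_w"
  shows "\<exists>c. (\<forall>i. c i \<in> E) \<and> (\<forall>z. bf n x z = bf n (\<lambda>a. \<Sum>i\<in>{1..nv}. c i * crow w i a) z) \<and>
    qf n x = qf n (\<lambda>a. \<Sum>i\<in>{1..nv}. c i * crow w i a)"
proof -
  obtain c where c: "\<forall>i. c i \<in> E" "\<forall>a<n. x a = (\<Sum>i\<in>{1..nv}. c i * crow w i a)"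
    using assms unfolding span_w_def by blast
  have "bf n x z = bf n (\<lambda>a. \<Sum>i\<in>{1..nv}. c i * crow w i a) z" for z
    by (rule bf_cong) (use c(2) in auto)
  moreover have "qf n x = qf n (\<lambda>a. \<Sum>i\<in>{1..nv}. c i * crow w i a)"
    by (rule qf_cong) (use c(2) in auto)
  ultimately show ?thesis using c(1) by blast
qed

lemma bf_span_w: "x \<in> span_w \<Longrightarrow> j \<in> {1..m} \<Longrightarrow> bf n x (crow w j) \<in> E"
proof -
  assume x: "x \<in> span_w" and j: "j \<in> {1..m}"
  obtain c where c: "\<forall>i. c i \<in> E" "\<forall>z. bf n x z = bf n (\<lambda>a. \<Sum>i\<in>{1..nv}. c i * crow w i a) z"
    "qf n x = qf n (\<lambda>a. \<Sum>i\<in>{1..nv}. c i * crow w i a)"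
    using span_wE[OF x] by (elim exE conjE)
  show ?thesis unfolding c(2)[rule_format] bf_sum
    by (intro fsub_sum[OF fsub_E] fsub_mult[OF fsub_E] bf_w_E c(1)[rule_format] j)
qed

lemma bf_span_w_span_w: "x \<in> span_w \<Longrightarrow> y \<in> span_w \<Longrightarrow> bf n x y \<in> E"
proof -
  assume x: "x \<in> span_w" and y: "y \<in> span_w"
  have "bf n (crow w i) y \<in> E" if "i \<in> {1..nv}" for i
    using bf_span_w[OF y, of i] that by (simp add: bf_sym[of n y] nv_def)
  note row = this
  obtain c where c: "\<forall>i. c i \<in> E" "\<forall>z. bf n x z = bf n (\<lambda>a. \<Sum>i\<in>{1..nv}. c i * crow w i a) z"
    "qf n x = qf n (\<lambda>a. \<Sum>i\<in>{1..nv}. c i * crow w i a)"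
    using span_wE[OF x] by (elim exE conjE)
  show ?thesis unfolding c(2)[rule_format] bf_sum
    by (intro fsub_sum[OF fsub_E] fsub_mult[OF fsub_E] row c(1)[rule_format])
qed

lemma qf_span_w: "x \<in> span_w \<Longrightarrow> qf n x \<in> E"
proof -
  assume x: "x \<in> span_w"
  obtain c where c: "\<forall>i. c i \<in> E" "\<forall>z. bf n x z = bf n (\<lambda>a. \<Sum>i\<in>{1..nv}. c i * crow w i a) z"
    "qf n x = qf n (\<lambda>a. \<Sum>i\<in>{1..nv}. c i * crow w i a)"
    using span_wE[OF x] by (elim exE conjE)
  have "qf n (\<lambda>a. \<Sum>i\<in>I. c i * crow w i a) \<in> E" if "I \<subseteq> {1..nv}" "finite I" for I
    using that(2,1)
  proof (induction I rule: finite_induct)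
    case empty
    then show ?case using fsub_0[OF fsub_E] by simp
  next
    case (insert i I)
    have eq: "(\<lambda>a. \<Sum>i\<in>insert i I. c i * crow w i a) = (\<lambda>a. (\<Sum>i\<in>I. c i * crow w i a) + c i * crow w i a)"
      using insert.hyps by (simp add: add.commute)
    have "bf n (\<lambda>a. \<Sum>i\<in>I. c i * crow w i a) (crow w i) \<in> E"
      unfolding bf_sum using insert.prems c(1)
      by (intro fsub_sum[OF fsub_E] fsub_mult[OF fsub_E] bf_w_E) (auto simp: nv_def)
    moreover have "qf n (\<lambda>a. \<Sum>i\<in>I. c i * crow w i a) \<in> E" "qf n (crow w i) \<in> E"
      using insert qf_w_E[of i] by auto
    ultimately show ?case unfolding eq qf_lin[OF two_r]
      by (intro fsub_add[OF fsub_E] fsub_mult[OF fsub_E] fsub_power[OF fsub_E] c(1)[rule_format])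
  qed
  then show ?thesis unfolding c(3) by simp
qed

definition \<beta> :: "nat \<Rightarrow> 'k ratfun" where "\<beta> s = bf n (dv s) (ve s)"

lemma ve_apply: "ve s a = (if a = s then w (2 * s + 2, s) else if a = \<nu> + s then w (2 * s + 2, \<nu> + s) else 0)"
  by (simp add: ve_def pair_def)

lemma \<beta>_eq:
  assumes "2 * s + 2 \<le> nv"
  shows "\<beta> s = w (2 * s + 2, \<nu> + s) + w (2 * s + 1, \<nu> + s) * w (2 * s + 2, s)"
proof -
  have "s < \<nu>" using assms by (simp add: nv_def)
  then show ?thesis
    unfolding \<beta>_def dv_def by (subst bf_pair) (simp_all add: ve_apply)
qed

lemma \<beta>_nonzero:
  assumes s: "2 * s + 2 \<le> nv"
  shows "\<beta> s \<noteq> 0"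
proof -
  let ?p = "Var (2 * s + 2, \<nu> + s) + Var (2 * s + 1, \<nu> + s) * Var (2 * s + 2, s) :: (nat \<times> nat, 'k) mpoly"
  have s1: "2 * s + 1 \<le> nv" using s by simp
  have "\<beta> s = to_fract ?p"
    unfolding \<beta>_eq[OF s] w_block2[OF s] w_block(1)[OF s1] by (simp only: to_fract_add to_fract_mult)
  moreover have "ev (\<lambda>x. if x = (2 * s + 2, \<nu> + s) then 1 else 0) ?p = 1"
    by (simp add: eval_simps)
  then have "?p \<noteq> 0" by (metis eval_simps(10) zero_neq_one)
  ultimately show ?thesis by (simp only: to_fract_eq_0_iff not_False_eq_True)
qed

text \<open>\<open>dv s\<close> and \<open>ve s\<close> form a basis of plane \<open>s\<close>.
  Since the polar form is alternating, the dual basis is \<open>ve s / \<beta> s\<close>,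
  \<open>dv s / \<beta> s\<close>.\<close>

lemma block_decomposition:
  assumes s: "2 * s + 2 \<le> nv" and a: "a = s \<or> a = \<nu> + s"
  shows "x a = bf n x (ve s) / \<beta> s * dv s a + bf n x (dv s) / \<beta> s * ve s a"
proof -
  have sn: "s < \<nu>" using s by (simp add: nv_def)
  define A where "A = w (2 * s + 1, \<nu> + s)"
  define T where "T = w (2 * s + 2, s)"
  define Y where "Y = w (2 * s + 2, \<nu> + s)"
  have B: "\<beta> s = Y + A * T" by (simp add: \<beta>_eq[OF s] A_def T_def Y_def)
  have bd: "bf n x (dv s) = x (\<nu> + s) + A * x s" by (simp add: bf_dv[OF sn] A_def)
  have be: "bf n x (ve s) = T * x (\<nu> + s) + Y * x s"
    by (simp add: bf_sym[of n x] ve_def bf_pair[OF sn] T_def Y_def)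
  have d: "dv s s = 1" "dv s (\<nu> + s) = A" "ve s s = T" "ve s (\<nu> + s) = Y"
    using nu_pos by (auto simp: dv_apply ve_apply A_def T_def Y_def)
  have "bf n x (ve s) * dv s a + bf n x (dv s) * ve s a = \<beta> s * x a"
  proof (cases "a = s")
    case True
    have "bf n x (ve s) * dv s a + bf n x (dv s) * ve s a = \<beta> s * x s + 2 * (T * x (\<nu> + s))"
      unfolding True d bd be B by (simp add: algebra_simps)
    then show ?thesis using True two_r by simp
  next
    case False
    then have a: "a = \<nu> + s" using a by simp
    have "bf n x (ve s) * dv s a + bf n x (dv s) * ve s a = \<beta> s * x (\<nu> + s) + 2 * (A * Y * x s)"
      unfolding a d bd be B by (simp add: algebra_simps)
    then show ?thesis using a two_r by simp
  qed
  then have "(bf n x (ve s) * dv s a + bf n x (dv s) * ve s a) / \<beta> s = x a"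
    using \<beta>_nonzero[OF s] by simp
  then show ?thesis by (simp add: add_divide_distrib)
qed

text \<open>A Gram-Schmidt step: removing from row \<open>i\<close> its components in the earlier
  planes, with coefficients that are quotients of polar form values in \<open>E\<close>, leaves the
  component in its own plane, beyond which the row is zero.\<close>

lemma own_block_span_w:
  assumes i: "i \<in> {1..nv}"
    and IH: "\<And>r. r < blk i \<Longrightarrow> dv r \<in> span_w \<and> ve r \<in> span_w"
  shows "pair (blk i) (w (i, blk i)) (w (i, \<nu> + blk i)) \<in> span_w"
proof -
  let ?s = "blk i" and ?x = "crow w i"
  have sn: "?s < \<nu>" by (rule blk_nv[OF i])
  have le: "2 * r + 2 \<le> nv" if "r < ?s" for r using that i by (auto simp: blk_def)
  define c where "c r = bf n ?x (ve r) / \<beta> r" for r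
  define c' where "c' r = bf n ?x (dv r) / \<beta> r" for r
  have cE: "c r \<in> E" "c' r \<in> E" if "r \<in> {..<?s}" for r
    using IH[of r] that i bf_span_w[of "ve r" i] bf_span_w[of "dv r" i] bf_span_w_span_w[of "dv r" "ve r"]
    unfolding c_def c'_def \<beta>_def bf_sym[of n ?x] by (auto intro!: fsub_divide[OF fsub_E] simp: nv_def)
  \<comment> \<open>The components are added instead of subtracted, the characteristic being
    2.\<close>
  let ?y = "\<lambda>a. (?x a + (\<Sum>r<?s. c r * dv r a)) + (\<Sum>r<?s. c' r * ve r a)"
  have "?y \<in> span_w"
    by (intro span_w_sum[of _ ve] span_w_sum[of _ dv] span_w_row i cE) (use IH in auto)
  then show ?thesis
  proof (rule span_w_cong)
    fix a assume a: "a < n"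
    have y: "?y a = ?x a + (\<Sum>r<?s. c r * dv r a + c' r * ve r a)"
      by (simp add: sum.distrib add.assoc)
    have zero: "dv r a = 0" "ve r a = 0" if "a \<noteq> r" "a \<noteq> \<nu> + r" for r
      using that by (simp_all add: dv_apply ve_apply)
    show "pair ?s (w (i, ?s)) (w (i, \<nu> + ?s)) a = ?y a"
    proof (cases "\<exists>t<?s. a = t \<or> a = \<nu> + t")
      case True
      then obtain t where t: "t < ?s" "a = t \<or> a = \<nu> + t" by blast
      have "(\<Sum>r<?s. c r * dv r a + c' r * ve r a) = c t * dv t a + c' t * ve t a"
      proof (subst sum.remove[of _ t])
        have "(\<Sum>r\<in>{..<?s} - {t}. c r * dv r a + c' r * ve r a) = 0"
        proof (intro sum.neutral ballI)
          fix r assume "r \<in> {..<?s} - {t}"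
          then have "a \<noteq> r" "a \<noteq> \<nu> + r" using t sn by auto
          then show "c r * dv r a + c' r * ve r a = 0" by (simp add: zero)
        qed
        then show "c t * dv t a + c' t * ve t a + (\<Sum>r\<in>{..<?s} - {t}. c r * dv r a + c' r * ve r a) =
          c t * dv t a + c' t * ve t a" by simp
      qed (use t in auto)
      also have "\<dots> = ?x a"
        unfolding c_def c'_def by (rule block_decomposition[OF le[OF t(1)] t(2), symmetric])
      finally have "?y a = 0" unfolding y by (simp add: add_self[OF two_r])
      moreover have "pair ?s (w (i, ?s)) (w (i, \<nu> + ?s)) a = 0" using t sn by (auto simp: pair_def)
      ultimately show ?thesis by simp
    next
      case False
      have "(\<Sum>r<?s. c r * dv r a + c' r * ve r a) = 0"
      proof (intro sum.neutral ballI)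
        fix r assume "r \<in> {..<?s}"
        then have "a \<noteq> r" "a \<noteq> \<nu> + r" using False by auto
        then show "c r * dv r a + c' r * ve r a = 0" by (simp add: zero)
      qed
      then have "?y a = w (i, a)" unfolding y by (simp add: crow_def)
      moreover have "pair ?s (w (i, ?s)) (w (i, \<nu> + ?s)) a = w (i, a)"
      proof (cases "a = ?s \<or> a = \<nu> + ?s")
        case True
        then show ?thesis using nu_pos by (auto simp: pair_def)
      next
        case nF: False
        have "high (Suc ?s) a"
          using a by (rule idx_cases) (use False nF in \<open>auto simp: high_simps Suc_le_eq not_less intro: le_neq_trans\<close>)
        then show ?thesis using nF w_zero[OF i a] by (simp add: pair_def)
      qed
      ultimately show ?thesis by simp
    qed
  qed
qed

lemma dv_ve_span_w: "(2 * s + 1 \<le> nv \<longrightarrow> dv s \<in> span_w) \<and> (2 * s + 2 \<le> nv \<longrightarrow> ve s \<in> span_w)"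
proof (induction s rule: less_induct)
  case (less s)
  show ?case
  proof (intro conjI impI)
    assume s: "2 * s + 1 \<le> nv"
    have "pair (blk (2 * s + 1)) (w (2 * s + 1, blk (2 * s + 1))) (w (2 * s + 1, \<nu> + blk (2 * s + 1))) \<in> span_w"
      by (rule own_block_span_w) (use s less in auto)
    then show "dv s \<in> span_w" using w_block(2)[OF s] by (simp add: dv_def)
  next
    assume s: "2 * s + 2 \<le> nv"
    have "pair (blk (2 * s + 2)) (w (2 * s + 2, blk (2 * s + 2))) (w (2 * s + 2, \<nu> + blk (2 * s + 2))) \<in> span_w"
      by (rule own_block_span_w) (use s less in auto)
    then show "ve s \<in> span_w" by (simp add: ve_def)
  qed
qed

end


section \<open>Invariants of the reflections\<close>

text \<open>Inverses come from the conjugate \<open>z' = x + y (p - t)\<close>, formed with the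
  other root, and the norm \<open>N = z z'\<close>.\<close>

lemma fsub_quadratic_extension:
  fixes t :: "'a::field"
  assumes S: "fsub S" and t: "t\<^sup>2 = p * t + q" and pq: "p \<in> S" "q \<in> S"
  shows "fsub {x + y * t | x y. x \<in> S \<and> y \<in> S}" (is "fsub ?T")
proof -
  have I: "x + y * t \<in> ?T" if "x \<in> S" "y \<in> S" for x y using that by blast
  note cl = fsub_add[OF S] fsub_mult[OF S] fsub_diff[OF S] fsub_inverse[OF S] fsub_divide[OF S]
    fsub_uminus[OF S] fsub_power[OF S] pq
  show ?thesis unfolding fsub_def
  proof (intro conjI ballI)
    show "1 \<in> ?T" using I[OF fsub_1[OF S] fsub_0[OF S]] by simp
    fix z assume "z \<in> ?T"
    then obtain x y where z: "z = x + y * t" "x \<in> S" "y \<in> S" by blast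
    define z' where "z' = x + y * (p - t)"
    define N where "N = x\<^sup>2 + x * y * p - y\<^sup>2 * q"
    have "z * z' = x\<^sup>2 + x * y * p + y\<^sup>2 * (p * t - t\<^sup>2)"
      by (simp add: z(1) z'_def power2_eq_square algebra_simps)
    then have zz': "z * z' = N" by (simp add: t N_def)
    have N: "N \<in> S" unfolding N_def using z by (intro cl)
    show "inverse z \<in> ?T"
    proof (cases "z' = 0")
      \<comment> \<open>When the conjugate vanishes, \<open>z\<close> equals the trace
        \<open>z + z'\<close>, an element of \<open>S\<close>.\<close>
      case True
      then have "y * t = x + y * p" by (simp add: z'_def algebra_simps)
      then have "z = x + (x + y * p)" by (simp add: z(1))
      moreover have "x + (x + y * p) \<in> S" using z by (intro cl)
      ultimately have "inverse z \<in> S" by (simp only: cl)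
      then show ?thesis using I[of "inverse z" 0] fsub_0[OF S] by simp
    next
      case False
      then have "inverse z = z' / N" using zz' by (cases "z = 0") (auto simp: field_simps)
      also have "\<dots> = (x + y * p) / N + (- y / N) * t"
        unfolding z'_def by (simp add: right_diff_distrib add_divide_distrib diff_divide_distrib)
      finally show ?thesis using I[of "(x + y * p) / N" "- y / N"] z N by (simp add: cl)
    qed
    fix u assume "u \<in> ?T"
    then obtain x' y' where u: "u = x' + y' * t" "x' \<in> S" "y' \<in> S" by blast
    have diff: "z - u = (x - x') + (y - y') * t" by (simp add: z u algebra_simps)
    show "z - u \<in> ?T" unfolding diff by (intro I cl z u)
    have "z * u = x * x' + (x * y' + y * x') * t + y * y' * t\<^sup>2"
      by (simp add: z u algebra_simps power2_eq_square)
    also have "\<dots> = (x * x' + y * y' * q) + (x * y' + y * x' + y * y' * p) * t"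
      by (simp add: t algebra_simps)
    finally have mult: "z * u = (x * x' + y * y' * q) + (x * y' + y * x' + y * y' * p) * t" .
    show "z * u \<in> ?T" unfolding mult by (intro I cl z u)
  qed
qed

context orth_inv
begin

text \<open>The values at \<open>w\<close> lie in the field generated by the Gram matrix of \<open>w\<close> and the \<open>t\<^sub>s\<close>, each of which
  is quadratic over the preceding ones.  The reflection in \<open>dv s\<close> exchanges the two roots \<open>t\<^sub>s\<close>, so that
  \<open>t\<^sub>s\<close> does not occur in the value of an invariant.\<close>

definition M :: "nat \<Rightarrow> 'k ratfun set" where
  "M k = generate_field class_ring (E \<union> (\<lambda>s. w (2 * s + 2, s)) ` {..<k})"

lemma fsub_M: "fsub (M k)"
  unfolding M_def by (rule fsub_generate_field)

lemma E_M: "x \<in> E \<Longrightarrow> x \<in> M k" and root_M: "s < k \<Longrightarrow> w (2 * s + 2, s) \<in> M k"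
  unfolding M_def by (auto intro!: generate_field.incl)

lemma M_0: "M 0 \<subseteq> E"
  unfolding M_def by (rule generate_field_subset[OF fsub_E]) simp

lemma dv_E: "2 * s + 1 \<le> nv \<Longrightarrow> w (2 * s + 1, \<nu> + s) \<in> E"
  using qf_span_w[of "dv s"] dv_ve_span_w[of s] qf_dv(1)[of s] by simp

lemma \<beta>_E: "2 * s + 2 \<le> nv \<Longrightarrow> \<beta> s \<in> E"
  unfolding \<beta>_def using dv_ve_span_w[of s] by (intro bf_span_w_span_w) auto

text \<open>\<open>ve s\<close> is \<open>(t, \<beta> s - a t)\<close>, so that
  \<open>q(ve s) = t (\<beta> s - a t)\<close> is a quadratic equation for \<open>t\<close>.\<close>

lemma ve_root:
  assumes s: "2 * s + 2 \<le> nv"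
  defines "a \<equiv> w (2 * s + 1, \<nu> + s)" and "t \<equiv> w (2 * s + 2, s)"
  shows "w (2 * s + 2, \<nu> + s) = \<beta> s - a * t" "t\<^sup>2 = \<beta> s / a * t + - (qf n (ve s) / a)"
proof -
  have sn: "s < \<nu>" using s by (simp add: nv_def)
  show Y: "w (2 * s + 2, \<nu> + s) = \<beta> s - a * t" by (simp add: \<beta>_eq[OF s] a_def t_def)
  have a: "a \<noteq> 0" using qf_dv[of s] s by (simp add: a_def)
  have "qf n (ve s) = t * (\<beta> s - a * t)"
    using Y by (simp add: ve_def qf_pair[OF sn] t_def)
  then have "\<beta> s / a * t + - (qf n (ve s) / a) = a * t * t / a" by (simp add: field_simps)
  then show "t\<^sup>2 = \<beta> s / a * t + - (qf n (ve s) / a)" using a by (simp add: power2_eq_square)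
qed

lemma M_Suc:
  assumes s: "2 * s + 2 \<le> nv" and z: "z \<in> M (Suc s)"
  obtains x y where "x \<in> M s" "y \<in> M s" "z = x + y * w (2 * s + 2, s)"
proof -
  let ?t = "w (2 * s + 2, s)"
  let ?T = "{x + y * ?t | x y. x \<in> M s \<and> y \<in> M s}"
  have "qf n (ve s) \<in> E" using dv_ve_span_w[of s] s by (intro qf_span_w) auto
  then have pq: "\<beta> s / w (2 * s + 1, \<nu> + s) \<in> M s" "- (qf n (ve s) / w (2 * s + 1, \<nu> + s)) \<in> M s"
    using \<beta>_E[OF s] dv_E[of s] s by (auto intro!: E_M fsub_uminus[OF fsub_E] fsub_divide[OF fsub_E])
  have T: "fsub ?T"
    by (rule fsub_quadratic_extension[OF fsub_M ve_root(2)[OF s] pq])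
  have "M (Suc s) \<subseteq> ?T"
    unfolding M_def[of "Suc s"]
  proof (rule generate_field_subset[OF T])
    have I: "x \<in> ?T" if "x \<in> M s" for x
      using that fsub_0[OF fsub_M, of s] by (intro CollectI exI[of _ x] exI[of _ 0]) simp
    have "?t \<in> ?T"
      using fsub_0[OF fsub_M, of s] fsub_1[OF fsub_M, of s] by (intro CollectI exI[of _ 0] exI[of _ 1]) simp
    then have "w (2 * r + 2, r) \<in> ?T" if "r < Suc s" for r
      using that I root_M[of r s] by (cases "r = s") auto
    then show "E \<union> (\<lambda>s. w (2 * s + 2, s)) ` {..<Suc s} \<subseteq> ?T"
      using I E_M by blast
  qed
  then show ?thesis using z that by blast
qed

text \<open>The substitution of \<open>w' s\<close> fixes the generators of \<open>E\<close>,
  because the reflection preserves the Gram matrix, and the earlier roots, because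
  \<open>dv s\<close> is supported on plane \<open>s\<close>.\<close>

lemma spec_w'_M:
  assumes s: "2 * s + 2 \<le> nv" and "z \<in> M s"
  shows "spec const (w' s) z z"
proof -
  have s1: "2 * s + 1 \<le> nv" using s by simp
  note h = comm_ring_hom_const
  let ?S = "{z. spec const (w' s) z z}"
  have S: "fsub ?S"
  proof (rule fsub_Collect)
    show "spec const (w' s) (inverse x) (inverse x)" if "spec const (w' s) x x" for x
      using that spec_inverse[OF h that] by (cases "x = 0") auto
  qed (auto intro: spec_1[OF h] spec_diff[OF h] spec_mult[OF h])
  have "poly_eval const w (gpoly n g) \<in> ?S" if "g \<in> gens" for g
  proof -
    have "spec const (w' s) (poly_eval const w (gpoly n g)) (poly_eval const (w' s) (gpoly n g))"
      by (rule spec_poly_eval[OF h]) (rule spec_w_w'[OF s1])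
    then show ?thesis using eval_gens_w'[OF s1 that] by simp
  qed
  then have "E \<subseteq> ?S"
    unfolding E_def by (intro generate_field_subset[OF S]) (auto intro: spec_const[OF h])
  moreover have "w (2 * r + 2, r) \<in> ?S" if "r < s" for r
  proof -
    have "w' s (2 * r + 2, r) = w (2 * r + 2, r)"
      using that s by (simp add: w'_eq dv_apply nv_def)
    then show ?thesis using spec_w_w'[OF s1, of "(2 * r + 2, r)"] by simp
  qed
  ultimately have "M s \<subseteq> ?S"
    unfolding M_def[of s] by (intro generate_field_subset[OF S]) auto
  then show ?thesis using assms(2) by blast
qed

text \<open>Write the value as \<open>x + y t\<close> with \<open>x\<close> and \<open>y\<close> in
  \<open>M s\<close>. The substitution of \<open>w' s\<close> fixes it by invariance, and it fixes
  \<open>x\<close> and \<open>y\<close>, but it moves \<open>t\<close> by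
  \<open>\<beta> s / q(dv s)\<close>, which is nonzero; hence \<open>y = 0\<close>.\<close>

lemma descent:
  assumes inv: "\<And>b g. reflprod n b g \<Longrightarrow> lin_subst g P * R = P * lin_subst g R"
    and R: "poly_eval const w R \<noteq> 0" and s: "2 * s + 2 \<le> nv"
    and f: "poly_eval const w P / poly_eval const w R \<in> M (Suc s)"
  shows "poly_eval const w P / poly_eval const w R \<in> M s"
proof -
  have s1: "2 * s + 1 \<le> nv" using s by simp
  note h = comm_ring_hom_const
  let ?t = "w (2 * s + 2, s)" and ?t' = "w' s (2 * s + 2, s)"
  obtain x y where xy: "x \<in> M s" "y \<in> M s" "poly_eval const w P / poly_eval const w R = x + y * ?t"
    using M_Suc[OF s f] by blast
  have ev: "spec const (w' s) (poly_eval const w Q) (poly_eval const (w' s) Q)" for Q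
    by (rule spec_poly_eval[OF h]) (rule spec_w_w'[OF s1])
  \<comment> \<open>If the denominator vanished at \<open>w' s\<close>, substituting once more would
    make it vanish at \<open>w\<close>.\<close>
  have "spec const (w' s) (poly_eval const (w' s) R) (poly_eval const w R)"
    by (rule spec_poly_eval[OF h]) (rule spec_w'_w[OF s1])
  then have R': "poly_eval const (w' s) R \<noteq> 0"
    using R spec_unique[OF h _ spec_0[OF h]] by metis
  have "poly_eval const (w' s) P / poly_eval const (w' s) R = poly_eval const w P / poly_eval const w R"
    using invariance_at_w[OF inv s1] R R' by (simp add: frac_eq_eq)
  then have "spec const (w' s) (x + y * ?t) (x + y * ?t)"
    using spec_divide[OF h ev ev R'] xy(3) by metis
  moreover have "spec const (w' s) (x + y * ?t) (x + y * ?t')"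
    by (intro spec_add[OF h] spec_mult[OF h] spec_w'_M[OF s] xy spec_w_w'[OF s1])
  ultimately have "x + y * ?t = x + y * ?t'" by (rule spec_unique[OF h])
  then have "y * (?t - ?t') = 0" by (simp add: right_diff_distrib del: mult_eq_0_iff)
  moreover have "?t - ?t' = bf n (crow w (2 * s + 2)) (dv s) / qf n (dv s)"
    by (simp add: w'_eq dv_apply)
  moreover have "bf n (crow w (2 * s + 2)) (dv s) = \<beta> s"
    using s by (simp add: \<beta>_eq[OF s] bf_dv nv_def crow_def)
  ultimately have "y * (\<beta> s / qf n (dv s)) = 0" by (simp only:)
  then have "y = 0" using \<beta>_nonzero[OF s] qf_dv(2)[OF s1] by simp
  then show ?thesis using xy by simp
qed

lemma hafnian_det_poly:
  fixes h :: "'k \<Rightarrow> 'b::comm_ring_1"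
  assumes h: "comm_ring_hom h" and two: "(2::'b) = 0"
  shows "poly_eval h v (det_poly (2 * \<nu>) [1..<2 * \<nu> + 1]) = hafnian \<nu> (\<lambda>i j. bf n (crow v i) (crow v j))"
proof -
  have "mat (2 * \<nu>) (2 * \<nu>) (\<lambda>(a, j). v ([1..<2 * \<nu> + 1] ! j, a)) =
      mat (2 * \<nu>) (2 * \<nu>) (\<lambda>(a, j). crow v (Suc j) a)"
    by (intro eq_matI) (auto simp: crow_def simp del: upt_Suc)
  then show ?thesis
    using hafnian_eq_det[OF two, of \<nu> "crow v"] by (subst eval_det_poly[OF h]) (simp_all add: bf_2nu)
qed

lemma det_poly_nonzero: "det_poly k [1..<k + 1] \<noteq> (0 :: (nat \<times> nat, 'k) mpoly)"
proof -
  have "ev (\<lambda>(i, a). if i = Suc a then 1 else 0) (det_poly k [1..<k + 1]) =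
      det (mat k k (\<lambda>(a, j). if [1..<k + 1] ! j = Suc a then 1 else 0))"
    by (subst eval_det_poly[OF comm_ring_hom_id]) simp_all
  also have "mat k k (\<lambda>(a, j). if [1..<k + 1] ! j = Suc a then 1 else 0) = (1\<^sub>m k :: 'k mat)"
    by (intro eq_matI) (auto simp del: upt_Suc)
  finally have "ev (\<lambda>(i, a). if i = Suc a then 1 else 0) (det_poly k [1..<k + 1]) = 1" by simp
  moreover have "ev (\<lambda>(i, a). if i = Suc a then 1 else 0) 0 = 0" by (simp only: eval_simps)
  ultimately show ?thesis by (intro notI) (simp only:, simp)
qed

text \<open>The hafnian is a nonzero determinant polynomial, and it does not change under
  reflections, since the polar form does not. By density it is nonzero at some normal tuple, hence
  at \<open>w\<close>.\<close>

lemma hafnian_w_nonzero: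
  assumes "nv = 2 * \<nu>"
  shows "hafnian \<nu> (\<lambda>i j. bf n (crow w i) (crow w j)) \<noteq> 0"
proof -
  let ?D = "det_poly (2 * \<nu>) [1..<2 * \<nu> + 1] :: (nat \<times> nat, 'k) mpoly"
  obtain b g \<xi> where g: "reflprod n b g" and \<xi>: "normal_upto nv \<xi>" "ev (act_pt n g \<xi>) ?D \<noteq> 0"
    using density[OF det_poly_nonzero] by blast
  have "ev (act_pt n g \<xi>) ?D = ev \<xi> ?D"
    unfolding hafnian_det_poly[OF comm_ring_hom_id two] bf_crow_act_pt
      bf_orthogonal[OF two reflprod_orthogonal[OF two g]] ..
  then have "poly_eval const w ?D \<noteq> 0" using eval_w_nonzero[OF \<xi>(1)] \<xi>(2) by simp
  then show ?thesis unfolding hafnian_det_poly[OF comm_ring_hom_const two_r] .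
qed

lemma hafnian_w_E:
  assumes "nv = 2 * \<nu>"
  shows "hafnian \<nu> (\<lambda>i j. bf n (crow w i) (crow w j)) \<in> E"
  unfolding hafnian_def
proof (intro fsub_sum[OF fsub_E] fsub_prod[OF fsub_E] bf_w_E)
  fix s t assume s: "s \<in> pairings \<nu>" and t: "t \<in> {1..\<nu>}"
  then have "s (2 * t - 1) \<in> {1..2 * \<nu>}" "s (2 * t) \<in> {1..2 * \<nu>}"
    unfolding pairings_def by (auto simp only: mem_Collect_eq permutes_in_image, auto)
  moreover have "2 * \<nu> \<le> m" using assms by (simp add: nv_def)
  ultimately show "s (2 * t - 1) \<in> {1..nv}" "s (2 * t) \<in> {1..m}" using assms by auto
qed

text \<open>A plane filled by two vectors is handled by the dual basis. In a plane that only one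
  normalised vector reaches, its component is \<open>(1, a)\<close> with \<open>a\<close> in
  \<open>E\<close>. The last coordinate for odd \<open>n\<close> is \<open>D\<close> divided by the
  hafnian.\<close>

lemma w_M:
  assumes i: "i \<in> {1..m}" and a: "a < n"
  shows "w (i, a) \<in> M (nv div 2)"
proof -
  let ?K = "nv div 2"
  have full: "w (i, a) \<in> M ?K" if s: "2 * s + 2 \<le> nv" and as: "a = s \<or> a = \<nu> + s" for s
  proof -
    have sK: "s < ?K" using s by linarith
    have sp: "dv s \<in> span_w" "ve s \<in> span_w" using dv_ve_span_w[of s] s by auto
    have "bf n (crow w i) (ve s) / \<beta> s \<in> M ?K" "bf n (crow w i) (dv s) / \<beta> s \<in> M ?K"
      using bf_span_w[OF sp(1) i] bf_span_w[OF sp(2) i] \<beta>_E[OF s]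
      by (auto simp: bf_sym[of n "crow w i"] intro!: E_M fsub_divide[OF fsub_E])
    moreover have "dv s a \<in> M ?K"
      using dv_E[of s] s nu_pos by (auto simp: dv_apply intro: E_M fsub_0[OF fsub_M] fsub_1[OF fsub_M])
    moreover have "w (2 * s + 2, \<nu> + s) \<in> M ?K"
      unfolding ve_root(1)[OF s] using s
      by (intro fsub_diff[OF fsub_M] fsub_mult[OF fsub_M] E_M[OF \<beta>_E] E_M[OF dv_E] root_M[OF sK]) auto
    then have "ve s a \<in> M ?K"
      using root_M[OF sK] fsub_0[OF fsub_M] by (simp add: ve_apply)
    ultimately have "bf n (crow w i) (ve s) / \<beta> s * dv s a + bf n (crow w i) (dv s) / \<beta> s * ve s a \<in> M ?K"
      by (intro fsub_add[OF fsub_M] fsub_mult[OF fsub_M])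
    then show ?thesis using block_decomposition[OF s as, of "crow w i"] by (simp add: crow_def)
  qed
  have partial: "w (i, a) \<in> M ?K" if t: "t < \<nu>" and "a = t \<or> a = \<nu> + t" for t
  proof (cases "2 * t + 2 \<le> nv")
    case True
    then show ?thesis using full that(2) by blast
  next
    case False
    then have iv: "i \<in> {1..nv}" "nv = m" using i t by (auto simp: nv_def)
    show ?thesis
    proof (cases "blk i < t")
      case True
      then have "high (Suc (blk i)) a" using that by (auto simp: high_simps)
      then show ?thesis using w_zero[OF iv(1) a] fsub_0[OF fsub_M] by simp
    next
      case nlt: False
      then have it: "i = 2 * t + 1" "2 * t + 1 \<le> nv" using False iv by (auto simp: blk_def)
      then show ?thesis
        using that(2) w_block(2)[OF it(2)] dv_E[OF it(2)] fsub_1[OF fsub_M] E_M by auto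
    qed
  qed
  show ?thesis using a
  proof (rule idx_cases)
    assume z: "a = 2 * \<nu>" "n = 2 * \<nu> + 1"
    show ?thesis
    proof (cases "i \<in> {1..nv}")
      case True
      show ?thesis unfolding z(1) w_last[OF True z(2)] by (rule fsub_0[OF fsub_M])
    next
      case False
      then have l: "2 * \<nu> + 1 \<le> i" "i \<le> m" using i by (auto simp: nv_def)
      then have nv: "nv = 2 * \<nu>" by (rule nv_full)
      have "poly_eval const w (gpoly n (Dgen i)) \<in> E"
        by (rule gens_E, unfold gens_nv(3), intro conjI z(2) l)
      moreover have "poly_eval const w (gpoly n (Dgen i)) =
          hafnian \<nu> (\<lambda>i j. bf n (crow w i) (crow w j)) * w (i, 2 * \<nu>)"
        by (rule eval_Dgen[OF comm_ring_hom_const two_r z(2)], rule w_last[OF _ z(2)], unfold nv)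
      ultimately have "hafnian \<nu> (\<lambda>i j. bf n (crow w i) (crow w j)) * w (i, 2 * \<nu>) /
          hafnian \<nu> (\<lambda>i j. bf n (crow w i) (crow w j)) \<in> E"
        using hafnian_w_E[OF nv] by (intro fsub_divide[OF fsub_E]) auto
      then have "w (i, 2 * \<nu>) \<in> E" using hafnian_w_nonzero[OF nv] by simp
      then show ?thesis unfolding z(1) by (rule E_M)
    qed
  qed (use partial in auto)
qed

text \<open>Once \<open>f\<close> is known to take a value in \<open>E\<close> at \<open>w\<close>,
  some \<open>\<phi>\<close> in the generated field takes the same value there, because
  \<open>E\<close> is generated by the values of the generators. The difference is invariant and
  zero at \<open>w\<close>, hence zero on a dense set.\<close>

theorem refl_invariants_subset:
  fixes f :: "'k ratfun"
  assumes f: "f \<in> ratfun_field n m" and inv: "\<forall>b g. reflprod n b g \<longrightarrow> ratfun_act g f = f"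
    and gens_inv: "\<And>b g x. reflprod n b g \<Longrightarrow> x \<in> gens \<Longrightarrow> ratfun_act g (gen_val n x) = (gen_val n x :: 'k ratfun)"
    and gens_field: "\<And>x. x \<in> gens \<Longrightarrow> (gen_val n x :: 'k ratfun) \<in> ratfun_field n m"
  shows "f \<in> generate_field class_ring (range const \<union> gen_val n ` gens)"
proof -
  note h = comm_ring_hom_const
  let ?F = "generate_field class_ring (range const \<union> gen_val n ` gens) :: 'k ratfun set"
  obtain P R where PR: "f = to_fract P / to_fract R" "poly_eval const w R \<noteq> 0"
    "vars P \<subseteq> {1..m} \<times> {..<n}" "vars R \<subseteq> {1..m} \<times> {..<n}" "R \<noteq> 0"
    "\<forall>b g. reflprod n b g \<longrightarrow> lin_subst g P * R = P * lin_subst g R"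
    using good_fraction[OF f inv] by blast
  let ?f = "poly_eval const w P / poly_eval const w R"
  have ev: "poly_eval const w Q \<in> M (nv div 2)" if "vars Q \<subseteq> {1..m} \<times> {..<n}" for Q
    by (rule fsub_poly_eval[OF fsub_M]) (use that in \<open>auto intro: E_M const_E intro!: w_M simp del: atLeastAtMost_iff\<close>)
  \<comment> \<open>\<open>k\<close> counts the roots that have been eliminated.\<close>
  have "?f \<in> M (nv div 2 - k)" for k
  proof (induction k)
    case 0
    then show ?case using ev PR by (auto intro: fsub_divide[OF fsub_M])
  next
    case (Suc k)
    show ?case
    proof (cases "nv div 2 - k = 0")
      case False
      define s where "s = nv div 2 - Suc k"
      then have s: "nv div 2 - k = Suc s" using False by simp
      have "2 * s + 2 \<le> nv" using s by linarith
      then show ?thesis using descent[OF PR(6)[rule_format] PR(2)] Suc.IH s s_def by simp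
    qed (use Suc in simp)
  qed
  from this[of "nv div 2"] have fE: "?f \<in> E" using M_0 by auto
  have F: "fsub ?F" by (rule fsub_generate_field)
  have "E \<subseteq> {y. \<exists>\<phi>\<in>?F. spec const w \<phi> y}"
    unfolding E_def
  proof (rule generate_field_subset[OF fsub_Collect])
    show "\<exists>\<phi>\<in>?F. spec const w \<phi> 1" using fsub_1[OF F] spec_1[OF h] by blast
    show "\<exists>\<phi>\<in>?F. spec const w \<phi> (x - y)" if "\<exists>\<phi>\<in>?F. spec const w \<phi> x" "\<exists>\<phi>\<in>?F. spec const w \<phi> y" for x y
      using that fsub_diff[OF F] spec_diff[OF h] by blast
    show "\<exists>\<phi>\<in>?F. spec const w \<phi> (x * y)" if "\<exists>\<phi>\<in>?F. spec const w \<phi> x" "\<exists>\<phi>\<in>?F. spec const w \<phi> y" for x y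
      using that fsub_mult[OF F] spec_mult[OF h] by blast
    show "\<exists>\<phi>\<in>?F. spec const w \<phi> (inverse x)" if x: "\<exists>\<phi>\<in>?F. spec const w \<phi> x" for x
    proof (cases "x = 0")
      case True
      then show ?thesis using x by simp
    next
      case False
      then show ?thesis using x fsub_inverse[OF F] spec_inverse[OF h] by blast
    qed
    have "const c \<in> ?F" "gen_val n x \<in> ?F" if "x \<in> gens" for c x
      using that by (auto intro: generate_field.incl)
    moreover have "const c \<in> ?F" for c by (auto intro: generate_field.incl)
    moreover have "spec const w (gen_val n x) (poly_eval const w (gpoly n x))" for x
      unfolding gen_val_gpoly by (rule spec_to_fract[OF h])
    ultimately show "range const \<union> (\<lambda>g. poly_eval const w (gpoly n g)) ` gens \<subseteq> {y. \<exists>\<phi>\<in>?F. spec const w \<phi> y}"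
      using spec_const[OF h, of w] by blast
  qed
  then obtain \<phi> where \<phi>: "\<phi> \<in> ?F" "spec const w \<phi> ?f" using fE by blast
  let ?W = "{g :: 'k mat. \<exists>b. reflprod n b g}"
  have W: "?W \<subseteq> orthogonal_group n" using reflprod_orthogonal[OF two] by blast
  have "range const \<union> gen_val n ` gens \<subseteq> invariant_field ?W n m"
    using gens_inv gens_field const_invariant_field[OF W] unfolding invariant_field_def[of ?W] by blast
  then have \<phi>_inv: "\<phi> \<in> invariant_field ?W n m"
    using generate_field_subset[OF fsub_invariant_field[OF W]] \<phi>(1) by blast
  let ?h = "f - \<phi>"
  have "\<phi> \<in> ratfun_field n m" using \<phi>_inv by (simp add: invariant_field_def)
  then have h_field: "?h \<in> ratfun_field n m" using f fsub_diff[OF fsub_ratfun_field] by blast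
  have h_inv: "ratfun_act g ?h = ?h" if "reflprod n b g" for b g
  proof -
    have "ratfun_act g \<phi> = \<phi>" using that \<phi>_inv unfolding invariant_field_def by blast
    moreover have "ratfun_act g f = f" using inv that by blast
    ultimately show ?thesis using ratfun_act_diff[OF reflprod_mat[OF that], of f \<phi>] by simp
  qed
  then have h_inv': "\<forall>b g. reflprod n b g \<longrightarrow> ratfun_act g ?h = ?h" by blast
  have "spec const w f ?f" unfolding PR(1) by (rule spec_fraction[OF h PR(2)])
  then have spec0: "spec const w ?h 0" using spec_diff[OF h _ \<phi>(2)] by fastforce
  obtain P' R' where PR': "?h = to_fract P' / to_fract R'" "poly_eval const w R' \<noteq> 0"
    "\<forall>b g. reflprod n b g \<longrightarrow> lin_subst g P' * R' = P' * lin_subst g R'"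
    using good_fraction[OF h_field h_inv'] by blast
  have "spec const w ?h (poly_eval const w P' / poly_eval const w R')"
    unfolding PR'(1) by (rule spec_fraction[OF h PR'(2)])
  then have P'0: "poly_eval const w P' = 0"
    using spec_unique[OF h spec0] PR'(2) by fastforce
  have "P' = 0"
  proof (rule ccontr)
    assume "P' \<noteq> 0"
    then obtain b g \<xi> where g: "reflprod n b g" and \<xi>: "normal_upto nv \<xi>" "ev (act_pt n g \<xi>) P' \<noteq> 0"
      using density by blast
    then have "poly_eval const w (lin_subst g P') \<noteq> 0"
      using eval_w_nonzero[OF \<xi>(1)] by (simp add: eval_lin_subst[OF reflprod_mat(1)[OF g]])
    \<comment> \<open>At \<open>w\<close> the right-hand side is zero and \<open>R'\<close> is not,
      so the translated numerator vanishes as well, contrary to the choice of \<open>g\<close> and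
      \<open>\<xi>\<close>.\<close>
    moreover have "poly_eval const w (lin_subst g P' * R') = poly_eval const w (P' * lin_subst g R')"
      using PR'(3) g by simp
    ultimately show False using PR'(2) P'0 by (simp add: const_eval_simps)
  qed
  then have "?h = 0" using PR'(1) by simp
  then show ?thesis using \<phi>(1) by simp
qed

end


section \<open>Algebraic independence\<close>

definition deg :: "('x \<Rightarrow>\<^sub>0 nat) \<Rightarrow> nat" where
  "deg e = (\<Sum>x\<in>Poly_Mapping.keys e. Poly_Mapping.lookup e x)"

lemma deg_superset: "finite S \<Longrightarrow> Poly_Mapping.keys e \<subseteq> S \<Longrightarrow> deg e = (\<Sum>x\<in>S. Poly_Mapping.lookup e x)"
  unfolding deg_def by (rule sum.mono_neutral_left) (auto simp: in_keys_iff)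

lemma deg_add: "deg (d + e) = deg d + deg e"
proof -
  let ?S = "Poly_Mapping.keys d \<union> Poly_Mapping.keys e"
  have "Poly_Mapping.keys (d + e) \<subseteq> ?S" by (rule Poly_Mapping.keys_add)
  then show ?thesis by (simp add: deg_superset[of ?S] lookup_add sum.distrib)
qed

text \<open>Membership in the \<open>d\<close>-th power of the ideal generated by the
  variables.\<close>

definition vanishes :: "nat \<Rightarrow> ('x, 'a::comm_ring_1) mpoly \<Rightarrow> bool" where
  "vanishes d p \<longleftrightarrow> (\<forall>e\<in>Poly_Mapping.keys p. d \<le> deg e)"

lemma vanishes_0 [simp]: "vanishes d 0" and vanishes_any [simp]: "vanishes 0 p"
  by (simp_all add: vanishes_def)

lemma vanishes_mono: "vanishes d p \<Longrightarrow> d' \<le> d \<Longrightarrow> vanishes d' p"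
  unfolding vanishes_def using order.trans by blast

lemma vanishes_add: "vanishes d p \<Longrightarrow> vanishes d q \<Longrightarrow> vanishes d (p + q)"
  unfolding vanishes_def using Poly_Mapping.keys_add[of p q] by blast

lemma vanishes_uminus: "vanishes d p \<Longrightarrow> vanishes d (- p)"
  by (simp add: vanishes_def)

lemma vanishes_sum: "(\<And>i. i \<in> I \<Longrightarrow> vanishes d (f i)) \<Longrightarrow> vanishes d (sum f I)"
  by (induction I rule: infinite_finite_induct) (simp_all add: vanishes_add)

lemma vanishes_mult: "vanishes a p \<Longrightarrow> vanishes b q \<Longrightarrow> vanishes (a + b) (p * q)"
  unfolding vanishes_def
proof
  fix e assume p: "\<forall>e\<in>Poly_Mapping.keys p. a \<le> deg e" and q: "\<forall>e\<in>Poly_Mapping.keys q. b \<le> deg e"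
    and "e \<in> Poly_Mapping.keys (p * q)"
  then obtain e1 e2 where "e = e1 + e2" "e1 \<in> Poly_Mapping.keys p" "e2 \<in> Poly_Mapping.keys q"
    using keys_mult[of p q] by auto
  then show "a + b \<le> deg e" using p q by (simp add: deg_add add_mono)
qed

lemma vanishes_Var: "vanishes 1 (Var x :: ('x, 'a::comm_ring_1) mpoly)"
  by (simp add: vanishes_def Var_def deg_def)

lemma vanishes_1_iff:
  fixes p :: "('x, 'b::comm_ring_1) mpoly"
  shows "vanishes 1 p \<longleftrightarrow> poly_eval (\<lambda>c. c) (\<lambda>_. 0) p = 0"
proof -
  have mon: "mon_eval (\<lambda>_. 0) e = (if e = 0 then 1 else (0::'b))" for e :: "'x \<Rightarrow>\<^sub>0 nat"
  proof (cases "e = 0")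
    case False
    then obtain x where x: "x \<in> Poly_Mapping.keys e" by fastforce
    then have "Poly_Mapping.lookup e x \<noteq> 0" by (simp only: in_keys_iff not_False_eq_True)
    then have "(0::'b) ^ Poly_Mapping.lookup e x = 0" by (simp only: power_0_left if_False)
    then have "mon_eval (\<lambda>_. 0) e = (0::'b)"
      unfolding mon_eval_def using x by (intro prod_zero bexI[of _ x]) simp_all
    then show ?thesis using False by simp
  qed simp
  have "poly_eval (\<lambda>c. c) (\<lambda>_. 0) p = (\<Sum>e\<in>Poly_Mapping.keys p. if e = 0 then Poly_Mapping.lookup p e else 0)"
    unfolding poly_eval_def mon by (intro sum.cong) auto
  also have "\<dots> = Poly_Mapping.lookup p 0"
    by (simp add: sum.delta in_keys_iff)
  finally have "poly_eval (\<lambda>c. c) (\<lambda>_. 0) p = Poly_Mapping.lookup p 0" .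
  moreover have "deg e = 0 \<longleftrightarrow> e = 0" for e :: "'x \<Rightarrow>\<^sub>0 nat"
    by (auto simp: deg_def in_keys_iff intro!: poly_mapping_eqI)
  then have "vanishes 1 p \<longleftrightarrow> 0 \<notin> Poly_Mapping.keys p"
    unfolding vanishes_def by (metis less_one not_le)
  ultimately show ?thesis by (simp add: in_keys_iff)
qed

text \<open>Equality of the homogeneous parts of degree \<open>d\<close>, for polynomials without
  terms of lower degree.\<close>

definition same_lead :: "nat \<Rightarrow> ('x, 'a::comm_ring_1) mpoly \<Rightarrow> ('x, 'a) mpoly \<Rightarrow> bool" where
  "same_lead d p q \<longleftrightarrow> vanishes d p \<and> vanishes d q \<and> vanishes (Suc d) (p - q)"

lemma same_lead_1: "same_lead 0 1 1"
  by (simp add: same_lead_def)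

lemma same_lead_mult: "same_lead a p q \<Longrightarrow> same_lead b p' q' \<Longrightarrow> same_lead (a + b) (p * p') (q * q')"
proof -
  assume *: "same_lead a p q" "same_lead b p' q'"
  have "p * p' - q * q' = (p - q) * p' + q * (p' - q')" by (simp add: algebra_simps)
  moreover have "vanishes (Suc (a + b)) ((p - q) * p')" "vanishes (Suc (a + b)) (q * (p' - q'))"
    using * vanishes_mult[of "Suc a" "p - q" b p'] vanishes_mult[of a q "Suc b" "p' - q'"]
    by (simp_all add: same_lead_def)
  ultimately show ?thesis using * by (simp add: same_lead_def vanishes_mult vanishes_add)
qed

lemma same_lead_power: "same_lead a p q \<Longrightarrow> same_lead (k * a) (p ^ k) (q ^ k)"
  by (induction k) (simp_all add: same_lead_1 same_lead_mult)

lemma same_lead_prod: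
  "(\<And>i. i \<in> I \<Longrightarrow> same_lead (d i) (f i) (g i)) \<Longrightarrow> same_lead (sum d I) (prod f I) (prod g I)"
  by (induction I rule: infinite_finite_induct) (simp_all add: same_lead_1 same_lead_mult)

lemma same_lead_mon_eval:
  assumes "\<And>x. x \<in> Poly_Mapping.keys e \<Longrightarrow> same_lead 1 (s x) (t x)"
  shows "same_lead (deg e) (mon_eval s e) (mon_eval t e)"
  unfolding mon_eval_def deg_def
  by (rule same_lead_prod) (use same_lead_power[OF assms] in force)

lemma vanishes_poly_eval_diff:
  assumes "vanishes d p" "\<And>x. x \<in> vars p \<Longrightarrow> same_lead 1 (s x) (t x)"
  shows "vanishes (Suc d) (poly_eval Const s p - poly_eval Const t p)" "vanishes d (poly_eval Const s p)"
proof -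
  have m: "same_lead (deg e) (mon_eval s e) (mon_eval t e)" "d \<le> deg e" if "e \<in> Poly_Mapping.keys p" for e
  proof -
    have "x \<in> vars p" if "x \<in> Poly_Mapping.keys e" for x
      using \<open>e \<in> _\<close> that unfolding vars_def by blast
    then show "same_lead (deg e) (mon_eval s e) (mon_eval t e)" by (intro same_lead_mon_eval assms(2))
    show "d \<le> deg e" using assms(1) that by (simp add: vanishes_def)
  qed
  have "vanishes (Suc d) (Const (Poly_Mapping.lookup p e) * (mon_eval s e - mon_eval t e))"
    if "e \<in> Poly_Mapping.keys p" for e
    using vanishes_mult[of 0 "Const (Poly_Mapping.lookup p e)" "Suc (deg e)"] m[OF that]
    by (auto simp: same_lead_def intro: vanishes_mono)
  then show "vanishes (Suc d) (poly_eval Const s p - poly_eval Const t p)"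
    unfolding poly_eval_def sum_subtractf[symmetric] right_diff_distrib[symmetric] by (intro vanishes_sum)
  have "vanishes d (Const (Poly_Mapping.lookup p e) * mon_eval s e)" if "e \<in> Poly_Mapping.keys p" for e
    using vanishes_mult[of 0 "Const (Poly_Mapping.lookup p e)" "deg e"] m[OF that]
    by (auto simp: same_lead_def intro: vanishes_mono)
  then show "vanishes d (poly_eval Const s p)"
    unfolding poly_eval_def by (intro vanishes_sum)
qed

lemma poly_eval_Const_subst:
  "poly_eval Const s (poly_eval Const \<rho> p) = poly_eval Const (\<lambda>x. poly_eval Const s (\<rho> x)) p"
  by (rule comm_ring_hom.poly_eval_subst[OF comm_ring_hom_Const])

text \<open>The Jacobian criterion in the special case where the linear parts at a point are distinct
  variables.\<close>

lemma linear_parts_independent: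
  fixes f :: "'x \<Rightarrow> ('y, 'a::comm_ring_1) mpoly"
  assumes inj: "inj_on \<iota> I"
    and f: "\<And>x. x \<in> I \<Longrightarrow> vanishes 2 (f x - Const (c x) - Var (\<iota> x))"
    and p: "vars p \<subseteq> I" "poly_eval Const f p = 0"
  shows "p = 0"
proof -
  \<comment> \<open>Translating the relation by \<open>c\<close> moves the values of the
    \<open>f x\<close> at the origin to 0.\<close>
  let ?s = "\<lambda>x. Var x + Const (c x)" and ?s' = "\<lambda>x. Var x - Const (c x)"
  define q where "q = poly_eval Const ?s p"
  have p_q: "p = poly_eval Const ?s' q"
    by (simp add: q_def poly_eval_Const_subst Const_eval_simps poly_eval_Const_Var)
  have vars_q: "vars q \<subseteq> I"
    unfolding q_def by (rule vars_poly_eval_Const) (use p(1) vars_closed(1)[of "Var _" I "Const _"] in auto)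
  define F where "F x = f x - Const (c x)" for x
  have qF: "poly_eval Const F q = 0"
    using p(2) by (simp add: q_def poly_eval_Const_subst Const_eval_simps F_def)
  have lead: "same_lead 1 (F x) (Var (\<iota> x))" if "x \<in> vars q" for x
  proof -
    have 2: "vanishes 2 (F x - Var (\<iota> x))" using f that vars_q by (auto simp: F_def)
    then have "vanishes 1 (F x - Var (\<iota> x) + Var (\<iota> x))"
      by (intro vanishes_add vanishes_Var) (rule vanishes_mono, auto)
    then show ?thesis using 2 vanishes_Var by (simp add: same_lead_def numeral_2_eq_2)
  qed
  have "q = 0"
  proof (rule ccontr)
    assume "q \<noteq> 0"
    then have K: "Poly_Mapping.keys q \<noteq> {}" by simp
    define d where "d = Min (deg ` Poly_Mapping.keys q)"
    have d: "vanishes d q" by (simp add: vanishes_def d_def)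
    have "d \<in> deg ` Poly_Mapping.keys q" unfolding d_def by (rule Min_in) (use K in auto)
    then obtain e0 where e0: "e0 \<in> Poly_Mapping.keys q" "deg e0 = d" by auto
    let ?T = "poly_eval Const (\<lambda>x. Var (\<iota> x)) q"
    \<comment> \<open>Replacing each \<open>F x\<close> by its linear part changes the value of
      \<open>q\<close> only in degrees above \<open>d\<close>, its lowest degree. As
      \<open>q\<close> vanishes at \<open>F\<close>, its form of degree \<open>d\<close> vanishes in
      the renamed variables; undoing the renaming contradicts the choice of
      \<open>d\<close>.\<close>
    have "vanishes (Suc d) (poly_eval Const F q - ?T)"
      by (rule vanishes_poly_eval_diff(1)[OF d lead])
    then have T: "vanishes (Suc d) ?T" using vanishes_uminus[of "Suc d" "- ?T"] by (simp add: qF)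
    let ?r = "\<lambda>y. Var (inv_into I \<iota> y) :: ('x, 'a) mpoly"
    have "vanishes (Suc d) (poly_eval Const ?r ?T)"
      by (rule vanishes_poly_eval_diff(2)[OF T, of _ ?r]) (simp add: same_lead_def vanishes_Var[unfolded One_nat_def])
    moreover have "poly_eval Const ?r ?T = q"
    proof -
      have "poly_eval Const ?r ?T = poly_eval Const (\<lambda>x. ?r (\<iota> x)) q"
        by (simp add: poly_eval_Const_subst Const_eval_simps)
      also have "\<dots> = poly_eval Const Var q"
        by (rule poly_eval_cong) (use vars_q inj in \<open>auto simp: inv_into_f_f subset_iff\<close>)
      finally show ?thesis by (simp add: poly_eval_Const_Var)
    qed
    ultimately show False using e0 by (auto simp: vanishes_def)
  qed
  then show ?thesis using p_q by (simp add: Const_eval_simps)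
qed

section \<open>The Jacobian criterion at the standard basis\<close>

context orth_inv
begin

abbreviation cj :: "nat \<Rightarrow> nat" where "cj \<equiv> conj_idx \<nu>"

text \<open>The point at which the Jacobian criterion is applied has the standard basis as its first \<open>2 \<nu>\<close>
  vectors.  Variables are added only in those coordinates that make the linear part of every generator a
  single variable.\<close>

definition base :: "nat \<Rightarrow> nat \<Rightarrow> 'a::comm_ring_1" where
  "base j a = (if j \<le> 2 * \<nu> \<and> a = j - 1 then 1 else 0)"

text \<open>Coordinate \<open>a\<close> is the one that the basis vector \<open>i = cj a + 1\<close>
  is paired with, so in vector \<open>j\<close> it gives the linear part of \<open>B\<close> for
  \<open>i\<close> and \<open>j\<close>, or of \<open>Q\<close> if \<open>i = j\<close>. Keeping it
  only for \<open>i \<le> j\<close> prevents a second linear term in \<open>B\<close>. The last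
  coordinate serves \<open>D\<close>.\<close>

definition free :: "nat \<Rightarrow> nat \<Rightarrow> bool" where
  "free j a \<longleftrightarrow> (a < 2 * \<nu> \<and> cj a + 1 \<le> j) \<or> (a = 2 * \<nu> \<and> j > 2 * \<nu>)"

definition dev :: "nat \<Rightarrow> nat \<Rightarrow> (nat \<times> nat, 'k) mpoly" where
  "dev j a = (if free j a then Var (j, a) else 0)"

definition u :: "nat \<times> nat \<Rightarrow> (nat \<times> nat, 'k) mpoly" where
  "u = (\<lambda>(j, a). base j a + dev j a)"

lemma two_m: "(2 :: (nat \<times> nat, 'k) mpoly) = 0" by (rule two_mpoly[OF two])

lemma crow_u: "crow u j = (\<lambda>a. base j a + dev j a)"
  by (simp add: crow_def u_def)

lemma bf_base:
  assumes "1 \<le> i" "i \<le> 2 * \<nu>"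
  shows "bf n (base i) y = y (cj (i - 1))"
proof (cases "i - 1 < \<nu>")
  case True
  have "bf n (base i) y = bf n (pair (i - 1) 1 0) y"
    using assms by (intro bf_cong) (auto simp: base_def pair_def)
  then show ?thesis using True by (simp add: bf_pair conj_idx_def)
next
  case False
  define s where "s = i - 1 - \<nu>"
  have s: "s < \<nu>" "i - 1 = \<nu> + s" using False assms by (auto simp: s_def)
  have "bf n (base i) y = bf n (pair s 0 1) y"
    using assms s by (intro bf_cong) (auto simp: base_def pair_def)
  then show ?thesis using s by (simp add: bf_pair conj_idx_def)
qed

lemma bf_base_zero: "i > 2 * \<nu> \<Longrightarrow> bf n (base i) y = 0"
  using bf_zero(1)[of n y] by (simp add: base_def[abs_def])

lemma qf_base:
  assumes "1 \<le> i" "i \<le> 2 * \<nu>"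
  shows "qf n (base i) = 0"
proof (cases "i - 1 < \<nu>")
  case True
  have "qf n (base i) = qf n (pair (i - 1) 1 0)"
    using assms by (intro qf_cong) (auto simp: base_def pair_def)
  then show ?thesis using True by (simp add: qf_pair)
next
  case False
  define s where "s = i - 1 - \<nu>"
  have s: "s < \<nu>" "i - 1 = \<nu> + s" using False assms by (auto simp: s_def)
  have "qf n (base i) = qf n (pair s 0 1)"
    using assms s by (intro qf_cong) (auto simp: base_def pair_def)
  then show ?thesis using s by (simp add: qf_pair)
qed

lemma vanishes_dev: "vanishes 1 (dev j a)"
  using vanishes_Var by (auto simp: dev_def)

lemma vanishes_bf_dev: "vanishes 2 (bf n (dev i) (dev j))"
proof -
  have "vanishes 2 (dev i a * dev j b)" for a b
    using vanishes_mult[OF vanishes_dev vanishes_dev] by (simp add: numeral_2_eq_2)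
  then show ?thesis unfolding bf_def by (intro vanishes_sum vanishes_add)
qed

lemma vanishes_qf_dev: "vanishes 2 (qf n (dev i))"
proof -
  have m: "vanishes 2 (dev i a * dev i b)" for a b
    using vanishes_mult[OF vanishes_dev vanishes_dev] by (simp add: numeral_2_eq_2)
  then show ?thesis unfolding qf_def power2_eq_square by (auto intro!: vanishes_sum vanishes_add)
qed

fun lead_var :: "gen \<Rightarrow> nat \<times> nat" where
  "lead_var (Qgen i) = (i, cj (i - 1))"
| "lead_var (Bgen i j) = (j, cj (i - 1))"
| "lead_var (Dgen l) = (l, 2 * \<nu>)"

lemma cj_lt: "1 \<le> i \<Longrightarrow> i \<le> 2 * \<nu> \<Longrightarrow> cj (i - 1) < 2 * \<nu>"
  and cj_cj: "1 \<le> i \<Longrightarrow> i \<le> 2 * \<nu> \<Longrightarrow> cj (cj (i - 1)) = i - 1"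
  using conj_idx(1,2)[of "i - 1" \<nu>] by auto

lemma cj_eq_iff: "1 \<le> i \<Longrightarrow> i \<le> 2 * \<nu> \<Longrightarrow> 1 \<le> j \<Longrightarrow> j \<le> 2 * \<nu> \<Longrightarrow> cj (i - 1) = cj (j - 1) \<longleftrightarrow> i = j"
proof
  assume ij: "1 \<le> i" "i \<le> 2 * \<nu>" "1 \<le> j" "j \<le> 2 * \<nu>" and "cj (i - 1) = cj (j - 1)"
  then have "i - 1 = j - 1" using cj_cj[OF ij(1,2)] cj_cj[OF ij(3,4)] by argo
  then show "i = j" using ij by simp
qed simp

text \<open>The second entry recovers \<open>i\<close>; then \<open>Q\<close> occupies the places
  with \<open>i = j\<close> and \<open>B\<close> those with \<open>i < j\<close>. Only
  \<open>D\<close> uses the last coordinate.\<close>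

lemma inj_lead_var: "inj_on lead_var gens"
proof (rule inj_onI)
  fix x y assume xy: "x \<in> gens" "y \<in> gens" "lead_var x = lead_var y"
  have Q: "1 \<le> i \<and> i \<le> 2 * \<nu>" if "Qgen i \<in> gens" for i using that by (simp add: gens_nv nv_def)
  have B: "1 \<le> i \<and> i \<le> 2 * \<nu> \<and> i < j" if "Bgen i j \<in> gens" for i j using that by (simp add: gens_nv)
  have lt: "cj (i - 1) \<noteq> 2 * \<nu>" if "1 \<le> i" "i \<le> 2 * \<nu>" for i using cj_lt[OF that] by simp
  show "x = y"
  proof (cases x; cases y)
    fix i j assume "x = Qgen i" "y = Qgen j"
    then show ?thesis using xy by simp
  next
    fix i j l assume "x = Qgen i" "y = Bgen j l"
    then show ?thesis using xy Q[of i] B[of j l] cj_eq_iff[of i j] by auto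
  next
    fix i l assume "x = Qgen i" "y = Dgen l"
    then show ?thesis using xy Q[of i] lt[of i] by auto
  next
    fix i j l assume "x = Bgen i j" "y = Qgen l"
    then show ?thesis using xy Q[of l] B[of i j] cj_eq_iff[of i l] by auto
  next
    fix i j i' j' assume "x = Bgen i j" "y = Bgen i' j'"
    then show ?thesis using xy B[of i j] B[of i' j'] cj_eq_iff[of i i'] by auto
  next
    fix i j l assume "x = Bgen i j" "y = Dgen l"
    then show ?thesis using xy B[of i j] lt[of i] by auto
  next
    fix l i assume "x = Dgen l" "y = Qgen i"
    then show ?thesis using xy Q[of i] lt[of i] by auto
  next
    fix l i j assume "x = Dgen l" "y = Bgen i j"
    then show ?thesis using xy B[of i j] lt[of i] by auto
  next
    fix l l' assume "x = Dgen l" "y = Dgen l'"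
    then show ?thesis using xy by simp
  qed
qed

lemma dev_lead: "1 \<le> i \<Longrightarrow> i \<le> 2 * \<nu> \<Longrightarrow> i \<le> j \<Longrightarrow> dev j (cj (i - 1)) = Var (j, cj (i - 1))"
  using cj_lt[of i] cj_cj[of i] by (simp add: dev_def free_def)

lemma dev_low: "1 \<le> j \<Longrightarrow> j \<le> 2 * \<nu> \<Longrightarrow> i < j \<Longrightarrow> dev i (cj (j - 1)) = 0"
  using cj_lt[of j] cj_cj[of j] by (auto simp: dev_def free_def)

lemma base_Const: "base j a = Const (base j a :: 'k)"
  by (simp add: base_def)

text \<open>Expansion at \<open>base + dev\<close>. In \<open>B\<close> one of the two mixed terms
  is removed by the choice of \<open>free\<close>. In \<open>D\<close> the cofactor of the last
  coordinate has constant term 1, the determinant of the identity matrix.\<close>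

lemma gen_linear_part:
  assumes "g \<in> gens"
  shows "\<exists>c. vanishes 2 (poly_eval Const u (gpoly n g) - Const c - Var (lead_var g))"
proof (cases g)
  case (Qgen i)
  then have i: "1 \<le> i" "i \<le> 2 * \<nu>" using assms by (auto simp: gens_nv nv_def)
  have "poly_eval Const u (gpoly n g) = qf n (crow u i)"
    by (simp add: Qgen eval_quad_form[OF comm_ring_hom_Const])
  also have "\<dots> = qf n (dev i) + Var (lead_var g)"
    unfolding crow_u qf_add[OF two_m] qf_base[OF i] bf_base[OF i] dev_lead[OF i order.refl]
    by (simp add: Qgen)
  finally show ?thesis using vanishes_qf_dev[of i] by (intro exI[of _ 0]) simp
next
  case (Bgen i j)
  then have i: "1 \<le> i" "i \<le> 2 * \<nu>" "i < j" using assms by (auto simp: gens_nv)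
  have rest: "bf n (dev i) (base j) = 0"
  proof (cases "j \<le> 2 * \<nu>")
    case True
    have j: "1 \<le> j" using i by simp
    show ?thesis unfolding bf_sym[of n "dev i"] bf_base[OF j True] by (rule dev_low[OF j True i(3)])
  next
    case False
    then show ?thesis by (simp add: bf_sym[of n "dev i"] bf_base_zero)
  qed
  have "poly_eval Const u (gpoly n g) = bf n (crow u i) (crow u j)"
    by (simp add: Bgen eval_polar_form[OF comm_ring_hom_Const two_m])
  also have "\<dots> = base j (cj (i - 1)) + Var (lead_var g) + bf n (dev i) (dev j)"
    unfolding crow_u bf_lin rest bf_base[OF i(1,2)] dev_lead[OF i(1,2) less_imp_le[OF i(3)]] by (simp add: Bgen)
  also have "base j (cj (i - 1)) = Const (base j (cj (i - 1)) :: 'k)" by (rule base_Const)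
  finally show ?thesis using vanishes_bf_dev[of i j] by (intro exI[of _ "base j (cj (i - 1))"]) simp
next
  case (Dgen l)
  then have l: "n = 2 * \<nu> + 1" "2 * \<nu> < l" using assms by (auto simp: gens_nv)
  define H where "H = hafnian \<nu> (\<lambda>i j. bf n (crow u i) (crow u j))"
  have u_last: "u (i, 2 * \<nu>) = 0" if "i \<in> {1..2 * \<nu>}" for i
    using that by (auto simp: u_def base_def dev_def free_def)
  have ul: "u (l, 2 * \<nu>) = Var (l, 2 * \<nu>)" using l by (simp add: u_def base_def dev_def free_def)
  have "poly_eval Const u (gpoly n (Dgen l)) = H * u (l, 2 * \<nu>)"
    unfolding H_def by (rule eval_Dgen[OF comm_ring_hom_Const two_m l(1)]) (rule u_last)
  then have D: "poly_eval Const u (gpoly n g) = H * Var (l, 2 * \<nu>)" unfolding ul Dgen .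
  have u0: "ev (\<lambda>_. 0) (u x) = (case x of (j, a) \<Rightarrow> base j a)" for x
    by (auto simp: u_def base_def dev_def eval_simps split: prod.splits)
  have "ev (\<lambda>_. 0) H = ev (\<lambda>_. 0) (poly_eval Const u (det_poly (2 * \<nu>) [1..<2 * \<nu> + 1]))"
    unfolding H_def hafnian_det_poly[OF comm_ring_hom_Const two_m] ..
  also have "\<dots> = ev (\<lambda>(j, a). base j a) (det_poly (2 * \<nu>) [1..<2 * \<nu> + 1])"
    unfolding eval_simps u0 by simp
  also have "\<dots> = det (mat (2 * \<nu>) (2 * \<nu>) (\<lambda>(a, j). base ([1..<2 * \<nu> + 1] ! j) a))"
    by (subst eval_det_poly[OF comm_ring_hom_id]) simp_all
  also have "mat (2 * \<nu>) (2 * \<nu>) (\<lambda>(a, j). base ([1..<2 * \<nu> + 1] ! j) a) = (1\<^sub>m (2 * \<nu>) :: 'k mat)"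
    by (intro eq_matI) (auto simp: base_def simp del: upt_Suc)
  finally have "ev (\<lambda>_. 0) (H - 1) = 0" by (simp add: eval_simps)
  then have "vanishes 1 (H - 1)" unfolding vanishes_1_iff .
  then have "vanishes (1 + 1) ((H - 1) * Var (l, 2 * \<nu>))" by (intro vanishes_mult vanishes_Var)
  then have "vanishes 2 ((H - 1) * Var (l, 2 * \<nu>))" by (simp only: one_add_one)
  then show ?thesis unfolding D
    by (intro exI[of _ 0]) (simp add: Dgen algebra_simps)
qed

theorem gens_independent: "alg_independent gens (gen_val n :: gen \<Rightarrow> 'k ratfun)"
  unfolding alg_independent_def
proof (intro allI impI)
  fix p :: "(gen, 'k) mpoly"
  assume p: "vars p \<subseteq> gens" "poly_eval const (gen_val n) p = 0"
  have "to_fract (poly_eval Const (gpoly n) p) = poly_eval const (gen_val n) p"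
    unfolding to_fract_poly_eval gen_val_gpoly[abs_def] ..
  then have "poly_eval Const (gpoly n) p = 0" using p(2) by simp
  then have "poly_eval Const u (poly_eval Const (gpoly n) p) = 0" by (simp add: Const_eval_simps)
  then have 0: "poly_eval Const (\<lambda>g. poly_eval Const u (gpoly n g)) p = 0"
    by (simp add: poly_eval_Const_subst)
  have "\<forall>g\<in>gens. \<exists>c. vanishes 2 (poly_eval Const u (gpoly n g) - Const c - Var (lead_var g))"
    using gen_linear_part by (rule ballI)
  from bchoice[OF this] obtain c where
    c: "\<forall>g\<in>gens. vanishes 2 (poly_eval Const u (gpoly n g) - Const (c g) - Var (lead_var g))"
    by (elim exE)
  show "p = 0"
    by (rule linear_parts_independent[OF inj_lead_var bspec[OF c] p(1) 0])
qed

end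


section \<open>The field of invariants of the orthogonal group\<close>

lemma vars_det:
  fixes A :: "('x, 'a::comm_ring_1) mpoly mat"
  assumes "A \<in> carrier_mat k k" "\<And>i j. i < k \<Longrightarrow> j < k \<Longrightarrow> vars (A $$ (i, j)) \<subseteq> S"
  shows "vars (det A) \<subseteq> S"
proof -
  have sgn: "vars (signof p :: ('x, 'a) mpoly) \<subseteq> S" for p :: "nat \<Rightarrow> nat"
    by (simp add: sign_def)
  have "vars (A $$ (i, p i)) \<subseteq> S" if "p permutes {0..<k}" "i \<in> {0..<k}" for p i
    using that permutes_in_image[OF that(1), of i] by (intro assms(2)) auto
  then show ?thesis
    unfolding det_def'[OF assms(1)] by (intro vars_sum vars_closed(3) vars_prod sgn) auto
qed

lemma vars_qf:
  assumes "\<And>a. a < n \<Longrightarrow> vars (x a) \<subseteq> S"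
  shows "vars (qf n x) \<subseteq> S"
  unfolding qf_def
proof (rule vars_closed(1))
  show "vars (\<Sum>t<n div 2. x t * x (n div 2 + t)) \<subseteq> S"
    by (intro vars_sum vars_closed(3) assms) auto
  show "vars (if odd n then (x (n - 1))\<^sup>2 else 0) \<subseteq> S"
    using vars_power[OF assms[of "n - 1"], of 2] odd_pos[of n] by (cases "odd n") simp_all
qed

lemma quad_form_gvec: "quad_form n (gvec n i) = qf n (\<lambda>a. Var (i, a))"
  unfolding quad_form_qf by (rule qf_cong) (simp add: gvec_def)

lemma vars_gpoly:
  "vars (gpoly n (Qgen i) :: (nat \<times> nat, 'k::field) mpoly) \<subseteq> {i} \<times> {..<n}"
  "vars (gpoly n (Bgen i j) :: (nat \<times> nat, 'k) mpoly) \<subseteq> {i, j} \<times> {..<n}"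
proof -
  show "vars (gpoly n (Qgen i) :: (nat \<times> nat, 'k) mpoly) \<subseteq> {i} \<times> {..<n}"
    unfolding gpoly.simps quad_form_gvec by (rule vars_qf) simp
  have "quad_form n (gvec n i + gvec n j) = qf n (\<lambda>a. Var (i, a) + (Var (j, a) :: (nat \<times> nat, 'k) mpoly))"
    unfolding quad_form_qf by (rule qf_cong) (simp add: gvec_def)
  moreover have "vars (qf n (\<lambda>a. Var (i, a) + (Var (j, a) :: (nat \<times> nat, 'k) mpoly))) \<subseteq> {i, j} \<times> {..<n}"
    by (intro vars_qf vars_closed(1)) simp_all
  moreover have "vars (qf n (\<lambda>a. Var (l, a) :: (nat \<times> nat, 'k) mpoly)) \<subseteq> {i, j} \<times> {..<n}" if "l = i \<or> l = j" for l
    using that by (intro vars_qf) auto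
  ultimately show "vars (gpoly n (Bgen i j) :: (nat \<times> nat, 'k) mpoly) \<subseteq> {i, j} \<times> {..<n}"
    unfolding gpoly.simps polar_form_def quad_form_gvec by (intro vars_closed) simp_all
qed

lemma vars_det_poly:
  assumes "length is = n"
  shows "vars (det_poly n is) \<subseteq> set is \<times> {..<n}"
  unfolding det_poly_def
  by (rule vars_det[of _ n]) (use assms in \<open>auto simp: mat_of_cols_def gvec_def\<close>)

lemma det_last_col:
  fixes f :: "nat \<times> nat \<Rightarrow> 'a::idom"
  assumes "\<And>i. i < k \<Longrightarrow> f (i, k) = 0"
  shows "det (mat (Suc k) (Suc k) f) = det (mat k k f) * f (k, k)"
proof -
  have t: "det (mat j j f) = det (mat j j (\<lambda>(a, b). f (b, a)))" for j
  proof -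
    have "transpose_mat (mat j j f) = mat j j (\<lambda>(a, b). f (b, a))" by (rule eq_matI) auto
    then show ?thesis using det_transpose[of "mat j j f" j] by simp
  qed
  show ?thesis
    unfolding t by (subst det_last_row) (use assms in auto)
qed

section \<open>Invariance of the generators\<close>

context orth_inv
begin

lemma gens_field:
  assumes "x \<in> gens"
  shows "gen_val n x \<in> ratfun_field n m"
  unfolding gen_val_gpoly
proof (rule to_fract_ratfun_field)
  show "vars (gpoly n x) \<subseteq> {1..m} \<times> {..<n}"
  proof (cases x)
    case (Qgen i)
    then show ?thesis using assms vars_gpoly(1)[of n i] by (fastforce simp: gens_nv nv_def)
  next
    case (Bgen i j)
    then have "{i, j} \<subseteq> {1..m}" using assms by (auto simp: gens_nv)
    then show ?thesis using vars_gpoly(2)[of n i j] unfolding Bgen by blast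
  next
    case (Dgen l)
    then have l: "n = 2 * \<nu> + 1" "2 * \<nu> + 1 \<le> l" "l \<le> m" using assms by (auto simp: gens_nv)
    then have "set ([1..<n] @ [l]) \<subseteq> {1..m}" "length ([1..<n] @ [l]) = n" by auto
    then show ?thesis using vars_det_poly[of "[1..<n] @ [l]" n] unfolding Dgen gpoly.simps by blast
  qed
qed

lemma surj_orthogonal:
  assumes "g \<in> orthogonal_group n"
  obtains x where "\<And>a. a < n \<Longrightarrow> mv n g x a = (y :: nat \<Rightarrow> 'k) a"
proof -
  note gm = orthogonal_groupD[OF assms]
  obtain h where h: "h \<in> carrier_mat n n" "g * h = 1\<^sub>m n" using invertible_matE[OF gm] by blast
  have "mv n g (mv n h y) a = y a" if "a < n" for a
    using mv_mult[OF gm(1) h(1) that, of y] h(2) that by (simp add: mv_one)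
  then show ?thesis using that by blast
qed

text \<open>For odd \<open>n\<close> the radical of the polar form is spanned by the last basis vector, which an
  isometry has to fix.\<close>

lemma orthogonal_last_col:
  assumes g: "g \<in> orthogonal_group n" and n: "n = 2 * \<nu> + 1" and a: "a < n"
  shows "g $$ (a, 2 * \<nu>) = (if a = 2 * \<nu> then 1 else (0::'k))"
proof -
  define z :: "nat \<Rightarrow> 'k" where "z = (\<lambda>b. if b = 2 * \<nu> then 1 else 0)"
  define c where "c = mv n g z"
  have c: "g $$ (b, 2 * \<nu>) = c b" for b
    using n by (simp add: c_def mv_def z_def if_distrib[of "\<lambda>z. _ * z"] cong: if_cong)
  have bz: "bf n x z = 0" for x by (simp add: bf_nu z_def)
  have bc: "bf n y c = 0" for y
  proof -
    obtain x where x: "\<And>a. a < n \<Longrightarrow> mv n g x a = y a" using surj_orthogonal[OF g] by blast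
    have "bf n y c = bf n (mv n g x) c" by (rule bf_cong) (simp_all add: x)
    also have "\<dots> = bf n x z" unfolding c_def by (rule bf_orthogonal[OF two g])
    finally show ?thesis by (simp add: bz)
  qed
  have zero: "c t = 0" "c (\<nu> + t) = 0" if "t < \<nu>" for t
    using bc[of "pair t 0 1"] bc[of "pair t 1 0"] that by (simp_all add: bf_pair)
  have "qf n c = qf n z" unfolding c_def by (rule qf_orthogonal[OF g])
  moreover have "qf n c = (c (2 * \<nu>))\<^sup>2" using n zero by (simp add: qf_def)
  moreover have "qf n z = 1" using n by (simp add: qf_def z_def)
  ultimately have "(c (2 * \<nu>) - 1)\<^sup>2 = 0"
    using square_add[OF two, of "c (2 * \<nu>)" 1] add_self[OF two, of 1] by (simp add: diff_eq[OF two])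
  then have cz: "c (2 * \<nu>) = 1" by simp
  show ?thesis using a unfolding c
    by (rule idx_cases) (use zero cz in auto)
qed

text \<open>The last column of \<open>g\<close> is the last basis vector, so \<open>det g\<close> is
  the upper left minor of size \<open>2 * \<nu>\<close>. This is the hafnian of the polar form
  values of the images of the basis vectors, and \<open>g\<close> preserves these values.\<close>

lemma det_orthogonal_odd:
  assumes g: "g \<in> orthogonal_group n" and n: "n = 2 * \<nu> + 1"
  shows "det g = (1::'k)"
proof -
  note gc = orthogonal_groupD(1)[OF g]
  have ge: "g = mat (Suc (2 * \<nu>)) (Suc (2 * \<nu>)) (\<lambda>ij. g $$ ij)"
    using gc n by (intro eq_matI) auto
  have "det g = det (mat (2 * \<nu>) (2 * \<nu>) (\<lambda>ij. g $$ ij)) * g $$ (2 * \<nu>, 2 * \<nu>)"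
    by (subst ge, rule det_last_col) (use orthogonal_last_col[OF g n] n in auto)
  also have "g $$ (2 * \<nu>, 2 * \<nu>) = 1" using orthogonal_last_col[OF g n] n by simp
  also have "mat (2 * \<nu>) (2 * \<nu>) (\<lambda>ij. g $$ ij) =
      mat (2 * \<nu>) (2 * \<nu>) (\<lambda>(a, j). mv n g (base (Suc j)) a)"
  proof (rule eq_matI)
    fix a j assume aj: "a < dim_row (mat (2 * \<nu>) (2 * \<nu>) (\<lambda>(a, j). mv n g (base (Suc j)) a))"
      "j < dim_col (mat (2 * \<nu>) (2 * \<nu>) (\<lambda>(a, j). mv n g (base (Suc j)) a))"
    then have "base (Suc j) = (\<lambda>b. if b = j then 1 else (0::'k))" by (auto simp: base_def)
    then show "mat (2 * \<nu>) (2 * \<nu>) (\<lambda>ij. g $$ ij) $$ (a, j) =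
      mat (2 * \<nu>) (2 * \<nu>) (\<lambda>(a, j). mv n g (base (Suc j)) a) $$ (a, j)"
      using aj n by (simp add: mv_def if_distrib[of "\<lambda>z. _ * z"] cong: if_cong)
  qed auto
  also have "det \<dots> = hafnian \<nu> (\<lambda>i j. bf n (mv n g (base i)) (mv n g (base j)))"
    using hafnian_eq_det[OF two, of \<nu> "\<lambda>j. mv n g (base j)"] by (simp add: bf_2nu)
  also have "\<dots> = hafnian \<nu> (\<lambda>i j. bf n (base i) (base j :: nat \<Rightarrow> 'k))"
    unfolding bf_orthogonal[OF two g] ..
  also have "\<dots> = det (mat (2 * \<nu>) (2 * \<nu>) (\<lambda>(a, j). base (Suc j) a))"
    using hafnian_eq_det[OF two, of \<nu> base] by (simp add: bf_2nu)
  also have "mat (2 * \<nu>) (2 * \<nu>) (\<lambda>(a, j). base (Suc j) a) = (1\<^sub>m (2 * \<nu>) :: 'k mat)"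
    by (intro eq_matI) (auto simp: base_def)
  finally show ?thesis by simp
qed

lemma gens_inv:
  assumes g: "g \<in> orthogonal_group n" and "x \<in> gens"
  shows "ratfun_act g (gen_val n x) = (gen_val n x :: 'k ratfun)"
proof -
  note gm = orthogonal_groupD[OF g]
  have "ev (act_pt n g v) (gpoly n x) = ev v (gpoly n x)" for v
  proof (cases x)
    case (Qgen i)
    then show ?thesis
      by (simp add: eval_quad_form[OF comm_ring_hom_id] qf_crow_act_pt qf_orthogonal[OF g])
  next
    case (Bgen i j)
    then show ?thesis
      by (simp add: eval_polar_form[OF comm_ring_hom_id two] bf_crow_act_pt bf_orthogonal[OF two g])
  next
    case (Dgen l)
    then have n: "n = 2 * \<nu> + 1" using assms(2) by (simp add: gens_nv)
    let ?is = "[1..<n] @ [l]"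
    have len: "length ?is = n" using n by simp
    have "mat n n (\<lambda>(a, j). act_pt n g v (?is ! j, a)) = g * mat n n (\<lambda>(a, j). v (?is ! j, a))"
    proof (rule eq_matI)
      fix a j assume "a < dim_row (g * mat n n (\<lambda>(a, j). v (?is ! j, a)))" "j < dim_col (g * mat n n (\<lambda>(a, j). v (?is ! j, a)))"
      then have aj: "a < n" "j < n" using gm by auto
      then have "(g * mat n n (\<lambda>(a, j). v (?is ! j, a))) $$ (a, j) = (\<Sum>b<n. g $$ (a, b) * v (?is ! j, b))"
        using gm by (simp add: scalar_prod_def atLeast0LessThan del: upt_Suc)
      then show "mat n n (\<lambda>(a, j). act_pt n g v (?is ! j, a)) $$ (a, j) = (g * mat n n (\<lambda>(a, j). v (?is ! j, a))) $$ (a, j)"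
        using aj by (simp add: act_pt_def mv_def crow_def del: upt_Suc)
    qed (use gm in auto)
    then show ?thesis
      unfolding Dgen gpoly.simps eval_det_poly[OF comm_ring_hom_id len]
      using det_mult[OF gm(1), of "mat n n (\<lambda>(a, j). v (?is ! j, a))"] det_orthogonal_odd[OF g n] by simp
  qed
  then have "lin_subst g (gpoly n x) = gpoly n x"
    by (intro mpoly_ext[OF inf]) (simp add: eval_lin_subst[OF gm(1)])
  then show ?thesis unfolding gen_val_gpoly by (simp add: ratfun_act_to_fract[OF gm])
qed

abbreviation F :: "'k ratfun set" where
  "F \<equiv> generate_field class_ring (range const \<union> gen_val n ` gens)"

lemma F_subset:
  assumes "G \<subseteq> orthogonal_group n"
  shows "F \<subseteq> invariant_field G n m"
proof (rule generate_field_subset[OF fsub_invariant_field[OF assms]])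
  have "gen_val n x \<in> invariant_field G n m" if "x \<in> gens" for x
    unfolding invariant_field_def using that assms gens_field gens_inv by blast
  then show "range const \<union> gen_val n ` gens \<subseteq> invariant_field G n m"
    using const_invariant_field[OF assms] by blast
qed

text \<open>The generators are fixed by all isometries, and what the products of reflections fix
  lies in \<open>F\<close>; any set of isometries in between has the same invariants.\<close>

lemma invariants_eq_F:
  assumes "G \<subseteq> orthogonal_group n" "\<And>b g. reflprod n b g \<Longrightarrow> g \<in> G"
  shows "invariant_field G n m = F"
proof
  show "invariant_field G n m \<subseteq> F"
  proof
    fix f :: "'k ratfun" assume "f \<in> invariant_field G n m"
    then have "f \<in> ratfun_field n m" "\<forall>b g. reflprod n b g \<longrightarrow> ratfun_act g f = f"
      using assms(2) unfolding invariant_field_def by blast+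
    then show "f \<in> F"
      by (rule refl_invariants_subset) (use gens_inv gens_field reflprod_orthogonal[OF two] in blast)+
  qed
qed (rule F_subset[OF assms(1)])

lemma orthogonal_invariants: "invariant_field (orthogonal_group n) n m = F"
  by (rule invariants_eq_F) (auto intro: reflprod_orthogonal[OF two])


section \<open>The connected component of the identity\<close>

lemma nth_beyond: "xs ! (length xs + i) = [] ! i"
  by (induction xs) auto

text \<open>The value of an index outside the matrix is unspecified, but it depends on the dimensions only.
  The equations of a Zariski closed set may mention such indices.\<close>

lemma index_mat_outside:
  "\<not> (a < r \<and> b < c) \<Longrightarrow> mat r c f $$ (a, b) = (if a < r then [] ! (b - c) else [] ! (a - r) ! b)"
proof -
  assume out: "\<not> (a < r \<and> b < c)"
  then have "mat r c f $$ (a, b) = undef_mat r c f (a, b)"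
    by (transfer', simp only: mk_mat_def snd_conv o_apply prod.case if_False)
  also have "\<dots> = (if a < r then [] ! (b - c) else [] ! (a - r) ! b)"
  proof (cases "a < r")
    case True
    then have "map (\<lambda>j. f (a, j)) [0..<c] ! b = [] ! (b - c)"
      using out nth_beyond[of "map (\<lambda>j. f (a, j)) [0..<c]" "b - c"] by simp
    then show ?thesis using True by (simp add: undef_mat_def)
  next
    case False
    then have "map (\<lambda>i. map (\<lambda>j. f (i, j)) [0..<c]) [0..<r] ! a = [] ! (a - r)"
      using nth_beyond[of "map (\<lambda>i. map (\<lambda>j. f (i, j)) [0..<c]) [0..<r]" "a - r"] by simp
    then show ?thesis using False by (simp add: undef_mat_def)
  qed
  finally show ?thesis .
qed

lemma mat_index_outside:
  assumes "g \<in> carrier_mat r c" "h \<in> carrier_mat r c" "\<not> (a < r \<and> b < c)"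
  shows "g $$ (a, b) = h $$ (a, b)"
proof -
  have "g = mat r c (\<lambda>ij. g $$ ij)" "h = mat r c (\<lambda>ij. h $$ ij)"
    using assms(1,2) by (auto intro!: eq_matI)
  then show ?thesis using index_mat_outside[OF assms(3)] by metis
qed

text \<open>Regular functions of the vector with index 0 on the set \<open>q \<noteq> 0\<close>; that this set is
  irreducible makes the reflections a connected family.\<close>

definition ratl :: "((nat \<times> nat \<Rightarrow> 'k) \<Rightarrow> 'k) \<Rightarrow> bool" where
  "ratl h \<longleftrightarrow> (\<exists>N k. \<forall>v. qf n (crow v 0) \<noteq> 0 \<longrightarrow> qf n (crow v 0) ^ k * h v = ev v N)"

lemma ratl_I: "(\<And>v. qf n (crow v 0) \<noteq> 0 \<Longrightarrow> qf n (crow v 0) ^ k * h v = ev v N) \<Longrightarrow> ratl h"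
  unfolding ratl_def by blast

lemma ratl_const: "ratl (\<lambda>v. c)"
  by (rule ratl_I[of 0 _ "Const c"]) (simp add: eval_simps)

lemma ratl_coord: "ratl (\<lambda>v. v x)"
  by (rule ratl_I[of 0 _ "Var x"]) (simp add: eval_simps)

lemma ratl_inverse_qf: "ratl (\<lambda>v. inverse (qf n (crow v 0)))"
  by (rule ratl_I[of 1 _ 1]) (simp add: eval_simps)

lemma ratl_mult: "ratl h \<Longrightarrow> ratl h' \<Longrightarrow> ratl (\<lambda>v. h v * h' v)"
proof -
  assume "ratl h" "ratl h'"
  then obtain N k N' k' where
    *: "\<forall>v. qf n (crow v 0) \<noteq> 0 \<longrightarrow> qf n (crow v 0) ^ k * h v = ev v N"
      "\<forall>v. qf n (crow v 0) \<noteq> 0 \<longrightarrow> qf n (crow v 0) ^ k' * h' v = ev v N'"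
    unfolding ratl_def by blast
  show ?thesis
  proof (rule ratl_I[of "k + k'" _ "N * N'"])
    fix v :: "nat \<times> nat \<Rightarrow> 'k" assume q: "qf n (crow v 0) \<noteq> 0"
    have "qf n (crow v 0) ^ (k + k') * (h v * h' v) = (qf n (crow v 0) ^ k * h v) * (qf n (crow v 0) ^ k' * h' v)"
      by (simp add: power_add mult_ac)
    also have "\<dots> = ev v (N * N')" using * q by (simp add: eval_simps)
    finally show "qf n (crow v 0) ^ (k + k') * (h v * h' v) = ev v (N * N')" .
  qed
qed

lemma ratl_add: "ratl h \<Longrightarrow> ratl h' \<Longrightarrow> ratl (\<lambda>v. h v + h' v)"
proof -
  assume "ratl h" "ratl h'"
  then obtain N k N' k' where
    *: "\<forall>v. qf n (crow v 0) \<noteq> 0 \<longrightarrow> qf n (crow v 0) ^ k * h v = ev v N"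
      "\<forall>v. qf n (crow v 0) \<noteq> 0 \<longrightarrow> qf n (crow v 0) ^ k' * h' v = ev v N'"
    unfolding ratl_def by blast
  let ?q = "quad_form n (gvec n 0) :: (nat \<times> nat, 'k) mpoly"
  show ?thesis
  proof (rule ratl_I[of "k + k'" _ "?q ^ k' * N + ?q ^ k * N'"])
    fix v :: "nat \<times> nat \<Rightarrow> 'k" assume q: "qf n (crow v 0) \<noteq> 0"
    have "qf n (crow v 0) ^ (k + k') * (h v + h' v) =
        qf n (crow v 0) ^ k' * (qf n (crow v 0) ^ k * h v) + qf n (crow v 0) ^ k * (qf n (crow v 0) ^ k' * h' v)"
      by (simp add: power_add algebra_simps)
    also have "\<dots> = ev v (?q ^ k' * N + ?q ^ k * N')"
      using * q by (simp add: eval_simps eval_quad_form[OF comm_ring_hom_id])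
    finally show "qf n (crow v 0) ^ (k + k') * (h v + h' v) = ev v (?q ^ k' * N + ?q ^ k * N')" .
  qed
qed

lemma ratl_sum: "(\<And>i. i \<in> I \<Longrightarrow> ratl (f i)) \<Longrightarrow> ratl (\<lambda>v. \<Sum>i\<in>I. f i v)"
  by (induction I rule: infinite_finite_induct) (simp_all add: ratl_const ratl_add)

lemma ratl_power: "ratl h \<Longrightarrow> ratl (\<lambda>v. h v ^ j)"
  by (induction j) (simp_all add: ratl_const ratl_mult)

lemma ratl_prod: "(\<And>i. i \<in> I \<Longrightarrow> ratl (f i)) \<Longrightarrow> ratl (\<lambda>v. \<Prod>i\<in>I. f i v)"
  by (induction I rule: infinite_finite_induct) (simp_all add: ratl_const ratl_mult)

lemma ratl_eval:
  assumes "\<And>x. ratl (\<lambda>v. s v x)"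
  shows "ratl (\<lambda>v. ev (s v) p)"
  unfolding poly_eval_def mon_eval_def
  by (intro ratl_sum ratl_mult ratl_const ratl_prod ratl_power assms)

lemma ratl_entry:
  assumes "g \<in> carrier_mat n n" "a < n" "b < n"
  shows "ratl (\<lambda>v. (g * refl_mat n (crow v 0)) $$ (a, b))"
proof -
  let ?J = "\<lambda>v. if b < n div 2 then v (0, n div 2 + b) else if b < 2 * (n div 2) then v (0, b - n div 2) else 0"
  have e: "(\<lambda>v. (g * refl_mat n (crow v 0)) $$ (a, b)) =
    (\<lambda>v. \<Sum>e<n. g $$ (a, e) * ((if e = b then 1 else 0) + (-1) * v (0, e) * ?J v * inverse (qf n (crow v 0))))"
    using assms by (auto simp: fun_eq_iff scalar_prod_def atLeast0LessThan refl_mat_def crow_def divide_inverse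
        intro!: sum.cong)
  have "ratl ?J"
    by (cases "b < n div 2"; cases "b < 2 * (n div 2)") (simp_all add: ratl_coord ratl_const)
  then show ?thesis unfolding e
    by (intro ratl_sum ratl_mult ratl_add ratl_const ratl_coord ratl_inverse_qf)
qed

text \<open>A nonempty relatively open subset contains the members of the family at all
  \<open>c\<close> where \<open>q\<close> and some polynomial \<open>N \<noteq> 0\<close> do not
  vanish. Two such polynomials and \<open>q\<close> have a common nonroot, so two such subsets
  meet.\<close>

lemma connected_refl_family:
  assumes g: "g \<in> orthogonal_group n"
  shows "connectedin (subtopology (zariski_topology n) (orthogonal_group n))
    {g * refl_mat n (c :: nat \<Rightarrow> 'k) | c. qf n c \<noteq> 0}" (is "connectedin _ ?S")
proof -
  note gc = orthogonal_groupD(1)[OF g]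
  have S: "?S \<subseteq> orthogonal_group n" using orthogonal_mult[OF g] refl_mat_orthogonal[OF two] by blast
  have SC: "?S \<subseteq> carrier_mat n n" using S orthogonal_groupD by blast
  have zar_carrier: "zariski_open n (carrier_mat n n :: 'k mat set)"
    unfolding zariski_open_def mat_zero_locus_def by (rule exI[of _ "{1}"]) (auto simp: eval_simps)
  then have top: "topspace (zariski_topology n :: 'k mat topology) \<supseteq> carrier_mat n n"
    by (metis openin_subset openin_zariski)
  have nonempty: "\<exists>N. N \<noteq> 0 \<and> (\<forall>v. qf n (crow v 0) \<noteq> 0 \<longrightarrow> ev v N \<noteq> 0 \<longrightarrow> g * refl_mat n (crow v 0) \<in> A)"
    if A: "zariski_open n A" "A \<inter> ?S \<noteq> {}" for A
  proof -
    obtain P where P: "A = carrier_mat n n - mat_zero_locus n P" using A(1) unfolding zariski_open_def by blast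
    obtain c where c: "qf n c \<noteq> 0" "g * refl_mat n c \<in> A" using A(2) by blast
    obtain p where p: "p \<in> P" "ev (\<lambda>ij. (g * refl_mat n c) $$ ij) p \<noteq> 0"
      using c(2) unfolding P mat_zero_locus_def by blast
    have "ratl (\<lambda>v. (g * refl_mat n (crow v 0)) $$ x)" for x
    proof (cases x)
      case (Pair a b)
      show ?thesis
      proof (cases "a < n \<and> b < n")
        case True
        then show ?thesis using ratl_entry[OF gc] by (simp add: Pair)
      next
        case False
        have "(g * refl_mat n (crow v 0)) $$ (a, b) = g $$ (a, b)" for v
          by (rule mat_index_outside[OF mult_carrier_mat[OF gc refl_mat_carrier] gc False])
        then show ?thesis using ratl_const by (simp add: Pair)
      qed
    qed
    then have "ratl (\<lambda>v. ev (\<lambda>ij. (g * refl_mat n (crow v 0)) $$ ij) p)" by (rule ratl_eval)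
    then obtain N k where N: "\<forall>v. qf n (crow v 0) \<noteq> 0 \<longrightarrow>
        qf n (crow v 0) ^ k * ev (\<lambda>ij. (g * refl_mat n (crow v 0)) $$ ij) p = ev v N"
      unfolding ratl_def by blast
    show ?thesis
    proof (intro exI[of _ N] conjI allI impI)
      define v where "v = (\<lambda>(i :: nat, a). c a)"
      have v: "crow v 0 = c" by (simp add: v_def crow_def)
      have "ev v N = qf n c ^ k * ev (\<lambda>ij. (g * refl_mat n c) $$ ij) p"
        using N[rule_format, of v] c(1) unfolding v by simp
      then have "ev v N \<noteq> 0" using c(1) p(2) by simp
      then show "N \<noteq> 0" by (auto simp: eval_simps)
      fix v assume v: "qf n (crow v 0) \<noteq> 0" "ev v N \<noteq> 0"
      then have "ev (\<lambda>ij. (g * refl_mat n (crow v 0)) $$ ij) p \<noteq> 0" using N by force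
      then show "g * refl_mat n (crow v 0) \<in> A"
        unfolding P mat_zero_locus_def using p(1) mult_carrier_mat[OF gc refl_mat_carrier] by blast
    qed
  qed
  have "connectedin (zariski_topology n) ?S"
    unfolding connectedin
  proof (intro conjI notI)
    show "?S \<subseteq> topspace (zariski_topology n)" using SC top by blast
    assume "\<exists>E1 E2. openin (zariski_topology n) E1 \<and> openin (zariski_topology n) E2 \<and> ?S \<subseteq> E1 \<union> E2 \<and>
      E1 \<inter> E2 \<inter> ?S = {} \<and> E1 \<inter> ?S \<noteq> {} \<and> E2 \<inter> ?S \<noteq> {}"
    then obtain E1 E2 where E: "zariski_open n E1" "zariski_open n E2" "E1 \<inter> E2 \<inter> ?S = {}"
      "E1 \<inter> ?S \<noteq> {}" "E2 \<inter> ?S \<noteq> {}"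
      unfolding openin_zariski by blast
    obtain N1 where N1: "N1 \<noteq> 0" "\<forall>v. qf n (crow v 0) \<noteq> 0 \<longrightarrow> ev v N1 \<noteq> 0 \<longrightarrow> g * refl_mat n (crow v 0) \<in> E1"
      using nonempty[OF E(1,4)] by blast
    obtain N2 where N2: "N2 \<noteq> 0" "\<forall>v. qf n (crow v 0) \<noteq> 0 \<longrightarrow> ev v N2 \<noteq> 0 \<longrightarrow> g * refl_mat n (crow v 0) \<in> E2"
      using nonempty[OF E(2,5)] by blast
    let ?q = "quad_form n (gvec n 0) :: (nat \<times> nat, 'k) mpoly"
    have "ev (\<lambda>(i, a). pair 0 1 1 a) ?q = qf n (pair 0 1 1)"
      by (simp add: eval_quad_form[OF comm_ring_hom_id] crow_def)
    also have "\<dots> = 1" using nu_pos by (simp add: qf_pair)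
    finally have "?q \<noteq> 0" by (auto simp: eval_simps)
    then have "?q * N1 * N2 \<noteq> 0" using N1(1) N2(1) by simp
    then obtain v where "ev v (?q * N1 * N2) \<noteq> 0" using exists_nonroot[OF inf] by blast
    then have "qf n (crow v 0) \<noteq> 0" "ev v N1 \<noteq> 0" "ev v N2 \<noteq> 0"
      by (auto simp: eval_simps eval_quad_form[OF comm_ring_hom_id])
    then show False using N1(2) N2(2) E(3) by blast
  qed
  then show ?thesis using S by (simp add: connectedin_subtopology)
qed

section \<open>Products of reflections in the identity component\<close>

lemma special_orthogonal_subset: "special_orthogonal_group n \<subseteq> (orthogonal_group n :: 'k mat set)"
proof -
  have "special_orthogonal_group n \<subseteq>
      topspace (subtopology (zariski_topology n) (orthogonal_group n :: 'k mat set))"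
    unfolding special_orthogonal_group_def by (rule connected_component_of_subset_topspace)
  then show ?thesis by (simp add: topspace_subtopology)
qed

lemma special_orthogonalI:
  assumes "connectedin (subtopology (zariski_topology n) (orthogonal_group n)) S" "g \<in> S" "h \<in> S"
    and "g \<in> special_orthogonal_group n"
  shows "h \<in> (special_orthogonal_group n :: 'k mat set)"
proof -
  have "connected_component_of (subtopology (zariski_topology n) (orthogonal_group n)) g h"
    unfolding connected_component_of_def using assms by blast
  then show ?thesis
    using assms(4) unfolding special_orthogonal_group_def by (auto intro: connected_component_of_trans)
qed

lemma one_special_orthogonal: "1\<^sub>m n \<in> (special_orthogonal_group n :: 'k mat set)"
proof -
  have "zariski_open n (carrier_mat n n :: 'k mat set)"
    unfolding zariski_open_def mat_zero_locus_def by (rule exI[of _ "{1}"]) (auto simp: eval_simps)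
  then have "carrier_mat n n \<subseteq> topspace (zariski_topology n :: 'k mat topology)"
    by (metis openin_subset openin_zariski)
  then have "1\<^sub>m n \<in> topspace (subtopology (zariski_topology n) (orthogonal_group n :: 'k mat set))"
    using one_orthogonal by (auto simp: topspace_subtopology)
  then show ?thesis
    unfolding special_orthogonal_group_def by (simp add: connected_component_of_refl)
qed

text \<open>The connected family of all \<open>g * refl_mat n c * refl_mat n e\<close> contains
  \<open>g\<close>, at \<open>e = c\<close>, and the given element, at \<open>e = d\<close>.\<close>

lemma special_orthogonal_refl_refl:
  assumes g: "g \<in> special_orthogonal_group n" and c: "qf n c \<noteq> (0::'k)" and d: "qf n d \<noteq> 0"
  shows "g * refl_mat n c * refl_mat n d \<in> special_orthogonal_group n"
proof -
  have go: "g \<in> orthogonal_group n" using g special_orthogonal_subset by blast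
  note gc = orthogonal_groupD(1)[OF go]
  have gr: "g * refl_mat n c \<in> orthogonal_group n" by (rule orthogonal_mult[OF go refl_mat_orthogonal[OF two c]])
  have "g * refl_mat n c * refl_mat n c = g * (refl_mat n c * refl_mat n c)"
    using gc by (intro assoc_mult_mat[of _ n n _ n _ n]) auto
  also have "\<dots> = g" using gc by (simp add: refl_mat_square[OF two c])
  finally have eq: "g * refl_mat n c * refl_mat n c = g" .
  show ?thesis
  proof (rule special_orthogonalI[OF connected_refl_family[OF gr] _ _ g])
    show "g \<in> {g * refl_mat n c * refl_mat n e | e. qf n e \<noteq> 0}"
      by (rule CollectI, rule exI[of _ c], rule conjI[OF eq[symmetric] c])
    show "g * refl_mat n c * refl_mat n d \<in> {g * refl_mat n c * refl_mat n e | e. qf n e \<noteq> 0}" using d by blast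
  qed
qed

text \<open>For an odd product the induction carries along that any one further reflection leads
  into \<open>SO(n)\<close>.\<close>

lemma even_reflprod_special:
  "reflprod n b (g :: 'k mat) \<Longrightarrow>
    (if b then \<forall>c. qf n c \<noteq> 0 \<longrightarrow> g * refl_mat n c \<in> special_orthogonal_group n
     else g \<in> special_orthogonal_group n)"
proof (induction rule: reflprod.induct)
  case one
  then show ?case by (simp add: one_special_orthogonal)
next
  case (step b g c)
  then show ?case using special_orthogonal_refl_refl[of g c] by (cases b) auto
qed

lemma odd_reflprod_special:
  assumes n: "n = 2 * \<nu> + 1"
  shows "reflprod n b (g :: 'k mat) \<Longrightarrow> g \<in> special_orthogonal_group n"
proof (induction rule: reflprod.induct)
  case one
  then show ?case by (rule one_special_orthogonal)
next
  case (step b g c)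
  have go: "g \<in> orthogonal_group n" using step.IH special_orthogonal_subset by blast
  note gc = orthogonal_groupD(1)[OF go]
  define z :: "nat \<Rightarrow> 'k" where "z = (\<lambda>b. if b = 2 * \<nu> then 1 else 0)"
  have qz: "qf n z \<noteq> 0" using n by (simp add: qf_def z_def)
  have bz: "bf n x z = 0" for x by (simp add: bf_nu z_def)
  have "refl_mat n z = 1\<^sub>m n"
    by (rule mat_eqI_mv[of _ n]) (simp_all add: mv_refl_mat mv_one reflect_def bz)
  then have "g = g * refl_mat n z" using gc by simp
  then show ?case
    using special_orthogonalI[OF connected_refl_family[OF go] _ _ step.IH] qz step.hyps(2) by blast
qed

theorem odd_special_orthogonal_invariants:
  "n = 2 * \<nu> + 1 \<Longrightarrow> invariant_field (special_orthogonal_group n) n m = F"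
  by (rule invariants_eq_F[OF special_orthogonal_subset]) (rule odd_reflprod_special)

end


section \<open>The action of a reflection on \<open>\<Delta>\<close>\<close>

text \<open>The matrix is a Schur complement in the bordered matrix \<open>?M\<close>, whose
  determinant is computed by eliminating with \<open>?L\<close> and with \<open>?U\<close>. The
  latter multiplies the first column by \<open>\<alpha>\<close> to avoid a division, whence the
  extra factor.\<close>

lemma det_rank_one_update:
  fixes \<alpha> :: "'a::idom"
  shows "det (mat N N (\<lambda>(a, b). (if a = b then \<alpha> else 0) - c a * d b)) * \<alpha> = \<alpha> ^ N * (\<alpha> - (\<Sum>a<N. d a * c a))"
proof -
  let ?R = "mat N N (\<lambda>(a, b). (if a = b then \<alpha> else 0) - c a * d b)"
  let ?one = "mat 1 1 (\<lambda>_. 1 :: 'a)" and ?d = "mat 1 N (\<lambda>(_, b). d b)" and ?c = "mat N 1 (\<lambda>(a, _). c a)"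
  let ?A = "\<alpha> \<cdot>\<^sub>m 1\<^sub>m N"
  let ?M = "four_block_mat ?one ?d ?c ?A"
  let ?L = "four_block_mat ?one (0\<^sub>m 1 N) (- ?c) (1\<^sub>m N)"
  let ?U = "four_block_mat (mat 1 1 (\<lambda>_. \<alpha>)) (0\<^sub>m 1 N) (- ?c) (1\<^sub>m N)"
  have M: "?M \<in> carrier_mat (1 + N) (1 + N)" and L: "?L \<in> carrier_mat (1 + N) (1 + N)"
    and U: "?U \<in> carrier_mat (1 + N) (1 + N)" by (auto intro!: four_block_carrier_mat)
  have "?L * ?M = four_block_mat ?one ?d (0\<^sub>m N 1) ?R"
    by (subst mult_four_block_mat[of _ 1 1 _ N _ N _ _ 1 _ N])
      (auto intro!: cong_four_block_mat eq_matI simp: scalar_prod_def)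
  then have 1: "det ?L * det ?M = det ?R"
    using det_mult[OF L M] det_four_block_mat_lower_left_zero[of ?one 1 ?d N "0\<^sub>m N 1" ?R]
    by (simp add: det_single)
  have "?M * ?U = four_block_mat (mat 1 1 (\<lambda>_. \<alpha> - (\<Sum>a<N. d a * c a))) ?d (0\<^sub>m N 1) ?A"
    by (subst mult_four_block_mat[of _ 1 1 _ N _ N _ _ 1 _ N])
      (auto intro!: cong_four_block_mat eq_matI
        simp: scalar_prod_def sum_negf atLeast0LessThan if_distrib[of "\<lambda>x. _ * x"] if_distrib[of "\<lambda>x. x * _"] mult.commute cong: if_cong)
  then have 2: "det ?M * det ?U = (\<alpha> - (\<Sum>a<N. d a * c a)) * \<alpha> ^ N"
    using det_mult[OF M U] det_four_block_mat_lower_left_zero[of "mat 1 1 (\<lambda>_. \<alpha> - (\<Sum>a<N. d a * c a))" 1 ?d N "0\<^sub>m N 1" ?A]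
    by (simp add: det_single)
  have 3: "det ?L = 1" "det ?U = \<alpha>"
    using det_four_block_mat_upper_right_zero[of ?one 1 "0\<^sub>m 1 N" N "- ?c" "1\<^sub>m N"]
      det_four_block_mat_upper_right_zero[of "mat 1 1 (\<lambda>_. \<alpha>)" 1 "0\<^sub>m 1 N" N "- ?c" "1\<^sub>m N"]
    by (simp_all add: det_single)
  show ?thesis using 1 2 3 by (simp add: mult.commute)
qed

section \<open>Integer polynomials and their reduction modulo 2\<close>

lemma lookup_poly_map:
  "f 0 = 0 \<Longrightarrow> Poly_Mapping.lookup (Poly_Mapping.map f p) e = f (Poly_Mapping.lookup p e)"
  by (simp add: Poly_Mapping.map.rep_eq when_def)

lemma eval_map_of_int:
  fixes p :: "('x, int) mpoly" and v :: "'x \<Rightarrow> 'a::comm_ring_1"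
  shows "poly_eval (\<lambda>c. c) v (Poly_Mapping.map of_int p) = poly_eval of_int v p"
proof -
  let ?p = "Poly_Mapping.map of_int p :: ('x, 'a) mpoly"
  have l: "Poly_Mapping.lookup ?p e = of_int (Poly_Mapping.lookup p e)" for e
    by (simp add: lookup_poly_map)
  then have "Poly_Mapping.keys ?p \<subseteq> Poly_Mapping.keys p"
    by (auto simp: in_keys_iff simp del: lookup_not_eq_zero_eq_in_keys)
  then have "poly_eval (\<lambda>c. c) v ?p =
      (\<Sum>e\<in>Poly_Mapping.keys p. of_int (Poly_Mapping.lookup p e) * mon_eval v e)"
    by (subst comm_ring_hom.poly_eval_superset[OF comm_ring_hom_id]) (simp_all add: l)
  then show ?thesis by (simp add: poly_eval_def)
qed

lemma eval_B_int:
  "comm_ring_hom h \<Longrightarrow> poly_eval h s (B_int \<nu> i j) = bf (2 * \<nu>) (crow s i) (crow s j)"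
  by (simp add: B_int_def bf_def crow_def comm_ring_hom.poly_eval_hom comm_ring_hom.poly_eval_Var)

lemma eval_hafnian:
  "comm_ring_hom h \<Longrightarrow> poly_eval h s (hafnian \<nu> B) = hafnian \<nu> (\<lambda>i j. poly_eval h s (B i j))"
  by (simp add: hafnian_def comm_ring_hom.poly_eval_hom)

lemma hafnian_scale: "hafnian \<nu> (\<lambda>i j. e * B i j) = e ^ \<nu> * hafnian \<nu> B"
  by (simp add: hafnian_def prod.distrib sum_distrib_left)

lemma double_cancel:
  fixes p q :: "('x, int) mpoly"
  assumes "2 * p = 2 * q"
  shows "p = q"
proof (rule poly_mapping_eqI)
  fix e
  have "Poly_Mapping.lookup (p + p) e = Poly_Mapping.lookup (q + q) e"
    using assms unfolding mult_2 by (rule arg_cong)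
  then show "Poly_Mapping.lookup p e = Poly_Mapping.lookup q e" unfolding lookup_add by linarith
qed

abbreviation D_int :: "nat \<Rightarrow> (nat \<times> nat, int) mpoly" where
  "D_int \<nu> \<equiv> det_poly (2 * \<nu>) [1..<2 * \<nu> + 1]"

lemma vars_hafnian_B_int: "vars (hafnian \<nu> (B_int \<nu>)) \<subseteq> {1..2 * \<nu>} \<times> {..<2 * \<nu>}"
  unfolding hafnian_def
proof (intro vars_sum vars_prod)
  fix s t assume s: "s \<in> pairings \<nu>" and t: "t \<in> {1..\<nu>}"
  then have p: "s permutes {1..2 * \<nu>}" by (simp add: pairings_def)
  have in1: "s (2 * t - 1) \<in> {1..2 * \<nu>}" "s (2 * t) \<in> {1..2 * \<nu>}"
    using t by (auto simp only: permutes_in_image[OF p], auto)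
  then show "vars (B_int \<nu> (s (2 * t - 1)) (s (2 * t))) \<subseteq> {1..2 * \<nu>} \<times> {..<2 * \<nu>}"
    unfolding B_int_def by (intro vars_sum vars_closed) (simp_all del: atLeastAtMost_iff)
qed

lemma vars_D_int: "vars (det_poly (2 * \<nu>) [1..<2 * \<nu> + 1]) \<subseteq> {1..2 * \<nu>} \<times> {..<2 * \<nu>}"
  using vars_det_poly[of "[1..<2 * \<nu> + 1]" "2 * \<nu>"] by (simp add: atLeastLessThanSuc_atLeastAtMost del: upt_Suc)

text \<open>Over the integers \<open>b(c, c) = 2 q(c)\<close> in even dimension, so this is the
  reflection in \<open>c\<close> multiplied by \<open>q(c)\<close>; it scales the form by the square
  of \<open>q(c)\<close>.\<close>

lemma bf_scaled_reflect:
  assumes "bf n c c = 2 * q"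
  shows "bf n (\<lambda>a. q * x a - bf n x c * c a) (\<lambda>a. q * y a - bf n y c * c a) = q\<^sup>2 * bf n x y"
proof -
  have lin: "bf n (\<lambda>a. q * x a - bf n x c * c a) z = q * bf n x z - bf n x c * bf n c z" for x z
    by (simp only: bf_lin)
  have 1: "bf n x (\<lambda>a. q * y a - bf n y c * c a) = q * bf n x y - bf n y c * bf n x c"
    unfolding bf_sym[of n x] lin bf_sym[of n x y] bf_sym[of n x c] ..
  have 2: "bf n c (\<lambda>a. q * y a - bf n y c * c a) = - (q * bf n y c)"
    unfolding bf_sym[of n c "\<lambda>a. q * y a - bf n y c * c a"] lin assms by (simp add: algebra_simps)
  show ?thesis unfolding lin 1 2 by (simp add: algebra_simps power2_eq_square)
qed

context orth_inv
begin

text \<open>Over \<open>k\<close> the hafnian of the \<open>B\<close> equals \<open>D\<close>, so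
  every coefficient of the difference is 0 in \<open>k\<close>, that is, even. Halving the
  coefficients gives the polynomial that the definition describes.\<close>

lemma Delta_int_eq: "2 * Delta_int \<nu> = hafnian \<nu> (B_int \<nu>) - D_int \<nu>"
proof -
  let ?X = "hafnian \<nu> (B_int \<nu>) - D_int \<nu>"
  have "poly_eval (of_int :: int \<Rightarrow> 'k) v ?X = 0" for v
  proof -
    have "poly_eval (of_int :: int \<Rightarrow> 'k) v (D_int \<nu>) = hafnian \<nu> (\<lambda>i j. bf (2 * \<nu>) (crow v i) (crow v j))"
    proof -
      have "mat (2 * \<nu>) (2 * \<nu>) (\<lambda>(a, j). v ([1..<2 * \<nu> + 1] ! j, a)) =
          mat (2 * \<nu>) (2 * \<nu>) (\<lambda>(a, j). crow v (Suc j) a)"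
        by (intro eq_matI) (auto simp: crow_def simp del: upt_Suc)
      then show ?thesis
        using hafnian_eq_det[OF two, of \<nu> "crow v"]
        by (subst eval_det_poly[OF of_int_hom.comm_ring_hom_axioms]) simp_all
    qed
    then show ?thesis
      by (simp add: comm_ring_hom.poly_eval_diff[OF of_int_hom.comm_ring_hom_axioms]
          eval_hafnian[OF of_int_hom.comm_ring_hom_axioms] eval_B_int[OF of_int_hom.comm_ring_hom_axioms])
  qed
  then have "Poly_Mapping.map of_int ?X = (0 :: (nat \<times> nat, 'k) mpoly)"
    by (intro mpoly_ext[OF inf]) (simp add: eval_map_of_int eval_simps)
  then have zero: "(of_int (Poly_Mapping.lookup ?X e) :: 'k) = 0" for e
    using lookup_poly_map[of "of_int :: int \<Rightarrow> 'k" ?X e] by simp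
  have even: "even (Poly_Mapping.lookup ?X e)" for e
  proof (rule ccontr)
    assume "odd (Poly_Mapping.lookup ?X e)"
    then obtain y where "Poly_Mapping.lookup ?X e = 2 * y + 1" by (elim oddE)
    then have "(of_int (2 * y + 1) :: 'k) = 0" using zero[of e] by (simp only:)
    then show False using two by simp
  qed
  define P where "P = Poly_Mapping.map (\<lambda>c. c div 2) ?X"
  have "2 * P = ?X"
  proof (rule poly_mapping_eqI)
    fix e
    have "Poly_Mapping.lookup P e = Poly_Mapping.lookup ?X e div 2"
      unfolding P_def by (rule lookup_poly_map) simp
    then show "Poly_Mapping.lookup (2 * P) e = Poly_Mapping.lookup ?X e"
      using even[of e] unfolding mult_2 lookup_add by (simp only: mult_2[symmetric] dvd_mult_div_cancel)
  qed
  then have "2 * (THE P. 2 * P = ?X) = ?X"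
    by (rule theI) (rule double_cancel, simp only: \<open>2 * P = ?X\<close>)
  then show ?thesis unfolding Delta_int_def hafnian_def .
qed

lemma vars_Delta_int: "vars (Delta_int \<nu>) \<subseteq> {1..2 * \<nu>} \<times> {..<2 * \<nu>}"
proof -
  have "Poly_Mapping.lookup (2 * Delta_int \<nu>) e = 2 * Poly_Mapping.lookup (Delta_int \<nu>) e" for e
    unfolding mult_2 lookup_add ..
  then have "Poly_Mapping.keys (Delta_int \<nu>) = Poly_Mapping.keys (2 * Delta_int \<nu>)"
    by (auto simp: in_keys_iff simp del: lookup_not_eq_zero_eq_in_keys)
  then have "vars (Delta_int \<nu>) = vars (2 * Delta_int \<nu>)" by (simp add: vars_def)
  then show ?thesis
    unfolding Delta_int_eq using vars_closed(2)[OF vars_hafnian_B_int vars_D_int] by simp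
qed

text \<open>The reflection in \<open>c\<close>, multiplied by \<open>q(c)\<close> to clear the denominator, over the integers; \<open>c\<close> is
  the vector with index 0.\<close>

definition refl_int :: "nat \<times> nat \<Rightarrow> (nat \<times> nat, int) mpoly" where
  "refl_int = (\<lambda>(i, a). qf (2 * \<nu>) (\<lambda>b. Var (0, b)) * Var (i, a) -
     bf (2 * \<nu>) (\<lambda>b. Var (i, b)) (\<lambda>b. Var (0, b)) * Var (0, a))"

text \<open>The determinant of a reflection is \<open>-1\<close> over the integers, so it maps \<open>(H - D) / 2\<close> to
  \<open>(H + D) / 2 = (H - D) / 2 + D\<close>, where \<open>H\<close> is the sum over the pairings.\<close>

lemma Delta_int_refl:
  "poly_eval Const refl_int (Delta_int \<nu>) =
    qf (2 * \<nu>) (\<lambda>b. Var (0, b)) ^ (2 * \<nu>) * (Delta_int \<nu> + D_int \<nu>)"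
proof (rule double_cancel)
  note h = comm_ring_hom_Const
  let ?N = "2 * \<nu>"
  define c :: "nat \<Rightarrow> (nat \<times> nat, int) mpoly" where "c = (\<lambda>b. Var (0, b))"
  define q where "q = qf ?N c"
  define V :: "nat \<Rightarrow> nat \<Rightarrow> (nat \<times> nat, int) mpoly" where "V i = (\<lambda>b. Var (i, b))" for i
  have crow: "crow refl_int i = (\<lambda>a. q * V i a - bf ?N (V i) c * c a)" for i
    by (simp add: crow_def refl_int_def q_def c_def V_def)
  have cc: "bf ?N c c = 2 * q"
    unfolding bf_def q_def qf_def mult_2 sum.distrib by (simp add: mult.commute)
  have B: "bf ?N (crow refl_int i) (crow refl_int j) = q\<^sup>2 * bf ?N (V i) (V j)" for i j
    unfolding crow using bf_scaled_reflect[OF cc] .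
  have B': "B_int \<nu> i j = bf ?N (V i) (V j)" for i j by (simp add: B_int_def bf_def V_def)
  have haf: "poly_eval Const refl_int (hafnian \<nu> (B_int \<nu>)) = q ^ ?N * hafnian \<nu> (B_int \<nu>)"
    unfolding eval_hafnian[OF h] eval_B_int[OF h] B hafnian_scale
    unfolding B'[abs_def] power_mult ..
  define ks where "ks = [1..<?N + 1]"
  have len: "length ks = ?N" by (simp add: ks_def del: upt_Suc)
  have D: "D_int \<nu> = det (mat ?N ?N (\<lambda>(a, j). V (ks ! j) a))"
    using eval_det_poly[OF h, of ks ?N Var] len by (simp add: poly_eval_Const_Var V_def ks_def del: upt_Suc)
  \<comment> \<open>The matrix of the scaled reflection: a scalar matrix minus the product of the
    column \<open>c\<close> and the row that represents the polar form with
    \<open>c\<close>.\<close>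
  let ?R = "mat ?N ?N (\<lambda>(a, b). (if a = b then q else 0) - c a * c (conj_idx \<nu> b))"
  have "poly_eval Const refl_int (D_int \<nu>) = det (mat ?N ?N (\<lambda>(a, j). crow refl_int (ks ! j) a))"
    unfolding ks_def[symmetric] eval_det_poly[OF h len] crow_def ..
  also have "mat ?N ?N (\<lambda>(a, j). crow refl_int (ks ! j) a) = ?R * mat ?N ?N (\<lambda>(a, j). V (ks ! j) a)"
  proof (rule eq_matI)
    fix a j assume "a < dim_row (?R * mat ?N ?N (\<lambda>(a, j). V (ks ! j) a))" "j < dim_col (?R * mat ?N ?N (\<lambda>(a, j). V (ks ! j) a))"
    then have aj: "a < ?N" "j < ?N" by auto
    let ?x = "V (ks ! j)"
    have "(?R * mat ?N ?N (\<lambda>(a, j). V (ks ! j) a)) $$ (a, j) =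
        (\<Sum>b<?N. ((if a = b then q else 0) - c a * c (conj_idx \<nu> b)) * ?x b)"
      using aj by (simp add: scalar_prod_def atLeast0LessThan del: upt_Suc)
    also have "\<dots> = (\<Sum>b<?N. (if a = b then q * ?x b else 0) - c a * (?x b * c (conj_idx \<nu> b)))"
      by (intro sum.cong refl) (simp add: algebra_simps)
    also have "\<dots> = q * ?x a - c a * bf ?N ?x c"
      unfolding sum_subtractf sum_distrib_left[symmetric] bf_conj_idx using aj by simp
    also have "\<dots> = crow refl_int (ks ! j) a" unfolding crow by (simp add: mult.commute)
    finally show "mat ?N ?N (\<lambda>(a, j). crow refl_int (ks ! j) a) $$ (a, j) =
        (?R * mat ?N ?N (\<lambda>(a, j). V (ks ! j) a)) $$ (a, j)" using aj by simp
  qed auto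
  also have "det \<dots> = det ?R * D_int \<nu>" unfolding D by (rule det_mult[of _ ?N]) auto
  also have "det ?R = - (q ^ ?N)"
  proof -
    have "(\<Sum>a<?N. c (conj_idx \<nu> a) * c a) = bf ?N c c" unfolding bf_conj_idx by (simp add: mult.commute)
    \<comment> \<open>The sign of the determinant has its origin here: \<open>b(c, c) = 2 q\<close>
      over the integers, and \<open>q - 2 q = - q\<close>.\<close>
    then have "det ?R * q = q ^ ?N * (q - 2 * q)"
      using det_rank_one_update[of ?N q c "\<lambda>b. c (conj_idx \<nu> b)"] by (simp add: cc)
    also have "\<dots> = - (q ^ ?N) * q" by (simp add: algebra_simps)
    finally have "det ?R * q = - (q ^ ?N) * q" .
    moreover have "q \<noteq> 0"
    proof -
      have "poly_eval (of_int :: int \<Rightarrow> 'k) (\<lambda>(i, a). pair 0 1 1 a) q = qf ?N (pair 0 1 1)"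
        by (simp add: q_def c_def eval_qf[OF of_int_hom.comm_ring_hom_axioms] comm_ring_hom.poly_eval_Var[OF of_int_hom.comm_ring_hom_axioms])
      also have "\<dots> = (\<Sum>t<\<nu>. if t = 0 then 1 else 0)"
      proof -
        have "pair 0 1 1 t * pair 0 1 (1 :: 'k) (\<nu> + t) = (if t = 0 then 1 else 0)" if "t < \<nu>" for t
          using that by (simp add: pair_def)
        then show ?thesis unfolding qf_def by (simp del: sum.delta sum.delta')
      qed
      also have "\<dots> = 1" using nu_pos by (subst sum.delta) simp_all
      finally show ?thesis using comm_ring_hom.poly_eval_0[OF of_int_hom.comm_ring_hom_axioms] by force
    qed
    ultimately show ?thesis unfolding mult_cancel_right by blast
  qed
  finally have det: "poly_eval Const refl_int (D_int \<nu>) = - (q ^ ?N) * D_int \<nu>" .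
  have "2 * poly_eval Const refl_int (Delta_int \<nu>) = poly_eval Const refl_int (2 * Delta_int \<nu>)"
    unfolding mult_2 comm_ring_hom.poly_eval_add[OF h] ..
  also have "\<dots> = q ^ ?N * (hafnian \<nu> (B_int \<nu>) + D_int \<nu>)"
    unfolding Delta_int_eq comm_ring_hom.poly_eval_diff[OF h] haf det by (simp add: algebra_simps)
  also have "hafnian \<nu> (B_int \<nu>) = 2 * Delta_int \<nu> + D_int \<nu>" by (simp add: Delta_int_eq)
  finally show "2 * poly_eval Const refl_int (Delta_int \<nu>) =
      2 * (qf ?N (\<lambda>b. Var (0, b)) ^ ?N * (Delta_int \<nu> + D_int \<nu>))"
    by (simp add: q_def c_def algebra_simps)
qed

definition Delta_k :: "(nat \<times> nat, 'k) mpoly" where "Delta_k = Poly_Mapping.map of_int (Delta_int \<nu>)"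

definition D_k :: "(nat \<times> nat, 'k) mpoly" where "D_k = det_poly (2 * \<nu>) [1..<2 * \<nu> + 1]"

text \<open>The centre \<open>c\<close> is substituted for the vector with index 0, which does not
  occur in \<open>\<Delta>\<close> and \<open>D\<close>. As \<open>q(c) = 1\<close>, the scaled
  reflection is the reflection itself and the power of \<open>q\<close> is 1.\<close>

lemma Delta_k_refl_unit:
  assumes n: "n = 2 * \<nu>" and c: "qf n c = 1"
  shows "ev (act_pt n (refl_mat n c) v) Delta_k = ev v Delta_k + ev v D_k"
proof -
  note h = of_int_hom.comm_ring_hom_axioms
  have len: "length [1..<2 * \<nu> + 1] = 2 * \<nu>" by (simp del: upt_Suc)
  let ?e = "poly_eval (of_int :: int \<Rightarrow> 'k)"
  define v0 where "v0 = (\<lambda>(i, a). if i = 0 then c a else v (i, a))"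
  have c0: "(\<lambda>b. v0 (0, b)) = c" by (simp add: v0_def)
  have Ve: "?e v0 (Var x) = v0 x" for x by (rule comm_ring_hom.poly_eval_Var[OF h])
  have val: "?e v0 (refl_int (i, a)) = act_pt n (refl_mat n c) v (i, a)" if "1 \<le> i" "a < n" for i a
  proof -
    have row: "(\<lambda>b. v0 (i, b)) = crow v i" using that by (simp add: v0_def crow_def)
    have "?e v0 (refl_int (i, a)) = qf n c * v0 (i, a) - bf n (crow v i) c * v0 (0, a)"
      unfolding refl_int_def prod.case n[symmetric]
      by (simp add: comm_ring_hom.poly_eval_diff[OF h] comm_ring_hom.poly_eval_mult[OF h]
          eval_qf[OF h] eval_bf[OF h] Ve c0 row)
    then show ?thesis using that c
      by (simp add: act_pt_def mv_refl_mat reflect_def v0_def) (simp add: crow_def)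
  qed
  have vars: "1 \<le> fst x \<and> snd x < n" if "x \<in> vars (Delta_int \<nu>) \<or> x \<in> vars (D_int \<nu>)" for x
    using that vars_Delta_int vars_D_int n by fastforce
  have v0: "v0 x = v x" if "x \<in> vars (Delta_int \<nu>) \<or> x \<in> vars (D_int \<nu>)" for x
    using vars[OF that] unfolding v0_def by (cases x) simp
  have "ev (act_pt n (refl_mat n c) v) Delta_k = ?e (act_pt n (refl_mat n c) v) (Delta_int \<nu>)"
    by (simp add: Delta_k_def eval_map_of_int)
  also have "\<dots> = ?e (\<lambda>x. ?e v0 (refl_int x)) (Delta_int \<nu>)"
    by (rule poly_eval_cong) (use vars val in \<open>metis prod.collapse\<close>)
  also have "\<dots> = ?e v0 (poly_eval Const refl_int (Delta_int \<nu>))"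
    by (rule comm_ring_hom.poly_eval_subst[OF h, symmetric])
  also have "\<dots> = ?e v0 (Delta_int \<nu>) + ?e v0 (D_int \<nu>)"
    unfolding Delta_int_refl n[symmetric] comm_ring_hom.poly_eval_mult[OF h] comm_ring_hom.poly_eval_power[OF h]
      comm_ring_hom.poly_eval_add[OF h] eval_qf[OF h] Ve c0 c by simp
  also have "?e v0 (Delta_int \<nu>) = ?e v (Delta_int \<nu>)"
    by (rule poly_eval_cong) (rule v0, simp)
  also have "?e v0 (D_int \<nu>) = ?e v (D_int \<nu>)"
    by (rule poly_eval_cong) (rule v0, simp)
  also have "?e v (Delta_int \<nu>) = ev v Delta_k" by (simp add: Delta_k_def eval_map_of_int)
  also have "?e v (D_int \<nu>) = ev v D_k"
    unfolding D_k_def eval_det_poly[OF h len] eval_det_poly[OF comm_ring_hom_id len] ..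
  finally show ?thesis .
qed

lemma refl_mat_scale: "e \<noteq> 0 \<Longrightarrow> refl_mat n (\<lambda>a. e * c a) = refl_mat n (c :: nat \<Rightarrow> 'k)"
proof (rule mat_eqI_mv[of _ n])
  fix x a assume e: "e \<noteq> 0" and a: "a < n"
  have "qf n (\<lambda>a. e * c a) = e\<^sup>2 * qf n c"
    using qf_lin[OF two, of n "\<lambda>_. 0" e c] by simp
  then show "mv n (refl_mat n (\<lambda>a. e * c a)) x a = mv n (refl_mat n c) x a"
    using a e by (simp add: mv_refl_mat reflect_def bf_lin power2_eq_square)
qed simp_all

text \<open>A reflection depends only on the line through its centre, and square roots in
  \<open>k\<close> allow the centre to be rescaled to \<open>q(c) = 1\<close>.\<close>

lemma Delta_k_refl:
  assumes n: "n = 2 * \<nu>" and c: "qf n c \<noteq> 0"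
  shows "ev (act_pt n (refl_mat n c) v) Delta_k = ev v Delta_k + ev v D_k"
proof -
  obtain y where y: "y ^ 2 = qf n c" using nth_root_exists[of 2 "qf n c"] by auto
  then have y0: "inverse y \<noteq> 0" using c by auto
  have "qf n (\<lambda>a. inverse y * c a) = (inverse y)\<^sup>2 * qf n c"
    using qf_lin[OF two, of n "\<lambda>_. 0" "inverse y" c] by simp
  also have "\<dots> = (inverse y * y)\<^sup>2" unfolding y[symmetric] by (simp only: power_mult_distrib)
  also have "inverse y * y = 1" using y0 by simp
  finally have "qf n (\<lambda>a. inverse y * c a) = 1" by (simp only: power_one)
  from Delta_k_refl_unit[OF n this] show ?thesis unfolding refl_mat_scale[OF y0] .
qed

end


section \<open>The even-dimensional special orthogonal group\<close>

text \<open>For each \<open>v\<close> the condition \<open>p(g v) = q(v)\<close> is the polynomial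
  equation \<open>T v\<close> in the entries of \<open>g\<close>. All of them together express
  equality of polynomials, because the field is infinite.\<close>

lemma zariski_open_lin_subst_ne:
  fixes p q :: "(nat \<times> nat, 'k::alg_closed_field) mpoly"
  shows "zariski_open n {g \<in> carrier_mat n n. lin_subst g p \<noteq> q}"
proof -
  define T where "T v = poly_eval Const (\<lambda>(i, a). if a < n then \<Sum>b<n. Var (a, b) * Const (v (i, b)) else Const (v (i, a))) p -
    Const (poly_eval (\<lambda>c. c) v q)" for v
  have T: "poly_eval (\<lambda>c. c) (\<lambda>ij. g $$ ij) (T v) =
      poly_eval (\<lambda>c. c) v (lin_subst g p) - poly_eval (\<lambda>c. c) v q"
    if g: "g \<in> carrier_mat n n" for g :: "'k mat" and v
  proof -
    have "(\<lambda>x. poly_eval (\<lambda>c. c) (\<lambda>ij. g $$ ij) (case x of (i, a) \<Rightarrow>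
        if a < n then \<Sum>b<n. Var (a, b) * Const (v (i, b)) else Const (v (i, a)))) = act_pt n g v"
      by (auto simp: act_pt_def mv_def crow_def eval_simps fun_eq_iff)
    then show ?thesis unfolding T_def eval_lin_subst[OF g] eval_simps by (simp only:)
  qed
  have "{g \<in> carrier_mat n n. lin_subst g p \<noteq> q} = carrier_mat n n - mat_zero_locus n (range T)"
  proof (intro Set.set_eqI iffI)
    fix g assume g: "g \<in> {g \<in> carrier_mat n n. lin_subst g p \<noteq> q}"
    then obtain v where "poly_eval (\<lambda>c. c) v (lin_subst g p) \<noteq> poly_eval (\<lambda>c. c) v q"
      using mpoly_ext[OF alg_closed_infinite] by blast
    then have "poly_eval (\<lambda>c. c) (\<lambda>ij. g $$ ij) (T v) \<noteq> 0" using T[of g v] g by simp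
    then show "g \<in> carrier_mat n n - mat_zero_locus n (range T)"
      using g unfolding mat_zero_locus_def by blast
  next
    fix g assume "g \<in> carrier_mat n n - mat_zero_locus n (range T)"
    then obtain v where "g \<in> carrier_mat n n" "poly_eval (\<lambda>c. c) (\<lambda>ij. g $$ ij) (T v) \<noteq> 0"
      unfolding mat_zero_locus_def by blast
    then show "g \<in> {g \<in> carrier_mat n n. lin_subst g p \<noteq> q}" using T[of g v] by auto
  qed
  then show ?thesis unfolding zariski_open_def by blast
qed

lemma dimension_2I:
  fixes K :: "'a::field set"
  assumes K: "fsub K" and u: "u \<notin> K"
  shows "ring.dimension class_ring 2 K {a + b * u | a b. a \<in> K \<and> b \<in> K}"
proof -
  note R = class_ring.ring_axioms
  have "ring.dimension class_ring 1 K K"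
    by (rule ring.dimension_one[OF R fsub_subfield[OF K]])
  then have "ring.dimension class_ring (Suc 1) K (ring.line_extension class_ring K u K)"
    using u by (intro ring.Suc_dim[OF R]) simp_all
  moreover have "ring.line_extension class_ring K u K = {a + b * u | a b. a \<in> K \<and> b \<in> K}"
    by (rule Set.set_eqI) (auto simp: ring.line_extension_mem_iff[OF R] class_ring_simps add.commute)
  ultimately show ?thesis by (simp add: numeral_2_eq_2)
qed

lemma ratfun_act_field:
  assumes g: "g \<in> carrier_mat n n" "invertible_mat (g :: 'k::field mat)" and f: "f \<in> ratfun_field n m"
  shows "ratfun_act g f \<in> ratfun_field n m"
proof -
  obtain p r where pr: "f = to_fract p / to_fract r" "r \<noteq> 0" "vars p \<subseteq> {1..m} \<times> {..<n}" "vars r \<subseteq> {1..m} \<times> {..<n}"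
    using f unfolding ratfun_field_def by blast
  show ?thesis
    unfolding pr(1) ratfun_act_fraction[OF g pr(2)]
    by (intro fsub_divide[OF fsub_ratfun_field] to_fract_ratfun_field vars_lin_subst[OF _ g(1)] pr(3,4))
qed

context orth_inv
begin

lemma lin_subst_D:
  assumes g: "g \<in> orthogonal_group n"
  shows "lin_subst g D_k = (D_k :: (nat \<times> nat, 'k) mpoly)"
proof (rule mpoly_ext[OF inf])
  fix v :: "nat \<times> nat \<Rightarrow> 'k"
  show "ev v (lin_subst g D_k) = ev v D_k"
    unfolding eval_lin_subst[OF orthogonal_groupD(1)[OF g]] D_k_def hafnian_det_poly[OF comm_ring_hom_id two]
      bf_crow_act_pt bf_orthogonal[OF two g] ..
qed

lemma D_k_nonzero: "D_k \<noteq> 0"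
  unfolding D_k_def by (rule det_poly_nonzero)

text \<open>What all products of reflections fix lies in the field of the generators, and these are
  fixed by \<open>O(n)\<close>.\<close>

lemma invariant_fieldI_reflprod:
  assumes "f \<in> ratfun_field n m" "\<And>b g. reflprod n b g \<Longrightarrow> ratfun_act g f = (f :: 'k ratfun)"
  shows "f \<in> invariant_field (orthogonal_group n) n m"
  unfolding orthogonal_invariants
  by (rule refl_invariants_subset) (use assms gens_inv gens_field reflprod_orthogonal[OF two] in blast)+

lemma vars_Delta_k: "vars Delta_k \<subseteq> {1..2 * \<nu>} \<times> {..<2 * \<nu>}"
proof -
  have "Poly_Mapping.keys Delta_k \<subseteq> Poly_Mapping.keys (Delta_int \<nu>)"
  proof
    fix e assume "e \<in> Poly_Mapping.keys Delta_k"
    then have "(of_int (Poly_Mapping.lookup (Delta_int \<nu>) e) :: 'k) \<noteq> 0"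
      unfolding in_keys_iff Delta_k_def by (subst (asm) lookup_poly_map) simp_all
    then have "Poly_Mapping.lookup (Delta_int \<nu>) e \<noteq> 0" by (intro notI) simp
    then show "e \<in> Poly_Mapping.keys (Delta_int \<nu>)" unfolding in_keys_iff .
  qed
  then have "vars Delta_k \<subseteq> vars (Delta_int \<nu>)" unfolding vars_def by blast
  then show ?thesis using vars_Delta_int by blast
qed

end

locale even_orth_inv = orth_inv n \<nu> m ktype for n \<nu> m and ktype :: "'k::alg_closed_field itself" +
  assumes n_even: "n = 2 * \<nu>"
begin

lemma mpoly_add_self: "p + p = (0 :: (nat \<times> nat, 'k) mpoly)"
  by (rule add_self[OF two_mpoly[OF two]])

lemma lin_subst_Delta:
  "reflprod n b (g :: 'k mat) \<Longrightarrow> lin_subst g Delta_k = (if b then Delta_k + D_k else Delta_k)"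
proof (induction rule: reflprod.induct)
  case one
  show ?case
    by (simp, rule mpoly_ext[OF inf]) (simp add: eval_lin_subst[of _ n] act_pt_one)
next
  case (step b g c)
  let ?r = "refl_mat n c"
  have r: "lin_subst ?r Delta_k = Delta_k + D_k"
    by (rule mpoly_ext[OF inf])
      (simp add: eval_lin_subst[OF refl_mat_carrier] Delta_k_refl[OF n_even step.hyps(2)] eval_simps)
  have "lin_subst (g * ?r) Delta_k = lin_subst ?r (lin_subst g Delta_k)"
    by (rule lin_subst_lin_subst[symmetric, OF reflprod_carrier[OF step.hyps(1)] refl_mat_carrier])
  also have "\<dots> = (if b then Delta_k + D_k + D_k else Delta_k + D_k)"
    unfolding step.IH by (simp add: r lin_subst_D[OF refl_mat_orthogonal[OF two step.hyps(2)]])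
  finally show ?case by (simp add: add.assoc mpoly_add_self)
qed

text \<open>An isometry is not given here as a product of reflections, so its effect on
  \<open>\<Delta>\<close> is read off from an equation: \<open>\<Delta>\<close> and
  \<open>\<Delta> + D\<close> are the roots of a quadratic polynomial whose coefficients
  \<open>g\<close> fixes.\<close>

lemma lin_subst_Delta_cases:
  assumes m: "2 * \<nu> \<le> m" and g: "g \<in> orthogonal_group n"
  shows "lin_subst g Delta_k = Delta_k \<or> lin_subst g Delta_k = Delta_k + D_k"
proof -
  let ?N = "Delta_k * Delta_k + D_k * Delta_k"
  have sub: "{1..2 * \<nu>} \<times> {..<2 * \<nu>} \<subseteq> {1..m} \<times> {..<n}" using m n_even by auto
  have vD: "vars D_k \<subseteq> {1..m} \<times> {..<n}" unfolding D_k_def using vars_D_int sub by (rule subset_trans)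
  have v\<Delta>: "vars Delta_k \<subseteq> {1..m} \<times> {..<n}" using vars_Delta_k sub by (rule subset_trans)
  have "to_fract ?N \<in> invariant_field (orthogonal_group n) n m"
  proof (rule invariant_fieldI_reflprod)
    show "to_fract ?N \<in> ratfun_field n m"
      by (intro to_fract_ratfun_field vars_closed vD v\<Delta>)
    fix b g assume b: "reflprod n b (g :: 'k mat)"
    note gO = reflprod_orthogonal[OF two b]
    have "lin_subst g ?N = ?N"
    proof (cases b)
      case True
      have "lin_subst g ?N = ?N + (D_k * Delta_k + D_k * Delta_k) + (D_k * D_k + D_k * D_k)"
        using True by (simp only: lin_subst_hom lin_subst_Delta[OF b] lin_subst_D[OF gO] if_True) (simp only: algebra_simps)
      then show ?thesis by (simp only: mpoly_add_self add_0_right)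
    next
      case False
      then show ?thesis by (simp only: lin_subst_hom lin_subst_Delta[OF b] lin_subst_D[OF gO] if_False)
    qed
    then show "ratfun_act g (to_fract ?N) = to_fract ?N"
      by (simp only: ratfun_act_to_fract[OF orthogonal_groupD[OF gO]])
  qed
  then have "ratfun_act g (to_fract ?N) = to_fract ?N" using g unfolding invariant_field_def by blast
  then have "lin_subst g ?N = ?N"
    unfolding ratfun_act_to_fract[OF orthogonal_groupD[OF g]] to_fract_eq_iff .
  then have N: "lin_subst g Delta_k * lin_subst g Delta_k + D_k * lin_subst g Delta_k = ?N"
    by (simp only: lin_subst_hom lin_subst_D[OF g])
  have "(lin_subst g Delta_k - Delta_k) * (lin_subst g Delta_k - (Delta_k + D_k)) =
      lin_subst g Delta_k * lin_subst g Delta_k + D_k * lin_subst g Delta_k + ?N -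
      (lin_subst g Delta_k * Delta_k + lin_subst g Delta_k * Delta_k) -
      (D_k * lin_subst g Delta_k + D_k * lin_subst g Delta_k)"
    by (simp only: algebra_simps)
  also have "\<dots> = 0" unfolding N mpoly_add_self by simp
  finally show ?thesis unfolding mult_eq_0_iff right_minus_eq .
qed

lemma special_orthogonal_Delta:
  assumes m: "2 * \<nu> \<le> m" and g: "g \<in> special_orthogonal_group n"
  shows "lin_subst g Delta_k = Delta_k"
proof (rule ccontr)
  assume ne: "lin_subst g Delta_k \<noteq> Delta_k"
  let ?SO = "special_orthogonal_group n :: 'k mat set"
  \<comment> \<open>The sets where one of the equations fails are open. They cover
    \<open>SO(n)\<close> because \<open>D\<close> is nonzero, and they are disjoint on it because
    one of the equations always holds.\<close>
  let ?E1 = "{g \<in> carrier_mat n n. lin_subst g Delta_k \<noteq> Delta_k}"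
  let ?E2 = "{g \<in> carrier_mat n n. lin_subst g Delta_k \<noteq> Delta_k + D_k}"
  have "connectedin (subtopology (zariski_topology n) (orthogonal_group n)) ?SO"
    unfolding special_orthogonal_group_def by (rule connectedin_connected_component_of)
  then have conn: "connectedin (zariski_topology n) ?SO" by (simp add: connectedin_subtopology)
  have op: "openin (zariski_topology n) ?E1" "openin (zariski_topology n) ?E2"
    unfolding openin_zariski by (rule zariski_open_lin_subst_ne)+
  have SOc: "h \<in> carrier_mat n n" if "h \<in> ?SO" for h
    using that special_orthogonal_subset orthogonal_groupD(1) by blast
  have D: "Delta_k \<noteq> Delta_k + D_k" using D_k_nonzero by simp
  have "?SO \<subseteq> ?E1 \<union> ?E2"
  proof
    fix h assume h: "h \<in> ?SO"
    show "h \<in> ?E1 \<union> ?E2" using SOc[OF h] D by (cases "lin_subst h Delta_k = Delta_k") simp_all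
  qed
  moreover have "?E1 \<inter> ?E2 \<inter> ?SO = {}"
    using lin_subst_Delta_cases[OF m] special_orthogonal_subset by blast
  moreover have "?E1 \<inter> ?SO \<noteq> {}" using g SOc ne by blast
  moreover have "1\<^sub>m n \<in> ?E2 \<inter> ?SO"
    using lin_subst_Delta[OF reflprod.one] one_special_orthogonal D by simp
  ultimately show False using conn op unfolding connectedin by blast
qed

text \<open>An odd product is an even one followed by the reflection in \<open>c\<close>, so all odd
  products act alike on an invariant of \<open>SO(n)\<close>.\<close>

lemma special_invariants_reflprod:
  assumes f: "f \<in> invariant_field (special_orthogonal_group n) n m" and b: "reflprod n b (g :: 'k mat)"
    and c: "qf n c \<noteq> 0"
  shows "ratfun_act g f = (if b then ratfun_act (refl_mat n c) f else f)"
proof -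
  let ?r = "refl_mat n c"
  note gO = orthogonal_groupD[OF reflprod_orthogonal[OF two b]]
  note rO = orthogonal_groupD[OF refl_mat_orthogonal[OF two c]]
  have SO: "ratfun_act h f = f" if "h \<in> special_orthogonal_group n" for h
    using f that unfolding invariant_field_def by blast
  show ?thesis
  proof (cases b)
    case True
    have "g * ?r \<in> special_orthogonal_group n" using even_reflprod_special[OF b] True c by simp
    note gr = this
    have "g * ?r * ?r = g * (?r * ?r)"
      using gO by (intro assoc_mult_mat[of _ n n _ n _ n]) auto
    then have "g = g * ?r * ?r" using gO by (simp add: refl_mat_square[OF two c])
    then have "ratfun_act g f = ratfun_act (g * ?r * ?r) f" by (rule arg_cong)
    also have "\<dots> = ratfun_act ?r (ratfun_act (g * ?r) f)"
      by (rule ratfun_act_ratfun_act[symmetric, of _ n])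
        (use rO orthogonal_groupD[OF subsetD[OF special_orthogonal_subset gr]] in blast)+
    finally show ?thesis using True SO[OF gr] by simp
  next
    case False
    then show ?thesis using even_reflprod_special[OF b] SO by simp
  qed
qed

end

section \<open>The quadratic extension\<close>

context even_orth_inv
begin

abbreviation KO :: "'k ratfun set" where "KO \<equiv> invariant_field (orthogonal_group n) n m"

abbreviation KSO :: "'k ratfun set" where "KSO \<equiv> invariant_field (special_orthogonal_group n) n m"

lemma KO_subset_KSO: "KO \<subseteq> KSO"
  unfolding invariant_field_def using special_orthogonal_subset by blast

lemma ratfun_add_self: "x + x = (0 :: 'k ratfun)"
  by (rule add_self[OF two_ratfun[OF two]])

lemma ratfun_Delta_reflprod:
  "reflprod n b (g :: 'k mat) \<Longrightarrow>
    ratfun_act g (to_fract Delta_k) = to_fract Delta_k + (if b then to_fract D_k else 0)"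
  using ratfun_act_to_fract[OF orthogonal_groupD[OF reflprod_orthogonal[OF two]]] lin_subst_Delta by simp

lemma Delta_not_KO: "to_fract Delta_k \<notin> KO"
proof
  assume "to_fract Delta_k \<in> KO"
  have c: "qf n (pair 0 1 1) \<noteq> (0::'k)" using nu_pos by (simp add: qf_pair)
  have "to_fract Delta_k = ratfun_act (refl_mat n (pair 0 1 1)) (to_fract Delta_k)"
    using \<open>to_fract Delta_k \<in> KO\<close> refl_mat_orthogonal[OF two c] unfolding invariant_field_def by force
  also have "\<dots> = to_fract Delta_k + to_fract D_k"
    using ratfun_Delta_reflprod[OF reflprod_refl[OF c]] by simp
  finally show False using D_k_nonzero by simp
qed

lemma Delta_KSO:
  assumes m: "2 * \<nu> \<le> m"
  shows "to_fract Delta_k \<in> KSO"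
proof -
  have "{1..2 * \<nu>} \<times> {..<2 * \<nu>} \<subseteq> {1..m} \<times> {..<n}" using m n_even by auto
  then have "to_fract Delta_k \<in> ratfun_field n m" using vars_Delta_k by (intro to_fract_ratfun_field) blast
  moreover have "ratfun_act g (to_fract Delta_k) = to_fract Delta_k" if "g \<in> special_orthogonal_group n" for g
    using ratfun_act_to_fract[OF orthogonal_groupD[OF subsetD[OF special_orthogonal_subset that]]]
      special_orthogonal_Delta[OF m that] by simp
  ultimately show ?thesis unfolding invariant_field_def by blast
qed

lemma KSO_decomp:
  assumes m: "2 * \<nu> \<le> m" and f: "f \<in> KSO"
  shows "\<exists>a\<in>KO. \<exists>b\<in>KO. f = a + b * to_fract Delta_k"
proof -
  let ?\<Delta> = "to_fract Delta_k :: 'k ratfun" and ?D = "to_fract D_k :: 'k ratfun"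
  have c: "qf n (pair 0 1 1) \<noteq> (0::'k)" using nu_pos by (simp add: qf_pair)
  define r :: "'k mat" where "r = refl_mat n (pair 0 1 1)"
  note rp = reflprod_refl[OF c, folded r_def]
  note rO = orthogonal_groupD[OF reflprod_orthogonal[OF two rp]]
  define f' where "f' = ratfun_act r f"
  have fK: "f \<in> ratfun_field n m" using f unfolding invariant_field_def by blast
  have f'K: "f' \<in> ratfun_field n m" unfolding f'_def by (rule ratfun_act_field[OF rO fK])
  have af: "ratfun_act g f = (if b then f' else f)" if "reflprod n b g" for b g
    using special_invariants_reflprod[OF f that c] by (simp add: f'_def r_def)
  have af': "ratfun_act g f' = (if b then f else f')" if g: "reflprod n b g" for b g
  proof -
    note gO = orthogonal_groupD[OF reflprod_orthogonal[OF two g]]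
    have "ratfun_act g f' = ratfun_act (r * g) f" unfolding f'_def by (rule ratfun_act_ratfun_act[OF rO gO])
    then show ?thesis using af[OF reflprod_mult[OF rp g]] by simp
  qed
  have sub: "{1..2 * \<nu>} \<times> {..<2 * \<nu>} \<subseteq> {1..m} \<times> {..<n}" using m n_even by auto
  have DK: "?D \<in> ratfun_field n m"
    unfolding D_k_def using vars_D_int sub by (intro to_fract_ratfun_field) (rule subset_trans)
  have \<Delta>K: "?\<Delta> \<in> ratfun_field n m" using Delta_KSO[OF m] unfolding invariant_field_def by blast
  have D0: "?D \<noteq> 0" using D_k_nonzero by simp
  \<comment> \<open>If \<open>f = a + b \<Delta>\<close>, then a reflection adds \<open>b D\<close>,
    so that \<open>f + f' = b D\<close>; both sides of the quotient are fixed by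
    reflections.\<close>
  define b where "b = (f + f') / ?D"
  have bK: "b \<in> ratfun_field n m"
    unfolding b_def by (intro fsub_divide[OF fsub_ratfun_field] fsub_add[OF fsub_ratfun_field] fK f'K DK)
  have ab: "ratfun_act g b = b" if g: "reflprod n p g" for p g
  proof -
    note gO = reflprod_orthogonal[OF two g]
    note gG = orthogonal_groupD[OF gO]
    have "ratfun_act g (f + f') = f + f'"
      unfolding ratfun_act_add[OF gG] af[OF g] af'[OF g] by (simp add: add.commute)
    moreover have "ratfun_act g ?D = ?D" by (simp only: ratfun_act_to_fract[OF gG] lin_subst_D[OF gO])
    ultimately show ?thesis
      unfolding b_def divide_inverse by (simp only: ratfun_act_mult[OF gG] ratfun_act_inverse[OF gG])
  qed
  have "f - b * ?\<Delta> \<in> KO"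
  proof (rule invariant_fieldI_reflprod)
    show "f - b * ?\<Delta> \<in> ratfun_field n m"
      by (intro fsub_diff[OF fsub_ratfun_field] fsub_mult[OF fsub_ratfun_field] fK bK \<Delta>K)
    fix p g assume g: "reflprod n p (g :: 'k mat)"
    note gG = orthogonal_groupD[OF reflprod_orthogonal[OF two g]]
    have act: "ratfun_act g (f - b * ?\<Delta>) = (if p then f' else f) - b * (?\<Delta> + (if p then ?D else 0))"
      by (simp only: ratfun_act_diff[OF gG] ratfun_act_mult[OF gG] af[OF g] ab[OF g] ratfun_Delta_reflprod[OF g])
    show "ratfun_act g (f - b * ?\<Delta>) = f - b * ?\<Delta>"
    proof (cases p)
      case True
      have "b * ?D = f + f'" unfolding b_def using D0 by simp
      then have "f' - b * (?\<Delta> + ?D) = f - b * ?\<Delta> - (f + f)" by (simp add: distrib_left)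
      then show ?thesis unfolding act ratfun_add_self using True by simp
    next
      case False
      then show ?thesis unfolding act by simp
    qed
  qed
  moreover have "b \<in> KO" by (rule invariant_fieldI_reflprod[OF bK ab])
  moreover have "f = (f - b * ?\<Delta>) + b * ?\<Delta>" by simp
  ultimately show ?thesis by blast
qed

lemma KSO_eq:
  assumes m: "2 * \<nu> \<le> m"
  shows "KSO = {a + b * to_fract Delta_k | a b. a \<in> KO \<and> b \<in> KO}" (is "_ = ?R")
proof
  show "KSO \<subseteq> ?R" using KSO_decomp[OF m] by blast
  show "?R \<subseteq> KSO"
    using KO_subset_KSO Delta_KSO[OF m] fsub_invariant_field[OF special_orthogonal_subset]
    by (blast intro: fsub_add fsub_mult)
qed

theorem dimension_KSO: "2 * \<nu> \<le> m \<Longrightarrow> ring.dimension class_ring 2 KO KSO"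
  unfolding KSO_eq by (rule dimension_2I[OF fsub_invariant_field[OF subset_refl] Delta_not_KO])

theorem KSO_generated:
  assumes m: "2 * \<nu> \<le> m"
  shows "KSO = generate_field class_ring (KO \<union> {Delta \<nu>})"
proof
  let ?G = "generate_field class_ring (KO \<union> {Delta \<nu>})"
  have \<Delta>: "Delta \<nu> = to_fract Delta_k" by (simp add: Delta_def Delta_k_def)
  have sub: "KO \<union> {Delta \<nu>} \<subseteq> ?G" by (blast intro: generate_field.incl)
  show "KSO \<subseteq> ?G"
    unfolding KSO_eq[OF m] using sub unfolding \<Delta>
    by (blast intro: fsub_add[OF fsub_generate_field] fsub_mult[OF fsub_generate_field])
  show "?G \<subseteq> KSO"
    by (rule generate_field_subset[OF fsub_invariant_field[OF special_orthogonal_subset]])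
      (use KO_subset_KSO Delta_KSO[OF m] \<Delta> in simp)
qed

text \<open>With fewer than \<open>2 \<nu>\<close> vectors there is a reflection that fixes all of them, so that every single
  reflection acts on the vectors like a product of two.\<close>

lemma special_invariants_refl:
  assumes m: "m < 2 * \<nu>" and f: "f \<in> KSO" and c: "qf n c \<noteq> (0::'k)"
  shows "ratfun_act (refl_mat n c) f = f"
proof -
  let ?r = "refl_mat n c"
  note rG = orthogonal_groupD[OF refl_mat_orthogonal[OF two c]]
  obtain P R where PR: "f = to_fract P / to_fract R" "R \<noteq> 0" "vars P \<subseteq> {1..m} \<times> {..<n}" "vars R \<subseteq> {1..m} \<times> {..<n}"
    using f unfolding invariant_field_def ratfun_field_def by blast
  define Y where "Y = lin_subst ?r P * R - P * lin_subst ?r R"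
  have "Y = 0"
  proof (rule ccontr)
    assume "Y \<noteq> 0"
    then obtain b g \<xi> where g: "reflprod n b g" and \<xi>: "normal_upto nv \<xi>" and Y: "ev (act_pt n g \<xi>) Y \<noteq> 0"
      by (rule density)
    have nv: "nv = m" using m by (simp add: nv_def)
    define t where "t = \<nu> - 1"
    have t: "t < \<nu>" using nu_pos by (simp add: t_def)
    \<comment> \<open>The vector \<open>(1, p)\<close> in the last plane is to be nonsingular and
      orthogonal to all \<open>m\<close> normal rows. Only for \<open>m = 2 * \<nu> - 1\<close> does
      a row reach that plane: the last one, with component \<open>(1, a)\<close> and
      \<open>a \<noteq> 0\<close>. The polar form is then \<open>a + p\<close>, which
      \<open>p = - a\<close> makes zero.\<close>
    define p where "p = (if m = 2 * \<nu> - 1 then - \<xi> (m, \<nu> + t) else 1)"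
    let ?d0 = "pair t 1 p"
    have norm: "normal_row i (crow \<xi> i)" if "i \<in> {1..m}" for i
      using \<xi> that unfolding normal_upto_def nv by blast
    have p0: "p \<noteq> 0"
    proof (cases "m = 2 * \<nu> - 1")
      case True
      then have "m \<in> {1..m}" "odd m" "blk m = t" using nu_pos by (auto simp: blk_def t_def)
      then have "\<xi> (m, \<nu> + t) \<noteq> 0" using norm[of m] unfolding normal_row_def by (simp add: crow_def)
      then show ?thesis using True by (simp add: p_def)
    next
      case False
      then show ?thesis by (simp add: p_def)
    qed
    have bd0: "bf n x ?d0 = x (\<nu> + t) + p * x t" for x
      using bf_pair[OF t, of 1 p x] by (simp add: bf_sym[of n x])
    have orth: "bf n (crow \<xi> i) ?d0 = 0" if i: "i \<in> {1..m}" for i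
    proof (cases "i = 2 * \<nu> - 1")
      case True
      then have im: "i = m" "m = 2 * \<nu> - 1" using i m by auto
      have "odd i" "blk i = t" using True nu_pos by (auto simp: blk_def t_def)
      then have "crow \<xi> i t = 1" using norm[OF i] unfolding normal_row_def by simp
      then show ?thesis
        unfolding bd0 unfolding p_def using im by (simp add: crow_def)
    next
      case False
      have "Suc (blk i) \<le> t" using False i m unfolding blk_def t_def by auto
      then have "high (Suc (blk i)) t" "high (Suc (blk i)) (\<nu> + t)" using t by (simp_all add: high_simps)
      then have "crow \<xi> i t = 0" "crow \<xi> i (\<nu> + t) = 0"
        using norm[OF i] nu_lt[OF t] unfolding normal_row_def by blast+
      then show ?thesis unfolding bd0 by simp
    qed
    note gO = reflprod_orthogonal[OF two g]
    \<comment> \<open>Transported by \<open>g\<close>, so as to be orthogonal to the vectors of the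
      translated tuple at which \<open>Y\<close> is nonzero.\<close>
    define d where "d = mv n g ?d0"
    have qd: "qf n d \<noteq> 0"
      unfolding d_def qf_orthogonal[OF gO] qf_pair[OF t] using p0 by simp
    let ?v = "act_pt n g \<xi>"
    have bd: "bf n (crow ?v i) d = 0" if "i \<in> {1..m}" for i
    proof -
      have "bf n (crow ?v i) d = bf n (mv n g (crow \<xi> i)) (mv n g ?d0)"
        unfolding d_def by (rule bf_cong) (simp_all add: crow_act_pt)
      then show ?thesis unfolding bf_orthogonal[OF two gO] orth[OF that] .
    qed
    have fixed: "act_pt n (refl_mat n d) ?v (i, a) = ?v (i, a)" if "i \<in> {1..m}" "a < n" for i a
    proof -
      have "act_pt n (refl_mat n d) ?v (i, a) = crow ?v i a - bf n (crow ?v i) d / qf n d * d a"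
        using that by (simp add: act_pt_def[of n "refl_mat n d"] mv_refl_mat reflect_def)
      then show ?thesis unfolding bd[OF that(1)] by (simp add: crow_def)
    qed
    \<comment> \<open>As a product of two reflections \<open>?h\<close> fixes \<open>f\<close>,
      while on the vectors of \<open>?v\<close> it acts like \<open>?r\<close> alone; this forces
      \<open>Y\<close> to vanish at \<open>?v\<close>.\<close>
    let ?h = "?r * refl_mat n d"
    have "?h \<in> special_orthogonal_group n" using even_reflprod_special[OF reflprod_refl[OF c]] qd by simp
    then have h: "?h \<in> orthogonal_group n" "ratfun_act ?h f = f"
      using f special_orthogonal_subset unfolding invariant_field_def by blast+
    have eq: "lin_subst ?h P * R = P * lin_subst ?h R"
      using h(2) unfolding PR(1) ratfun_act_fixed_iff[OF orthogonal_groupD[OF h(1)] PR(2)] .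
    have same: "ev ?v (lin_subst ?h p) = ev ?v (lin_subst ?r p)" if p: "vars p \<subseteq> {1..m} \<times> {..<n}" for p
    proof -
      have "ev ?v (lin_subst ?h p) = ev (act_pt n ?r (act_pt n (refl_mat n d) ?v)) p"
        unfolding eval_lin_subst[OF orthogonal_groupD(1)[OF h(1)]]
          act_pt_mult[OF refl_mat_carrier refl_mat_carrier] ..
      also have "\<dots> = ev (act_pt n ?r ?v) p"
      proof (rule poly_eval_cong)
        fix x assume "x \<in> vars p"
        then obtain i a where x: "x = (i, a)" "i \<in> {1..m}" "a < n" using p by blast
        have "mv n ?r (crow (act_pt n (refl_mat n d) ?v) i) = mv n ?r (crow ?v i)"
          by (rule mv_cong) (simp only: crow_def fixed[OF x(2)])
        then show "act_pt n ?r (act_pt n (refl_mat n d) ?v) x = act_pt n ?r ?v x"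
          using x by (simp add: act_pt_def[of n ?r])
      qed
      finally show ?thesis unfolding eval_lin_subst[OF refl_mat_carrier] .
    qed
    have "ev ?v (lin_subst ?h P) * ev ?v R = ev ?v P * ev ?v (lin_subst ?h R)"
      using arg_cong[OF eq, of "ev ?v"] by (simp only: eval_simps)
    then have "ev ?v Y = 0"
      unfolding Y_def same[OF PR(3)] same[OF PR(4)] by (simp only: eval_simps) simp
    then show False using Y by simp
  qed
  then show ?thesis unfolding Y_def PR(1) ratfun_act_fixed_iff[OF rG PR(2)] by simp
qed

theorem KSO_eq_KO: "m < 2 * \<nu> \<Longrightarrow> KSO = KO"
proof (intro Set.equalityI KO_subset_KSO subsetI)
  fix f assume m: "m < 2 * \<nu>" and f: "f \<in> KSO"
  show "f \<in> KO"
  proof (rule invariant_fieldI_reflprod)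
    show "f \<in> ratfun_field n m" using f unfolding invariant_field_def by blast
    fix b g assume g: "reflprod n b (g :: 'k mat)"
    have c: "qf n (pair 0 1 1) \<noteq> (0::'k)" using nu_pos by (simp add: qf_pair)
    show "ratfun_act g f = f"
      using special_invariants_reflprod[OF f g c] special_invariants_refl[OF m f c] by simp
  qed
qed

end

theorem theorem4p5:
  fixes \<nu> m :: nat
  assumes "CHAR('k::alg_closed_field) = 2" and "\<nu> \<ge> 1" and "m \<ge> 1"
  shows
    "(alg_independent (gens_QB \<nu> m) (gen_val (2 * \<nu>) :: gen \<Rightarrow> 'k ratfun) \<and>
      (invariant_field (orthogonal_group (2 * \<nu>)) (2 * \<nu>) m :: 'k ratfun set) =
        generate_field class_ring (range const \<union> gen_val (2 * \<nu>) ` gens_QB \<nu> m)) \<and>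
    ((m < 2 * \<nu> \<longrightarrow>
        (invariant_field (special_orthogonal_group (2 * \<nu>)) (2 * \<nu>) m :: 'k ratfun set) =
        invariant_field (orthogonal_group (2 * \<nu>)) (2 * \<nu>) m) \<and>
      (m \<ge> 2 * \<nu> \<longrightarrow>
        ring.dimension class_ring 2
          (invariant_field (orthogonal_group (2 * \<nu>)) (2 * \<nu>) m :: 'k ratfun set)
          (invariant_field (special_orthogonal_group (2 * \<nu>)) (2 * \<nu>) m) \<and>
        (invariant_field (special_orthogonal_group (2 * \<nu>)) (2 * \<nu>) m :: 'k ratfun set) =
          generate_field class_ring
            (invariant_field (orthogonal_group (2 * \<nu>)) (2 * \<nu>) m \<union> {Delta \<nu>}))) \<and>
    (alg_independent (gens_QB \<nu> m \<union> gens_D \<nu> m)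
        (gen_val (2 * \<nu> + 1) :: gen \<Rightarrow> 'k ratfun) \<and>
      (invariant_field (special_orthogonal_group (2 * \<nu> + 1)) (2 * \<nu> + 1) m :: 'k ratfun set) =
        generate_field class_ring
          (range const \<union> gen_val (2 * \<nu> + 1) ` (gens_QB \<nu> m \<union> gens_D \<nu> m)))"
proof -
  have two: "(2::'k) = 0" by (rule two_eq_0[OF assms(1)])
  interpret even: even_orth_inv "2 * \<nu>" \<nu> m "TYPE('k)"
    by unfold_locales (use two assms(2) in simp_all)
  interpret odd: orth_inv "2 * \<nu> + 1" \<nu> m "TYPE('k)"
    by unfold_locales (use two assms(2) in simp_all)
  have ge: "even.gens = gens_QB \<nu> m" and go: "odd.gens = gens_QB \<nu> m \<union> gens_D \<nu> m"
    unfolding even.gens_def odd.gens_def by simp_all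
  show ?thesis
    using even.gens_independent even.orthogonal_invariants even.KSO_eq_KO even.dimension_KSO even.KSO_generated
      odd.gens_independent odd.odd_special_orthogonal_invariants[OF refl]
    unfolding ge go by (intro conjI impI)
qed

end
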